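(* Let $\tau>0$ and let $\lambda,\lambda_0\in L^\infty(\mathbb{R})$. Assume that, for some constant $\alpha_0>0$, $\lambda_0(x)\ge\alpha_0$ for a.e. $x\in\mathbb{R}$. Assume that there exist a positive constant $\alpha$ and a function $\beta\in L^p(\mathbb{R})$, for some $1\le p<\infty$, such that $$\frac{e^\tau+1}{2}|\lambda(x)|\le\alpha+\beta(x)\quad\text{for a.e. }x\in\mathbb{R}$$ with $$0\le\alpha<\alpha_0\quad\text{and}\quad\|\beta\|_p<\Big(\frac{\alpha_0-\alpha}{c_p}\Big)^{1-\frac1{2p}},\qquad c_p:=\Big(1-\frac1{2p}\Big)\Big(\frac2p\Big)^{\frac1{2p-1}}.$$ Then the problem $$\begin{cases} u_t(x,t)+u_{xxx}(x,t)-u_{xx}(x,t)+\lambda_0(x)u(x,t)+\lambda(x)u(x,t-\tau)=0 & \text{in } \mathbb{R}\times(0,\infty),\\ u(x,s)=u_0(x,s) & \text{in } \mathbb{R}\times[-\tau,0] \end{cases}$$ is exponentially stable. In particular, for every $u_0\in C([-\tau,0];L^2(\mathbb{R}))$ the solution $u$ satisfies $$\mathcal{E}(t)\le C(u_0)e^{-\gamma t}\quad\text{for all }t\ge0,$$ where $$\gamma=\min\Big\{2\Big(\alpha_0-\alpha-\frac{2p-1}{2p}\Big(\frac2p\Big)^{\frac1{2p-1}}\|\beta\|_p^{\frac{2p}{2p-1}}\Big),\,1\Big\}$$ and $$C(u_0)=\mathcal{E}(0)=\frac12\|u_0(\cdot,0)\|_2^2+\frac12\int_{-\tau}^0e^s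\int_{\mathbb{R}}|\lambda(x)|u_0^2(x,s)\,dx\,ds.$$
   Context: All functions are real-valued; $\|\cdot\|_p$ is the norm of $L^p(\mathbb{R})$. For $t\ge0$, $$\mathcal{E}(t):=\frac12\int_{\mathbb{R}}u^2(x,t)\,dx+\frac12\int_{t-\tau}^t\int_{\mathbb{R}}e^{-(t-s)}|\lambda(x)|u^2(x,s)\,dx\,ds,$$ where $u=u_0$ on $[-\tau,0]$. The operator $A_{\lambda_0}u:=-u_{xxx}+u_{xx}-\lambda_0u$, $\mathcal{D}(A_{\lambda_0})=H^3(\mathbb{R})$, generates a strongly continuous semigroup $(S(t))_{t\ge0}$ in $L^2(\mathbb{R})$ (known). The solution is the unique mild solution $u\in C([-\tau,\infty);L^2(\mathbb{R}))$: $u=u_0$ on $[-\tau,0]$ and $u(t)=S(t)u_0(0)-\int_0^tS(t-s)\lambda u(s-\tau)\,ds$ for $t\ge0$. Exponentially stable means that $\mathcal{E}$ decays exponentially along all solutions: there is $\gamma>0$ such that every solution satisfies $\mathcal{E}(t)\le Ce^{-\gamma t}$ for all $t\ge0$, with $C$ depending only on the initial datum $u_0$. *)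

theory Defs
  imports "HOL-Analysis.Analysis"
begin

section \<open>The Lebesgue spaces on the real line\<close>

definition in_Linf :: "(real \<Rightarrow> real) \<Rightarrow> bool" where
  "in_Linf m \<longleftrightarrow> m \<in> borel_measurable lebesgue \<and> (\<exists>C. AE x in lebesgue. \<bar>m x\<bar> \<le> C)"

definition in_Lp :: "real \<Rightarrow> (real \<Rightarrow> real) \<Rightarrow> bool" where
  "in_Lp p f \<longleftrightarrow> f \<in> borel_measurable lebesgue \<and> integrable lebesgue (\<lambda>x. \<bar>f x\<bar> powr p)"

definition Lp_norm :: "real \<Rightarrow> (real \<Rightarrow> real) \<Rightarrow> real" where
  "Lp_norm p f = (LINT x|lebesgue. \<bar>f x\<bar> powr p) powr (1 / p)"

definition square_integrable :: "(real \<Rightarrow> real) \<Rightarrow> bool" where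
  "square_integrable f \<longleftrightarrow> f \<in> borel_measurable lebesgue \<and> integrable lebesgue (\<lambda>x. (f x)\<^sup>2)"

lemma square_integrable_measurable [measurable_dest]:
  "square_integrable f \<Longrightarrow> f \<in> borel_measurable lebesgue"
  by (simp add: square_integrable_def)

lemma square_integrable_mult:
  assumes f: "square_integrable f" and g: "square_integrable g"
  shows "integrable lebesgue (\<lambda>x. f x * g x)"
proof (rule Bochner_Integration.integrable_bound)
  show "integrable lebesgue (\<lambda>x. (f x)\<^sup>2 + (g x)\<^sup>2)"
    using assms by (simp add: square_integrable_def)
  show "(\<lambda>x. f x * g x) \<in> borel_measurable lebesgue"
    using assms by measurable
  have "\<bar>a * b\<bar> \<le> a\<^sup>2 + b\<^sup>2" for a b :: real
  proof -
    have "2 * (\<bar>a\<bar> * \<bar>b\<bar>) \<le> a\<^sup>2 + b\<^sup>2"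
      using sum_squares_bound[of "\<bar>a\<bar>" "\<bar>b\<bar>"] by simp
    moreover have "0 \<le> \<bar>a\<bar> * \<bar>b\<bar>" by simp
    ultimately show ?thesis unfolding abs_mult by linarith
  qed
  then show "AE x in lebesgue. norm (f x * g x) \<le> norm ((f x)\<^sup>2 + (g x)\<^sup>2)"
    by simp
qed

lemma square_integrable_add:
  assumes f: "square_integrable f" and g: "square_integrable g"
  shows "square_integrable (\<lambda>x. f x + g x)"
proof -
  have "integrable lebesgue (\<lambda>x. (f x)\<^sup>2 + (g x)\<^sup>2 + 2 * (f x * g x))"
    using assms square_integrable_mult[OF f g] by (simp add: square_integrable_def)
  then have "integrable lebesgue (\<lambda>x. (f x + g x)\<^sup>2)"
    by (simp add: power2_sum mult.assoc)
  moreover have "(\<lambda>x. f x + g x) \<in> borel_measurable lebesgue"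
    using assms by measurable
  ultimately show ?thesis
    by (simp add: square_integrable_def)
qed

lemma square_integrable_scale:
  "square_integrable f \<Longrightarrow> square_integrable (\<lambda>x. c * f x)"
  by (auto intro: borel_measurable_times simp: square_integrable_def power_mult_distrib)

lemma square_integrable_uminus:
  "square_integrable f \<Longrightarrow> square_integrable (\<lambda>x. - f x)"
  by (auto simp: square_integrable_def)

lemma square_integrable_diff:
  "square_integrable f \<Longrightarrow> square_integrable g \<Longrightarrow> square_integrable (\<lambda>x. f x - g x)"
  using square_integrable_add[OF _ square_integrable_uminus, of f g] by simp

lemma square_integrable_zero: "square_integrable (\<lambda>x. 0)"
  by (simp add: square_integrable_def)

definition L2_eq :: "(real \<Rightarrow> real) \<Rightarrow> (real \<Rightarrow> real) \<Rightarrow> bool" where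
  "L2_eq f g \<longleftrightarrow> square_integrable f \<and> square_integrable g \<and> (AE x in lebesgue. f x = g x)"

(* For a class f in L2, rep_L2 f is some representative of it; for a square-integrable
   function g, abs_L2 g is its class. *)
quotient_type L2 = "real \<Rightarrow> real" / partial: L2_eq
  morphisms rep_L2 abs_L2
proof (rule part_equivpI)
  show "\<exists>f. L2_eq f f"
    using square_integrable_zero by (auto simp: L2_eq_def)
  show "symp L2_eq"
    by (auto simp: symp_def L2_eq_def)
  show "transp L2_eq"
    by (auto simp: transp_def L2_eq_def elim: eventually_elim2)
qed

instantiation L2 :: real_inner
begin

lift_definition zero_L2 :: L2 is "\<lambda>x. 0"
  by (simp add: L2_eq_def square_integrable_zero)

lift_definition plus_L2 :: "L2 \<Rightarrow> L2 \<Rightarrow> L2" is "\<lambda>f g x. f x + g x"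
  by (auto simp: L2_eq_def square_integrable_add elim: eventually_elim2)

lift_definition uminus_L2 :: "L2 \<Rightarrow> L2" is "\<lambda>f x. - f x"
  by (auto simp: L2_eq_def square_integrable_uminus elim: eventually_mono)

lift_definition minus_L2 :: "L2 \<Rightarrow> L2 \<Rightarrow> L2" is "\<lambda>f g x. f x - g x"
  by (auto simp: L2_eq_def square_integrable_diff elim: eventually_elim2)

lift_definition scaleR_L2 :: "real \<Rightarrow> L2 \<Rightarrow> L2" is "\<lambda>c f x. c * f x"
  by (auto simp: L2_eq_def square_integrable_scale elim: eventually_mono)

lift_definition inner_L2 :: "L2 \<Rightarrow> L2 \<Rightarrow> real" is "\<lambda>f g. LINT x|lebesgue. f x * g x"
proof -
  fix f f' g g' assume *: "L2_eq f f'" "L2_eq g g'"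
  have "AE x in lebesgue. f x * g x = f' x * g' x"
    using * by (auto simp: L2_eq_def elim: eventually_elim2)
  moreover have "(\<lambda>x. f x * g x) \<in> borel_measurable lebesgue"
    "(\<lambda>x. f' x * g' x) \<in> borel_measurable lebesgue"
    using * by (auto simp: L2_eq_def square_integrable_def)
  ultimately show "(LINT x|lebesgue. f x * g x) = (LINT x|lebesgue. f' x * g' x)"
    by (intro integral_cong_AE) auto
qed

definition norm_L2 :: "L2 \<Rightarrow> real" where "norm_L2 f = sqrt (inner f f)"
definition sgn_L2 :: "L2 \<Rightarrow> L2" where "sgn_L2 f = inverse (norm f) *\<^sub>R f"
definition dist_L2 :: "L2 \<Rightarrow> L2 \<Rightarrow> real" where "dist_L2 f g = norm (f - g)"
definition uniformity_L2 :: "(L2 \<times> L2) filter" where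
  "uniformity_L2 = (INF e\<in>{0<..}. principal {(f, g). dist f g < e})"
definition open_L2 :: "L2 set \<Rightarrow> bool" where
  "open_L2 U \<longleftrightarrow> (\<forall>f\<in>U. eventually (\<lambda>(f', g). f' = f \<longrightarrow> g \<in> U) uniformity)"

instance
proof
  fix f g h :: L2 and a b :: real
  show "f + g + h = f + (g + h)"
    by transfer (auto simp: L2_eq_def algebra_simps intro!: square_integrable_add)
  show "f + g = g + f"
    by transfer (auto simp: L2_eq_def algebra_simps intro!: square_integrable_add)
  show "0 + f = f"
    by transfer (auto simp: L2_eq_def)
  show "- f + f = 0"
    by transfer (auto simp: L2_eq_def square_integrable_zero)
  show "f - g = f + - g"
    by transfer (auto simp: L2_eq_def intro!: square_integrable_diff)
  show "a *\<^sub>R (f + g) = a *\<^sub>R f + a *\<^sub>R g"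
    by transfer (auto simp: L2_eq_def algebra_simps intro!: square_integrable_add square_integrable_scale)
  show "(a + b) *\<^sub>R f = a *\<^sub>R f + b *\<^sub>R f"
    by transfer (auto simp: L2_eq_def algebra_simps intro!: square_integrable_add square_integrable_scale)
  show "a *\<^sub>R b *\<^sub>R f = (a * b) *\<^sub>R f"
    by transfer (auto simp: L2_eq_def algebra_simps intro!: square_integrable_scale)
  show "1 *\<^sub>R f = f"
    by transfer (auto simp: L2_eq_def)
  show "sgn f = inverse (norm f) *\<^sub>R f" by (rule sgn_L2_def)
  show "dist f g = norm (f - g)" by (rule dist_L2_def)
  show "(uniformity :: (L2 \<times> L2) filter) = (INF e\<in>{0<..}. principal {(f, g). dist f g < e})"
    by (rule uniformity_L2_def)
  show "open U \<longleftrightarrow> (\<forall>f\<in>U. eventually (\<lambda>(f', g). f' = f \<longrightarrow> g \<in> U) uniformity)" for U :: "L2 set"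
    by (rule open_L2_def)
  show "inner f g = inner g f"
    by transfer (simp add: mult.commute)
  show "inner (f + g) h = inner f h + inner g h"
    by transfer (simp add: L2_eq_def distrib_right square_integrable_mult)
  show "inner (a *\<^sub>R f) g = a * inner f g"
    by transfer (simp add: L2_eq_def mult.assoc)
  show "0 \<le> inner f f"
    by transfer simp
  show "inner f f = 0 \<longleftrightarrow> f = 0"
  proof transfer
    fix f assume "L2_eq f f"
    then have f: "square_integrable f" by (simp add: L2_eq_def)
    have "(LINT x|lebesgue. f x * f x) = 0 \<longleftrightarrow> (AE x in lebesgue. f x * f x = 0)"
      using square_integrable_mult[OF f f] by (intro integral_nonneg_eq_0_iff_AE) auto
    then show "(LINT x|lebesgue. f x * f x) = 0 \<longleftrightarrow> L2_eq f (\<lambda>x. 0)"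
      using f by (simp add: L2_eq_def square_integrable_zero)
  qed
  show "norm f = sqrt (inner f f)" by (rule norm_L2_def)
qed

end

lemma square_integrable_rep_L2: "square_integrable (rep_L2 f)"
  using Quotient3_rep_reflp[OF Quotient3_L2, of f] by (simp add: L2_eq_def)

lemma abs_rep_L2: "abs_L2 (rep_L2 f) = f"
  by (rule Quotient3_abs_rep[OF Quotient3_L2])

lemma rep_abs_L2:
  assumes "square_integrable f"
  shows "AE x in lebesgue. rep_L2 (abs_L2 f) x = f x"
proof -
  have "L2_eq (rep_L2 (abs_L2 f)) f"
    using Quotient3_rep_abs[OF Quotient3_L2, of f] assms by (simp add: L2_eq_def)
  then show ?thesis by (simp add: L2_eq_def)
qed

lemma norm_abs_L2:
  assumes "square_integrable f"
  shows "(norm (abs_L2 f))\<^sup>2 = (LINT x|lebesgue. (f x)\<^sup>2)"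
  using assms
  by (simp add: norm_L2_def inner_L2.abs_eq L2_eq_def power2_eq_square)

lemma norm_L2_eq: "(norm f)\<^sup>2 = (LINT x|lebesgue. (rep_L2 f x)\<^sup>2)"
  using norm_abs_L2[OF square_integrable_rep_L2, of f] by (simp add: abs_rep_L2)

lemma diff_abs_L2:
  assumes "square_integrable f" "square_integrable g"
  shows "abs_L2 f - abs_L2 g = abs_L2 (\<lambda>x. f x - g x)"
  using assms by (simp add: minus_L2.abs_eq L2_eq_def)

lemma nn_integral_diff_L2:
  "(\<integral>\<^sup>+x. ennreal ((rep_L2 f x - rep_L2 g x)\<^sup>2) \<partial>lebesgue) = ennreal ((norm (f - g))\<^sup>2)"
proof -
  let ?d = "\<lambda>x. rep_L2 f x - rep_L2 g x"
  have d: "square_integrable ?d"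
    by (intro square_integrable_diff square_integrable_rep_L2)
  have "f - g = abs_L2 ?d"
    using diff_abs_L2[OF square_integrable_rep_L2 square_integrable_rep_L2, of f g]
    by (simp add: abs_rep_L2)
  then have "(norm (f - g))\<^sup>2 = (LINT x|lebesgue. (?d x)\<^sup>2)"
    using norm_abs_L2[OF d] by simp
  then show ?thesis
    using d by (subst nn_integral_eq_integral) (auto simp: square_integrable_def)
qed

text \<open>The Riesz--Fischer theorem.\<close>

lemma AE_convergent_fast_L2:
  fixes Y :: "nat \<Rightarrow> L2"
  assumes Y: "\<And>i. norm (Y (Suc i) - Y i) \<le> (1/2) ^ i"
  shows "AE x in lebesgue. convergent (\<lambda>i. rep_L2 (Y i) x)"
proof -
  define d where "d i x = rep_L2 (Y (Suc i)) x - rep_L2 (Y i) x" for i x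
  have m [measurable]: "rep_L2 f \<in> borel_measurable lebesgue" for f
    by (intro square_integrable_measurable square_integrable_rep_L2)
  have dm [measurable]: "d i \<in> borel_measurable lebesgue" for i
    unfolding d_def[abs_def] by measurable
  have int: "(\<integral>\<^sup>+x. ennreal (2^i * (d i x)\<^sup>2) \<partial>lebesgue) \<le> ennreal ((1/2)^i)" for i
  proof -
    have "(\<integral>\<^sup>+x. ennreal (2^i * (d i x)\<^sup>2) \<partial>lebesgue)
        = ennreal (2^i) * (\<integral>\<^sup>+x. ennreal ((d i x)\<^sup>2) \<partial>lebesgue)"
      by (simp add: ennreal_mult nn_integral_cmult)
    also have "\<dots> = ennreal (2^i * (norm (Y (Suc i) - Y i))\<^sup>2)"
      by (simp add: d_def nn_integral_diff_L2 ennreal_mult)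
    also have "\<dots> \<le> ennreal ((1/2)^i)"
    proof (rule ennreal_leI)
      have "2^i * (norm (Y (Suc i) - Y i))\<^sup>2 \<le> 2^i * ((1/2)^i)\<^sup>2"
        using Y[of i] by (intro mult_left_mono power_mono) auto
      also have "\<dots> = (1/2)^i"
        by (simp add: power2_eq_square power_one_over)
      finally show "2^i * (norm (Y (Suc i) - Y i))\<^sup>2 \<le> (1/2)^i" .
    qed
    finally show ?thesis .
  qed
  have "(\<integral>\<^sup>+x. (\<Sum>i. ennreal (2^i * (d i x)\<^sup>2)) \<partial>lebesgue)
      = (\<Sum>i. \<integral>\<^sup>+x. ennreal (2^i * (d i x)\<^sup>2) \<partial>lebesgue)"
    by (rule nn_integral_suminf) measurable
  also have "\<dots> \<le> (\<Sum>i. ennreal ((1/2)^i))"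
    using int by (intro suminf_le) auto
  also have "\<dots> = ennreal (\<Sum>i. (1/2)^i)"
    by (intro suminf_ennreal2 summable_geometric) auto
  finally have "(\<integral>\<^sup>+x. (\<Sum>i. ennreal (2^i * (d i x)\<^sup>2)) \<partial>lebesgue) \<noteq> \<infinity>"
    by (auto simp: top_unique)
  then have "AE x in lebesgue. (\<Sum>i. ennreal (2^i * (d i x)\<^sup>2)) \<noteq> \<infinity>"
    by (intro nn_integral_noteq_infinite) auto
  then show ?thesis
  proof eventually_elim
    case (elim x)
    then have s: "summable (\<lambda>i. 2^i * (d i x)\<^sup>2)"
      by (intro summable_suminf_not_top) auto
    then obtain M where M: "\<And>i. norm (2^i * (d i x)\<^sup>2) \<le> M" and "M > 0"
      using summable_imp_Bseq[OF s] by (auto simp: Bseq_def)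
    have b: "norm (d i x) \<le> sqrt M * (sqrt (1/2))^i" for i
    proof -
      have "(d i x)\<^sup>2 \<le> M * (1/2)^i"
        using M[of i] by (simp add: field_simps power_one_over)
      then have "sqrt ((d i x)\<^sup>2) \<le> sqrt (M * (1/2)^i)"
        by (rule real_sqrt_le_mono)
      then have "norm (d i x) \<le> sqrt (M * (1/2)^i)"
        by (simp only: real_sqrt_abs real_norm_def)
      then show ?thesis
        by (simp only: real_sqrt_mult real_sqrt_power)
    qed
    have "summable (\<lambda>i. sqrt M * (sqrt (1/2))^i)"
      by (intro summable_mult summable_geometric) (simp add: real_sqrt_divide)
    then have "summable (\<lambda>i. d i x)"
      using b by (rule summable_comparison_test'[where N = 0])
    then have "convergent (\<lambda>n. \<Sum>i<n. d i x)"
      by (simp add: summable_iff_convergent)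
    moreover have "(\<Sum>i<n. d i x) = rep_L2 (Y n) x - rep_L2 (Y 0) x" for n
      unfolding d_def by (rule sum_lessThan_telescope)
    ultimately have "convergent (\<lambda>n. rep_L2 (Y n) x - rep_L2 (Y 0) x + rep_L2 (Y 0) x)"
      by (intro convergent_add convergent_const) auto
    then show ?case by simp
  qed
qed

instance L2 :: banach
proof
  fix X :: "nat \<Rightarrow> L2" assume X: "Cauchy X"
  have m [measurable]: "rep_L2 f \<in> borel_measurable lebesgue" for f
    by (intro square_integrable_measurable square_integrable_rep_L2)
  have "\<exists>N. \<forall>m\<ge>N. \<forall>n\<ge>N. norm (X m - X n) < (1/2)^i" for i :: nat
    using X by (auto simp: Cauchy_iff)
  then obtain N where N: "\<And>i m n. m \<ge> N i \<Longrightarrow> n \<ge> N i \<Longrightarrow> norm (X m - X n) < (1/2)^i"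
    by metis
  define r where "r i = (\<Sum>j\<le>i. N j) + i" for i
  have r: "r i \<ge> N i" "r (Suc i) \<ge> N i" "r i \<ge> i" for i
  proof -
    have "N i \<le> (\<Sum>j\<le>i. N j)" by (intro member_le_sum) auto
    then show "r i \<ge> N i" "r (Suc i) \<ge> N i" by (auto simp: r_def)
    show "r i \<ge> i" by (simp add: r_def)
  qed
  define Y where "Y i = X (r i)" for i
  have "norm (Y (Suc i) - Y i) \<le> (1/2)^i" for i
    unfolding Y_def using N[OF r(2) r(1), of i] by simp
  then have conv: "AE x in lebesgue. convergent (\<lambda>i. rep_L2 (Y i) x)"
    by (rule AE_convergent_fast_L2)
  define f where "f x = lim (\<lambda>i. rep_L2 (Y i) x)" for x
  have fm [measurable]: "f \<in> borel_measurable lebesgue"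
    unfolding f_def[abs_def] by measurable
  have fatou: "(\<integral>\<^sup>+x. ennreal ((f x - rep_L2 (X n) x)\<^sup>2) \<partial>lebesgue) \<le> ennreal (((1/2)^i)\<^sup>2)"
    if n: "n \<ge> N i" for n i
  proof -
    have "(\<integral>\<^sup>+x. ennreal ((f x - rep_L2 (X n) x)\<^sup>2) \<partial>lebesgue)
        = (\<integral>\<^sup>+x. liminf (\<lambda>k. ennreal ((rep_L2 (Y k) x - rep_L2 (X n) x)\<^sup>2)) \<partial>lebesgue)"
      using conv
    proof (intro nn_integral_cong_AE, eventually_elim)
      case (elim x)
      then have "(\<lambda>k. rep_L2 (Y k) x) \<longlonglongrightarrow> f x"
        by (simp add: f_def convergent_LIMSEQ_iff)
      then have "(\<lambda>k. ennreal ((rep_L2 (Y k) x - rep_L2 (X n) x)\<^sup>2))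
          \<longlonglongrightarrow> ennreal ((f x - rep_L2 (X n) x)\<^sup>2)"
        by (intro tendsto_intros)
      then show ?case
        by (intro lim_imp_Liminf[symmetric]) auto
    qed
    also have "\<dots> \<le> liminf (\<lambda>k. \<integral>\<^sup>+x. ennreal ((rep_L2 (Y k) x - rep_L2 (X n) x)\<^sup>2) \<partial>lebesgue)"
      by (rule nn_integral_liminf) measurable
    also have "\<dots> = liminf (\<lambda>k. ennreal ((norm (Y k - X n))\<^sup>2))"
      by (simp add: nn_integral_diff_L2)
    also have "\<dots> \<le> ennreal (((1/2)^i)\<^sup>2)"
    proof -
      have "eventually (\<lambda>k. ennreal ((norm (Y k - X n))\<^sup>2) \<le> ennreal (((1/2)^i)\<^sup>2)) sequentially"
        using eventually_ge_at_top[of "N i"]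
      proof eventually_elim
        case (elim k)
        then have "r k \<ge> N i" using r(3)[of k] by linarith
        then have "norm (Y k - X n) < (1/2)^i" unfolding Y_def using N n by blast
        then show ?case by (intro ennreal_leI power_mono) auto
      qed
      then show ?thesis
        by (intro order_trans[OF Liminf_le_Limsup Limsup_bounded]) auto
    qed
    finally show ?thesis .
  qed
  have f: "square_integrable f"
  proof -
    have "integrable lebesgue (\<lambda>x. (f x - rep_L2 (X (N 0)) x)\<^sup>2)"
      using fatou[of 0 "N 0"] by (intro integrableI_nonneg) (auto simp: le_less_trans)
    then have "square_integrable (\<lambda>x. f x - rep_L2 (X (N 0)) x)"
      by (simp add: square_integrable_def)
    from square_integrable_add[OF this square_integrable_rep_L2[of "X (N 0)"]]
    show ?thesis by simp
  qed
  have le: "norm (X n - abs_L2 f) \<le> (1/2)^i" if n: "n \<ge> N i" for n i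
  proof -
    have d: "square_integrable (\<lambda>x. f x - rep_L2 (X n) x)"
      by (intro square_integrable_diff f square_integrable_rep_L2)
    have "abs_L2 f - X n = abs_L2 (\<lambda>x. f x - rep_L2 (X n) x)"
      using diff_abs_L2[OF f square_integrable_rep_L2, of "X n"] by (simp add: abs_rep_L2)
    then have "(norm (X n - abs_L2 f))\<^sup>2 = (LINT x|lebesgue. (f x - rep_L2 (X n) x)\<^sup>2)"
      using norm_abs_L2[OF d] by (simp add: norm_minus_commute)
    then have "ennreal ((norm (X n - abs_L2 f))\<^sup>2) \<le> ennreal (((1/2)^i)\<^sup>2)"
      using fatou[OF n] d
      by (subst (asm) nn_integral_eq_integral) (auto simp: square_integrable_def)
    then have "(norm (X n - abs_L2 f))\<^sup>2 \<le> ((1/2)^i)\<^sup>2"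
      by (subst (asm) ennreal_le_iff) auto
    then show ?thesis by (rule power2_le_imp_le) simp
  qed
  have "X \<longlonglongrightarrow> abs_L2 f"
  proof (rule LIMSEQ_I)
    fix e :: real assume "e > 0"
    then obtain i where "(1/2)^i < e"
      using real_arch_pow_inv[of e "1/2"] by auto
    then show "\<exists>n0. \<forall>n\<ge>n0. norm (X n - abs_L2 f) < e"
      using le by (intro exI[of _ "N i"]) (auto intro: le_less_trans)
  qed
  then show "convergent X" by (auto simp: convergent_def)
qed

(* Multiplication by a function m in L^infinity (a junk value for other m). *)
definition L2_mult :: "(real \<Rightarrow> real) \<Rightarrow> L2 \<Rightarrow> L2" where
  "L2_mult m f = abs_L2 (\<lambda>x. m x * rep_L2 f x)"

lemma rep_L2_mult:
  assumes "in_Linf m"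
  shows "AE x in lebesgue. rep_L2 (L2_mult m f) x = m x * rep_L2 f x"
proof -
  obtain C where C: "AE x in lebesgue. \<bar>m x\<bar> \<le> C" and m: "m \<in> borel_measurable lebesgue"
    using assms by (auto simp: in_Linf_def)
  have f: "square_integrable (rep_L2 f)" by (rule square_integrable_rep_L2)
  have mf [measurable]: "(\<lambda>x. m x * rep_L2 f x) \<in> borel_measurable lebesgue"
    using m f by measurable
  have "integrable lebesgue (\<lambda>x. (m x * rep_L2 f x)\<^sup>2)"
  proof (rule Bochner_Integration.integrable_bound)
    show "integrable lebesgue (\<lambda>x. C\<^sup>2 * (rep_L2 f x)\<^sup>2)"
      using f by (simp add: square_integrable_def)
    show "(\<lambda>x. (m x * rep_L2 f x)\<^sup>2) \<in> borel_measurable lebesgue"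
      by measurable
    show "AE x in lebesgue. norm ((m x * rep_L2 f x)\<^sup>2) \<le> norm (C\<^sup>2 * (rep_L2 f x)\<^sup>2)"
      using C
    proof eventually_elim
      case (elim x)
      then have "(m x)\<^sup>2 \<le> C\<^sup>2" using power_mono[of "\<bar>m x\<bar>" C 2] by simp
      then show ?case by (simp add: power_mult_distrib mult_right_mono)
    qed
  qed
  then show ?thesis
    unfolding L2_mult_def using mf by (intro rep_abs_L2) (simp add: square_integrable_def)
qed


section \<open>Sobolev spaces on the real line\<close>

definition test_function :: "(real \<Rightarrow> real) \<Rightarrow> bool" where
  "test_function \<phi> \<longleftrightarrow>
     (\<forall>n x. (deriv ^^ n) \<phi> field_differentiable at x) \<and> compact (closure {x. \<phi> x \<noteq> 0})"

definition has_weak_deriv :: "nat \<Rightarrow> L2 \<Rightarrow> L2 \<Rightarrow> bool" where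
  "has_weak_deriv k f g \<longleftrightarrow> (\<forall>\<phi>. test_function \<phi> \<longrightarrow>
     (LINT x|lebesgue. rep_L2 f x * (deriv ^^ k) \<phi> x)
       = (- 1) ^ k * (LINT x|lebesgue. rep_L2 g x * \<phi> x))"

definition sobolev_H :: "nat \<Rightarrow> L2 set" where
  "sobolev_H n = {f. \<forall>k\<le>n. \<exists>g. has_weak_deriv k f g}"


section \<open>Semigroups\<close>

definition C0_semigroup :: "(real \<Rightarrow> 'a \<Rightarrow> 'a::real_normed_vector) \<Rightarrow> bool" where
  "C0_semigroup S \<longleftrightarrow>
     (\<forall>t\<ge>0. bounded_linear (S t)) \<and>
     (\<forall>f. S 0 f = f) \<and>
     (\<forall>s\<ge>0. \<forall>t\<ge>0. \<forall>f. S (s + t) f = S s (S t f)) \<and>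
     (\<forall>f. ((\<lambda>t. S t f) \<longlongrightarrow> f) (at_right 0))"

(* Unbounded operators are represented by their graphs. *)
definition infinitesimal_generator ::
    "(real \<Rightarrow> 'a \<Rightarrow> 'a::real_normed_vector) \<Rightarrow> ('a \<times> 'a) set" where
  "infinitesimal_generator S = {(f, g). ((\<lambda>h. (S h f - f) /\<^sub>R h) \<longlongrightarrow> g) (at_right 0)}"

definition generates_C0_semigroup ::
    "('a \<times> 'a) set \<Rightarrow> (real \<Rightarrow> 'a \<Rightarrow> 'a::real_normed_vector) \<Rightarrow> bool" where
  "generates_C0_semigroup A S \<longleftrightarrow> C0_semigroup S \<and> infinitesimal_generator S = A"

(* The graph of u |-> - u_xxx + u_xx - lam0 u with domain H^3. *)
definition A_op :: "(real \<Rightarrow> real) \<Rightarrow> (L2 \<times> L2) set" where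
  "A_op lam0 = {(u, - u3 + u2 - L2_mult lam0 u) | u u2 u3.
     u \<in> sobolev_H 3 \<and> has_weak_deriv 2 u u2 \<and> has_weak_deriv 3 u u3}"


section \<open>The delayed equation\<close>

(* Mild solutions of u_t + u_xxx - u_xx + lam0 u + lam u(t - tau) = 0, where S is the semigroup
   generated by A_op lam0. Trajectories are maps from time to L2. Only the values of u0 on [-tau, 0] and those of u on
   [-tau, infinity) matter. *)
definition mild_solution ::
    "(real \<Rightarrow> L2 \<Rightarrow> L2) \<Rightarrow> (real \<Rightarrow> real) \<Rightarrow> real \<Rightarrow> (real \<Rightarrow> L2) \<Rightarrow> (real \<Rightarrow> L2) \<Rightarrow> bool" where
  "mild_solution S lam \<tau> u0 u \<longleftrightarrow>
     continuous_on {-\<tau>..} u \<and>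
     (\<forall>t\<in>{-\<tau>..0}. u t = u0 t) \<and>
     (\<forall>t\<ge>0. u t = S t (u0 0) - integral {0..t} (\<lambda>s. S (t - s) (L2_mult lam (u (s - \<tau>)))))"

definition energy :: "(real \<Rightarrow> real) \<Rightarrow> real \<Rightarrow> (real \<Rightarrow> L2) \<Rightarrow> real \<Rightarrow> real" where
  "energy lam \<tau> u t =
     1/2 * (LINT x|lebesgue. (rep_L2 (u t) x)\<^sup>2) +
     1/2 * integral {t - \<tau>..t}
       (\<lambda>s. LINT x|lebesgue. exp (- (t - s)) * \<bar>lam x\<bar> * (rep_L2 (u s) x)\<^sup>2)"

definition exponentially_stable ::
    "(real \<Rightarrow> L2 \<Rightarrow> L2) \<Rightarrow> (real \<Rightarrow> real) \<Rightarrow> real \<Rightarrow> bool" where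
  "exponentially_stable S lam \<tau> \<longleftrightarrow>
     (\<exists>\<gamma>>0. \<forall>u0. continuous_on {-\<tau>..0} u0 \<longrightarrow>
       (\<exists>C. \<forall>u. mild_solution S lam \<tau> u0 u \<longrightarrow>
         (\<forall>t\<ge>0. energy lam \<tau> u t \<le> C * exp (- \<gamma> * t))))"

end

theory Submission
  imports Defs
begin

text \<open>
  Write \<open>E\<close> for the energy and \<open>M\<close> for its memory part. Formally, differentiating the energy along a
  solution and integrating by parts gives

    \<open>E' = - \<parallel>u_x\<parallel>\<^sup>2 - \<integral> \<lambda>\<^sub>0 u\<^sup>2 - \<integral> \<lambda> u(t) u(t - \<tau>) + 1/2 \<integral> |\<lambda>| u(t)\<^sup>2 - 1/2 e^(-\<tau>) \<integral> |\<lambda>| u(t - \<tau>)\<^sup>2 - M\<close>.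

  The dispersive term contributes nothing because the third derivative is skew. Young's inequality
  with weights \<open>e^\<tau>\<close> and \<open>e^(-\<tau>)\<close> absorbs the delayed factor, so that

    \<open>E' \<le> - \<parallel>u_x\<parallel>\<^sup>2 - \<alpha>\<^sub>0 \<parallel>u\<parallel>\<^sup>2 + \<integral> m u\<^sup>2 - M\<close>  with  \<open>m = (e^\<tau> + 1)/2 |\<lambda>| \<le> \<alpha> + \<beta>\<close>.

  In one dimension \<open>sup u\<^sup>2 \<le> 2 \<parallel>u\<parallel> \<parallel>u_x\<parallel>\<close>, and this makes \<open>\<integral> \<beta> u\<^sup>2\<close> a form-small perturbation of
  \<open>\<parallel>u_x\<parallel>\<^sup>2\<close>:

    \<open>\<integral> m u\<^sup>2 \<le> \<parallel>u_x\<parallel>\<^sup>2 + (\<alpha> + \<kappa>) \<parallel>u\<parallel>\<^sup>2\<close>  with  \<open>\<kappa> = (2p-1)/(2p) (2/p)^(1/(2p-1)) \<parallel>\<beta>\<parallel>\<^sub>p^(2p/(2p-1))\<close>.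

  The smallness of \<open>\<parallel>\<beta>\<parallel>\<^sub>p\<close> says exactly that \<open>\<kappa> < \<alpha>\<^sub>0 - \<alpha>\<close>, and \<open>E' \<le> - \<gamma> E\<close> follows.

  A mild solution is known only to be a continuous curve in \<open>L\<^sup>2\<close>, so two points need care.

  In space, the inequality is used only in the form \<open>\<langle>A v, v\<rangle> + \<langle>Q v, v\<rangle> \<le> 0\<close> on the domain of the
  generator, where \<open>Q v = m v + \<delta> v\<close> with \<open>\<delta> = \<alpha>\<^sub>0 - \<alpha> - \<kappa>\<close>. Since \<open>Q\<close> is bounded on \<open>L\<^sup>2\<close>, the consequences
  pass to limits although \<open>\<beta>\<close> is unbounded. On the domain the inequality results from
  \<open>potential_bound\<close> and \<open>A_op_dissipative\<close>, both obtained by approximating a function with a weak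
  derivative by mollified ones together with their derivatives (\<open>H1_dense\<close>); for differentiable
  functions the computations are classical.

  In time, the derivative is replaced by one-sided majorants: a continuous function that near every
  point lies, to the right, below a function touching it with nonpositive right derivative is
  nonincreasing (\<open>decreasing_if_right_majorant\<close>). Applied to orbits in the domain of the generator
  this gives an integrated dissipation inequality, which extends to all orbits by density
  (\<open>dissipation\<close>). Restarting Duhamel's formula at time \<open>t\<close> then turns it into a majorant for
  \<open>1/2 \<parallel>u\<parallel>\<^sup>2\<close> near \<open>t\<close> (\<open>mild_norm_majorant\<close>) whose slope is what the formal computation predicts. A
  second application, to \<open>e^(\<gamma> t) E(t)\<close>, concludes (\<open>energy_decay\<close>).
\<close>

section \<open>Strongly continuous semigroups\<close>

text \<open>
  By Baire's theorem one of the closed sets on which all operators are bounded by a fixed constant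
  contains a ball, and differences of points of this ball fill a ball around the origin.
\<close>

lemma uniform_boundedness_principle:
  fixes T :: "nat \<Rightarrow> 'a::banach \<Rightarrow> 'b::real_normed_vector"
  assumes lin: "\<And>n. bounded_linear (T n)"
    and ptw: "\<And>x. bounded (range (\<lambda>n. T n x))"
  obtains B where "\<And>n x. norm (T n x) \<le> B * norm x"
proof -
  define F where "F k = {x. \<forall>n. norm (T n x) \<le> real k}" for k :: nat
  have cont: "continuous_on UNIV (T n)" for n
    using lin by (simp add: linear_continuous_on)
  have closed_F: "closed (F k)" for k
  proof -
    have "F k = (\<Inter>n. {x. norm (T n x) \<le> real k})"
      by (auto simp: F_def)
    moreover have "closed {x. norm (T n x) \<le> real k}" for n
      using cont by (intro closed_Collect_le continuous_intros) auto
    ultimately show ?thesis by auto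
  qed
  have "(\<Union>k. F k) = UNIV"
  proof -
    have "x \<in> (\<Union>k. F k)" for x
    proof -
      obtain b where b: "\<And>n. norm (T n x) \<le> b"
        using ptw[of x] by (auto simp: bounded_iff)
      then have "\<And>n. norm (T n x) \<le> real (nat \<lceil>b\<rceil>)"
        by (meson order_trans real_nat_ceiling_ge)
      then show ?thesis by (auto simp: F_def)
    qed
    then show ?thesis by auto
  qed
  then have "\<exists>k. interior (F k) \<noteq> {}"
    using Met_TC.metric_Baire_category_alt[of "range F"] closed_F complete_UNIV
    by (force simp: closed_closedin[symmetric] mcomplete_iff_complete)
  then obtain k x0 where "x0 \<in> interior (F k)" by blast
  then obtain r where r: "r > 0" "cball x0 r \<subseteq> F k"
    by (auto simp: mem_interior_cball)
  have "norm (T n x) \<le> (2 * real k / r) * norm x" for n x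
  proof (cases "x = 0")
    case True
    then show ?thesis by (simp add: linear_0[OF bounded_linear.linear[OF lin]])
  next
    case False
    define y where "y = (r / norm x) *\<^sub>R x"
    have "x0 + y \<in> cball x0 r" "x0 \<in> cball x0 r"
      using False r by (auto simp: y_def dist_norm)
    then have "x0 + y \<in> F k" "x0 \<in> F k" using r by blast+
    then have "norm (T n (x0 + y)) \<le> real k" "norm (T n x0) \<le> real k"
      by (auto simp: F_def)
    moreover have "T n y = T n (x0 + y) - T n x0"
      by (simp add: linear_add[OF bounded_linear.linear[OF lin]])
    ultimately have "norm (T n y) \<le> 2 * real k"
      by (metis add_mono mult_2 norm_triangle_ineq4 order_trans)
    moreover have "norm (T n y) = (r / norm x) * norm (T n x)"
      using r by (simp add: y_def linear_scale[OF bounded_linear.linear[OF lin]])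
    ultimately show ?thesis
      using False r by (simp add: field_simps)
  qed
  then show thesis by (rule that)
qed

text \<open>
  A substitute for the sign of the derivative when \<open>\<phi>\<close> is merely continuous: if \<open>\<phi>\<close> exceeded
  a line of slope \<open>e > 0\<close> through its initial point, the last point at which it still lies below
  this line would have a majorant of slope at most \<open>0 < e\<close> there, and so would not be the last.
\<close>

lemma decreasing_if_right_majorant:
  fixes \<phi> :: "real \<Rightarrow> real"
  assumes "a \<le> b" and cont: "continuous_on {a..b} \<phi>"
    and maj: "\<And>t. a \<le> t \<Longrightarrow> t < b \<Longrightarrow> \<exists>\<psi> d. (\<psi> has_real_derivative d) (at t within {t..})
                 \<and> d \<le> 0 \<and> \<psi> t = \<phi> t \<and> (\<forall>\<^sub>F s in at_right t. \<phi> s \<le> \<psi> s)"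
  shows "\<phi> b \<le> \<phi> a"
proof -
  have slope: "\<phi> b \<le> \<phi> a + e * (b - a)" if "e > 0" for e
  proof (rule ccontr)
    assume neg: "\<not> ?thesis"
    \<comment> \<open>The points not above the line of slope \<open>e\<close>; the last one of them contradicts the majorant.\<close>
    define X where "X = {s \<in> {a..b}. \<phi> s - e * s \<le> \<phi> a - e * a}"
    have "closed X"
      unfolding X_def by (intro continuous_on_closed_Collect_le continuous_intros cont)
    moreover have "a \<in> X" using \<open>a \<le> b\<close> by (simp add: X_def)
    moreover have bdd: "bdd_above X" by (auto simp: X_def bdd_above_def)
    ultimately have c: "Sup X \<in> X"
      by (intro closed_contains_Sup) auto
    define c where "c = Sup X"
    have "c \<noteq> b" using c neg by (auto simp: X_def c_def algebra_simps)
    then have c': "a \<le> c" "c < b" "\<phi> c - e * c \<le> \<phi> a - e * a"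
      using c by (auto simp: X_def c_def)
    obtain \<psi> d where \<psi>: "(\<psi> has_real_derivative d) (at c within {c..})" "d \<le> 0"
        "\<psi> c = \<phi> c" "\<forall>\<^sub>F s in at_right c. \<phi> s \<le> \<psi> s"
      using maj[OF c'(1,2)] by blast
    have "((\<lambda>s. (\<psi> s - \<psi> c) / (s - c)) \<longlongrightarrow> d) (at_right c)"
      using \<psi>(1) by (auto simp: has_field_derivative_iff intro: tendsto_within_subset)
    then have "\<forall>\<^sub>F s in at_right c. (\<psi> s - \<psi> c) / (s - c) < e"
      using \<psi>(2) \<open>e > 0\<close> by (auto intro: order_tendstoD)
    moreover have "\<forall>\<^sub>F s in at_right c. s \<in> {c<..<b}"
      using c' by (intro eventually_at_right_real)
    ultimately have "\<forall>\<^sub>F s in at_right c. s \<in> X \<and> s > c" using \<psi>(4)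
    proof eventually_elim
      case (elim s)
      then have "\<psi> s - \<psi> c < e * (s - c)" by (simp add: field_simps)
      then show ?case using elim c' \<psi>(3) by (auto simp: X_def algebra_simps)
    qed
    then obtain s where "s \<in> X" "s > c"
      using eventually_happens'[OF trivial_limit_at_right_real] by blast
    then show False using bdd by (metis c_def cSup_upper not_le)
  qed
  show ?thesis
  proof (rule field_le_epsilon)
    fix e :: real assume "e > 0"
    have "\<phi> b \<le> \<phi> a + (e / (b - a + 1)) * (b - a)"
      using \<open>e > 0\<close> \<open>a \<le> b\<close> by (intro slope) auto
    also have "(e / (b - a + 1)) * (b - a) \<le> e"
      using \<open>e > 0\<close> \<open>a \<le> b\<close> by (simp add: field_simps)
    finally show "\<phi> b \<le> \<phi> a + e" by simp
  qed
qed

text \<open>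
  Otherwise there are times \<open>t\<^sub>n \<rightarrow> 0\<close> with \<open>\<parallel>S(t\<^sub>n)\<parallel> > n\<close>, although
  \<open>S(t\<^sub>n) x \<rightarrow> x\<close> for each \<open>x\<close>; this contradicts uniform boundedness.
\<close>

lemma C0_semigroup_bound_near_0:
  fixes S :: "real \<Rightarrow> 'a::banach \<Rightarrow> 'a"
  assumes "C0_semigroup S"
  obtains \<delta> M where "\<delta> > 0" "M \<ge> 1" "\<And>t x. 0 \<le> t \<Longrightarrow> t \<le> \<delta> \<Longrightarrow> norm (S t x) \<le> M * norm x"
proof (rule ccontr)
  assume neg: "\<not> thesis"
  have "\<exists>t x. 0 \<le> t \<and> t \<le> inverse (real (Suc n)) \<and> norm (S t x) > real (Suc n) * norm x" for n
  proof (rule ccontr)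
    assume "\<not> ?thesis"
    then show False
      using neg that[of "inverse (real (Suc n))" "real (Suc n)"] by (auto simp: not_less)
  qed
  then obtain t x where tx: "\<And>n. 0 \<le> t n" "\<And>n. t n \<le> inverse (real (Suc n))"
      "\<And>n. norm (S (t n) (x n)) > real (Suc n) * norm (x n)"
    by metis
  have t0: "t \<longlonglongrightarrow> 0"
    by (rule tendsto_sandwich[OF _ _ tendsto_const LIMSEQ_inverse_real_of_nat])
       (use tx in auto)
  have lim: "(\<lambda>n. S (t n) y) \<longlonglongrightarrow> y" for y
  proof -
    have "continuous (at 0 within {0..}) (\<lambda>t. S t y)"
      using assms by (auto simp: C0_semigroup_def continuous_within at_within_Ici_at_right)
    then have "(\<lambda>n. S (t n) y) \<longlonglongrightarrow> S 0 y"
      unfolding continuous_within_sequentially using t0 tx by (auto simp: o_def)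
    then show ?thesis using assms by (simp add: C0_semigroup_def)
  qed
  obtain B where B: "\<And>n y. norm (S (t n) y) \<le> B * norm y"
  proof (rule uniform_boundedness_principle[of "\<lambda>n. S (t n)"])
    show "bounded_linear (S (t n))" for n using assms tx by (simp add: C0_semigroup_def)
    show "bounded (range (\<lambda>n. S (t n) y))" for y
      using lim[of y] by (rule convergent_imp_bounded)
  qed blast
  obtain n where n: "B \<le> real n" using real_arch_simple by blast
  have "real (Suc n) * norm (x n) < B * norm (x n)"
    using tx(3)[of n] B[of n "x n"] by linarith
  then have "real (Suc n) < B" by (simp add: mult_less_cancel_right)
  then show False using n by simp
qed

lemma C0_semigroup_locally_bounded:
  fixes S :: "real \<Rightarrow> 'a::banach \<Rightarrow> 'a"
  assumes "C0_semigroup S"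
  obtains M where "M \<ge> 1" "\<And>t x. 0 \<le> t \<Longrightarrow> t \<le> T \<Longrightarrow> norm (S t x) \<le> M * norm x"
proof -
  obtain \<delta> M where \<delta>: "\<delta> > 0" and M: "M \<ge> 1"
    and le: "\<And>t x. 0 \<le> t \<Longrightarrow> t \<le> \<delta> \<Longrightarrow> norm (S t x) \<le> M * norm x"
    using C0_semigroup_bound_near_0[OF assms] by metis
  have iter: "0 \<le> t \<Longrightarrow> t \<le> real (Suc n) * \<delta> \<Longrightarrow> norm (S t x) \<le> M ^ Suc n * norm x" for n t x
  proof (induction n arbitrary: t x)
    case 0
    then show ?case using le by simp
  next
    case (Suc n)
    show ?case
    proof (cases "t \<le> \<delta>")
      case True
      then have "norm (S t x) \<le> M * norm x" using le Suc by simp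
      also have "\<dots> \<le> M ^ Suc (Suc n) * norm x"
        using M one_le_power[OF M, of n]
        by (intro mult_right_mono) (auto simp: mult_le_cancel_left1 intro: order_trans mult_ge1_I)
      finally show ?thesis .
    next
      case False
      then have "S t x = S (t - \<delta>) (S \<delta> x)"
        using assms \<delta> unfolding C0_semigroup_def
        by (metis diff_add_cancel diff_ge_0_iff_ge less_imp_le not_le)
      moreover have "norm (S (t - \<delta>) (S \<delta> x)) \<le> M ^ Suc n * norm (S \<delta> x)"
        using Suc.prems False by (intro Suc.IH) (auto simp: algebra_simps)
      moreover have "M ^ Suc n * norm (S \<delta> x) \<le> M ^ Suc n * (M * norm x)"
        using M le[of \<delta> x] \<delta> by (intro mult_left_mono) auto
      ultimately show ?thesis by (simp add: mult_ac)
    qed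
  qed
  obtain n where "T / \<delta> \<le> real n" using real_arch_simple by blast
  then have "T \<le> real (Suc n) * \<delta>" using \<delta> by (simp add: field_simps)
  then have "0 \<le> t \<Longrightarrow> t \<le> T \<Longrightarrow> norm (S t x) \<le> M ^ Suc n * norm x" for t x
    by (intro iter) auto
  then show thesis using that[of "M ^ Suc n"] M one_le_power by blast
qed

text \<open>
  Continuity from the right is built into the definition; the local bound carries it over to the
  left, since \<open>S(t) x - S(s) x = S(s) (S(t - s) x - x)\<close> for \<open>s \<le> t\<close>.
\<close>

lemma C0_semigroup_continuous_on:
  fixes S :: "real \<Rightarrow> 'a::banach \<Rightarrow> 'a"
  assumes "C0_semigroup S"
  shows "continuous_on {0..} (\<lambda>t. S t x)"
  unfolding continuous_on_def
proof
  fix t :: real assume t: "t \<in> {0..}"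
  obtain M where M: "M \<ge> 1"
    and le: "\<And>s x. 0 \<le> s \<Longrightarrow> s \<le> t + 1 \<Longrightarrow> norm (S s x) \<le> M * norm x"
    using C0_semigroup_locally_bounded[OF assms, of "t + 1"] by metis
  have lin: "bounded_linear (S s)" if "s \<ge> 0" for s
    using assms that by (simp add: C0_semigroup_def)
  have bd: "norm (S s x - S t x) \<le> M * norm (S \<bar>s - t\<bar> x - x)" if "0 \<le> s" "s \<le> t + 1" for s
  proof -
    have mm: "norm (S (a + h) x - S a x) \<le> M * norm (S h x - x)"
      if "0 \<le> a" "a \<le> t + 1" "0 \<le> h" for a h
    proof -
      have "S (a + h) x - S a x = S a (S h x - x)"
        using assms that linear_diff[OF bounded_linear.linear[OF lin]]
        by (simp add: C0_semigroup_def)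
      then show ?thesis using le that by simp
    qed
    show ?thesis
    proof (cases "s \<le> t")
      case True
      then show ?thesis using mm[of s "t - s"] that t by (simp add: norm_minus_commute)
    next
      case False
      then show ?thesis using mm[of t "s - t"] that t by simp
    qed
  qed
  have "filterlim (\<lambda>s. \<bar>s - t\<bar>) (at_right 0) (at t within {0..})"
  proof (rule tendsto_imp_filterlim_at_right)
    show "((\<lambda>s. \<bar>s - t\<bar>) \<longlongrightarrow> 0) (at t within {0..})"
      by (auto intro!: tendsto_eq_intros)
    show "\<forall>\<^sub>F s in at t within {0..}. 0 < \<bar>s - t\<bar>"
      by (auto simp: eventually_at intro: exI[of _ 1])
  qed
  moreover have "((\<lambda>h. S h x) \<longlongrightarrow> x) (at_right 0)"
    using assms by (simp add: C0_semigroup_def)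
  ultimately have "((\<lambda>s. S \<bar>s - t\<bar> x) \<longlongrightarrow> x) (at t within {0..})"
    by (rule filterlim_compose[rotated])
  then have "((\<lambda>s. M * norm (S \<bar>s - t\<bar> x - x)) \<longlongrightarrow> 0) (at t within {0..})"
    by (auto intro!: tendsto_eq_intros)
  moreover have "\<forall>\<^sub>F s in at t within {0..}. norm (S s x - S t x) \<le> M * norm (S \<bar>s - t\<bar> x - x)"
    by (auto simp: eventually_at dist_real_def intro!: exI[of _ 1] bd)
  ultimately have "((\<lambda>s. S s x - S t x) \<longlongrightarrow> 0) (at t within {0..})"
    by (rule Lim_null_comparison[rotated])
  then show "((\<lambda>s. S s x) \<longlongrightarrow> S t x) (at t within {0..})"
    by (simp add: LIM_zero_iff)
qed

lemma has_vector_derivative_right_iff: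
  "(f has_vector_derivative D) (at t within {t..}) \<longleftrightarrow>
    ((\<lambda>h. (f (t + h) - f t) /\<^sub>R h) \<longlongrightarrow> D) (at_right 0)"
proof -
  have "\<forall>\<^sub>F s in at_right t. (1 / \<bar>s - t\<bar>) *\<^sub>R (f s - (f t + (s - t) *\<^sub>R D))
      = (f s - f t) /\<^sub>R (s - t) - D"
    by (auto simp: eventually_at_filter scaleR_diff_right diff_diff_eq[symmetric] divide_inverse)
  then have "(f has_vector_derivative D) (at t within {t..}) \<longleftrightarrow>
      ((\<lambda>s. (f s - f t) /\<^sub>R (s - t)) \<longlongrightarrow> D) (at_right t)"
    by (simp add: has_vector_derivative_def has_derivative_within at_within_Ici_at_right
          bounded_linear_scaleR_left filterlim_cong LIM_zero_iff)
  then show ?thesis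
    by (simp add: filterlim_at_right_to_0[of _ _ t] add.commute)
qed

lemma C0_semigroup_commute:
  "C0_semigroup S \<Longrightarrow> s \<ge> 0 \<Longrightarrow> t \<ge> 0 \<Longrightarrow> S s (S t x) = S t (S s x)"
  unfolding C0_semigroup_def by (metis add.commute)

text \<open>
  Serves both for \<open>L = S(t)\<close>, giving invariance of the domain, and for scalar multiples.
\<close>

lemma infinitesimal_generator_image:
  assumes "bounded_linear L" and comm: "\<And>h x. h > 0 \<Longrightarrow> S h (L x) = L (S h x)"
    and vg: "(v, g) \<in> infinitesimal_generator S"
  shows "(L v, L g) \<in> infinitesimal_generator S"
proof -
  have "((\<lambda>h. L ((S h v - v) /\<^sub>R h)) \<longlongrightarrow> L g) (at_right 0)"
    using vg by (intro bounded_linear.tendsto[OF assms(1)]) (simp add: infinitesimal_generator_def)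
  moreover have "\<forall>\<^sub>F h in at_right 0. L ((S h v - v) /\<^sub>R h) = (S h (L v) - L v) /\<^sub>R h"
    by (simp add: eventually_at_filter comm linear_diff[OF bounded_linear.linear[OF assms(1)]]
          linear_scale[OF bounded_linear.linear[OF assms(1)]])
  ultimately show ?thesis
    by (simp add: infinitesimal_generator_def filterlim_cong)
qed

lemma C0_semigroup_right_derivative:
  assumes S: "C0_semigroup S" and vg: "(v, g) \<in> infinitesimal_generator S" and "t \<ge> 0"
  shows "(S t v, S t g) \<in> infinitesimal_generator S"
    and "((\<lambda>s. S s v) has_vector_derivative S t g) (at t within {t..})"
proof -
  show gen: "(S t v, S t g) \<in> infinitesimal_generator S"
  proof (rule infinitesimal_generator_image[OF _ _ vg])
    show "bounded_linear (S t)" using S \<open>t \<ge> 0\<close> by (simp add: C0_semigroup_def)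
    show "S h (S t x) = S t (S h x)" if "h > 0" for h x
      using that \<open>t \<ge> 0\<close> by (intro C0_semigroup_commute[OF S]) auto
  qed
  then have "((\<lambda>h. (S h (S t v) - S t v) /\<^sub>R h) \<longlongrightarrow> S t g) (at_right 0)"
    by (simp add: infinitesimal_generator_def)
  moreover have "\<forall>\<^sub>F h in at_right 0. (S h (S t v) - S t v) /\<^sub>R h = (S (t + h) v - S t v) /\<^sub>R h"
    using S \<open>t \<ge> 0\<close> C0_semigroup_commute[OF S _ \<open>t \<ge> 0\<close>]
    by (auto simp: eventually_at_filter C0_semigroup_def)
  ultimately show "((\<lambda>s. S s v) has_vector_derivative S t g) (at t within {t..})"
    by (simp add: has_vector_derivative_right_iff filterlim_cong)
qed

lemma integral_has_right_derivative:
  fixes f :: "real \<Rightarrow> 'a::banach"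
  assumes "continuous_on {a..} f" and "a \<le> t"
  shows "((\<lambda>u. integral {a..u} f) has_vector_derivative f t) (at t within {t..})"
proof -
  have "((\<lambda>u. integral {a..u} f) has_vector_derivative f t) (at t within {a..t+1})"
    using assms by (intro integral_has_vector_derivative) (auto intro: continuous_on_subset)
  then have "((\<lambda>u. integral {a..u} f) has_vector_derivative f t) (at t within {t..t+1})"
    by (rule has_vector_derivative_within_subset) (use \<open>a \<le> t\<close> in auto)
  then show ?thesis
    by (simp add: at_within_Ici_at_right at_within_Icc_at_right)
qed

lemma integral_average_tendsto:
  fixes f :: "real \<Rightarrow> 'a::banach"
  assumes "continuous_on {a..} f"
  shows "((\<lambda>h. integral {a..a + h} f /\<^sub>R h) \<longlongrightarrow> f a) (at_right 0)"
  using integral_has_right_derivative[OF assms order_refl] by (simp add: has_vector_derivative_right_iff)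

text \<open>
  Applying \<open>S(k) - I\<close> to \<open>\<integral>\<^sub>0\<^sup>h S(r) x dr\<close> cancels all but the two end pieces
  over \<open>[h, h + k]\<close> and \<open>[0, k]\<close>, whose averages converge.
\<close>

lemma average_in_generator:
  fixes S :: "real \<Rightarrow> 'a::banach \<Rightarrow> 'a"
  assumes S: "C0_semigroup S" and "h > 0"
  shows "(integral {0..h} (\<lambda>r. S r x), S h x - x) \<in> infinitesimal_generator S"
proof -
  have cont: "continuous_on {0..} (\<lambda>r. S r x)" by (rule C0_semigroup_continuous_on[OF S])
  have int: "(\<lambda>r. S r x) integrable_on {a..b}" if "a \<ge> 0" for a b
    using that by (intro integrable_continuous_real continuous_on_subset[OF cont]) auto
  have eq: "S k (integral {0..h} (\<lambda>r. S r x)) - integral {0..h} (\<lambda>r. S r x)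
     = integral {h..h+k} (\<lambda>r. S r x) - integral {0..0+k} (\<lambda>r. S r x)" if k: "k > 0" for k
  proof -
    have lin: "bounded_linear (S k)" using S k by (simp add: C0_semigroup_def)
    have "S k (integral {0..h} (\<lambda>r. S r x)) = integral {0..h} (\<lambda>r. S k (S r x))"
      using integral_linear[OF int[of 0 h] lin] by (simp add: o_def)
    also have "\<dots> = integral {0..h} (\<lambda>r. S (r + k) x)"
      using S k by (intro integral_cong) (auto simp: C0_semigroup_def add.commute[of _ k])
    also have "\<dots> = integral {k..h+k} (\<lambda>r. S r x)"
      using integral_shift_real_ivl[of k k "h + k" "\<lambda>r. S r x"] by simp
    finally have "S k (integral {0..h} (\<lambda>r. S r x)) = integral {k..h+k} (\<lambda>r. S r x)" .
    moreover have "integral {0..k} (\<lambda>r. S r x) + integral {k..h+k} (\<lambda>r. S r x)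
        = integral {0..h} (\<lambda>r. S r x) + integral {h..h+k} (\<lambda>r. S r x)"
      using k \<open>h > 0\<close> by (simp add: Henstock_Kurzweil_Integration.integral_combine int)
    ultimately show ?thesis by (simp add: algebra_simps)
  qed
  have "((\<lambda>k. integral {h..h+k} (\<lambda>r. S r x) /\<^sub>R k - integral {0..0+k} (\<lambda>r. S r x) /\<^sub>R k)
      \<longlongrightarrow> S h x - S 0 x) (at_right 0)"
    using \<open>h > 0\<close> by (intro tendsto_diff integral_average_tendsto continuous_on_subset[OF cont]) auto
  moreover have "\<forall>\<^sub>F k in at_right 0.
      integral {h..h+k} (\<lambda>r. S r x) /\<^sub>R k - integral {0..0+k} (\<lambda>r. S r x) /\<^sub>R k
      = (S k (integral {0..h} (\<lambda>r. S r x)) - integral {0..h} (\<lambda>r. S r x)) /\<^sub>R k"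
    by (auto simp: eventually_at_filter eq simp flip: scaleR_diff_right)
  ultimately show ?thesis
    using S by (simp add: infinitesimal_generator_def C0_semigroup_def filterlim_cong)
qed

lemma generator_domain_dense:
  fixes S :: "real \<Rightarrow> 'a::banach \<Rightarrow> 'a"
  assumes S: "C0_semigroup S"
  obtains v g where "\<And>n. (v n, g n) \<in> infinitesimal_generator S" "v \<longlonglongrightarrow> x"
proof -
  define h where "h n = inverse (real (Suc n))" for n
  have h: "h n > 0" for n by (simp add: h_def)
  have "filterlim h (at_right 0) sequentially"
    using h unfolding h_def by (intro tendsto_imp_filterlim_at_right LIMSEQ_inverse_real_of_nat) auto
  moreover have "((\<lambda>h. integral {0..0+h} (\<lambda>r. S r x) /\<^sub>R h) \<longlongrightarrow> S 0 x) (at_right 0)"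
    by (intro integral_average_tendsto C0_semigroup_continuous_on[OF S])
  ultimately have "(\<lambda>n. integral {0..0 + h n} (\<lambda>r. S r x) /\<^sub>R h n) \<longlonglongrightarrow> S 0 x"
    by (rule filterlim_compose[rotated])
  then have "(\<lambda>n. integral {0..h n} (\<lambda>r. S r x) /\<^sub>R h n) \<longlonglongrightarrow> x"
    using S by (simp add: C0_semigroup_def)
  moreover have "(integral {0..h n} (\<lambda>r. S r x) /\<^sub>R h n, (S (h n) x - x) /\<^sub>R h n) \<in> infinitesimal_generator S" for n
    by (intro infinitesimal_generator_image[where L = "\<lambda>x. x /\<^sub>R h n"] average_in_generator S h
          bounded_linear_scaleR_right)
       (use S in \<open>auto simp: C0_semigroup_def linear_scale bounded_linear.linear\<close>)
  ultimately show thesis by (intro that)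
qed

section \<open>Duhamel's formula for dissipative semigroups\<close>

text \<open>
  The bounded operator \<open>Q\<close> measures the dissipation that the generator guarantees. Only the
  form of \<open>Q\<close> enters, so the estimates on the domain survive the passage to arbitrary orbits.
\<close>

locale dissipative_semigroup =
  fixes S :: "real \<Rightarrow> 'a::{real_inner, banach} \<Rightarrow> 'a" and Q :: "'a \<Rightarrow> 'a"
  assumes C0: "C0_semigroup S"
    and Q: "bounded_linear Q" and Q_nonneg: "\<And>x. 0 \<le> inner (Q x) x"
    and dissipative: "\<And>v g. (v, g) \<in> infinitesimal_generator S \<Longrightarrow> inner g v + inner (Q v) v \<le> 0"
begin

lemma linear_S: "t \<ge> 0 \<Longrightarrow> bounded_linear (S t)"
  and S_0: "S 0 x = x"
  and S_add: "s \<ge> 0 \<Longrightarrow> t \<ge> 0 \<Longrightarrow> S (s + t) x = S s (S t x)"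
  using C0 by (auto simp: C0_semigroup_def)

lemma continuous_S: "continuous_on {0..} (\<lambda>r. S r x)"
  by (rule C0_semigroup_continuous_on[OF C0])

lemma continuous_QS: "continuous_on {0..} (\<lambda>r. inner (Q (S r x)) (S r x))"
  by (intro continuous_intros continuous_S bounded_linear.continuous_on[OF Q])

text \<open>
  For an orbit in the domain, the left-hand side is right differentiable in \<open>t\<close> with derivative
  \<open>\<langle>A S(t) v + Q S(t) v, S(t) v\<rangle> \<le> 0\<close>.
\<close>

lemma dissipation_generator:
  assumes vg: "(v, g) \<in> infinitesimal_generator S" and "t \<ge> 0"
  shows "(norm (S t v))\<^sup>2 / 2 + integral {0..t} (\<lambda>r. inner (Q (S r v)) (S r v)) \<le> (norm v)\<^sup>2 / 2"
proof -
  let ?\<phi> = "\<lambda>s. inner (S s v) (S s v) / 2 + integral {0..s} (\<lambda>r. inner (Q (S r v)) (S r v))"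
  have "?\<phi> t \<le> ?\<phi> 0"
  proof (rule decreasing_if_right_majorant[OF \<open>t \<ge> 0\<close>])
    show "continuous_on {0..t} ?\<phi>"
      by (intro continuous_intros indefinite_integral_continuous_1 integrable_continuous_real
            continuous_on_subset[OF continuous_S] continuous_on_subset[OF continuous_QS]) auto
    fix s :: real assume s: "0 \<le> s" "s < t"
    let ?d = "inner (S s g) (S s v) + inner (Q (S s v)) (S s v)"
    have "?d \<le> 0"
      by (intro dissipative C0_semigroup_right_derivative C0 vg s)
    moreover have "(?\<phi> has_real_derivative ?d) (at s within {s..})"
    proof -
      have "((\<lambda>r. S r v) has_derivative (\<lambda>h. h *\<^sub>R S s g)) (at s within {s..})"
        using C0_semigroup_right_derivative(2)[OF C0 vg s(1)] by (simp add: has_vector_derivative_def)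
      from has_derivative_inner[OF this this]
      have "((\<lambda>r. inner (S r v) (S r v)) has_real_derivative 2 * inner (S s g) (S s v)) (at s within {s..})"
        unfolding has_field_derivative_def
        by (rule has_derivative_eq_rhs) (auto simp: inner_commute algebra_simps)
      then have "((\<lambda>r. inner (S r v) (S r v) / 2) has_real_derivative inner (S s g) (S s v)) (at s within {s..})"
        by (auto intro!: derivative_eq_intros)
      moreover have "((\<lambda>s. integral {0..s} (\<lambda>r. inner (Q (S r v)) (S r v)))
          has_real_derivative inner (Q (S s v)) (S s v)) (at s within {s..})"
        unfolding has_real_derivative_iff_has_vector_derivative
        by (intro integral_has_right_derivative continuous_QS s)
      ultimately show ?thesis by (rule DERIV_add)
    qed
    ultimately show "\<exists>\<psi> d. (\<psi> has_real_derivative d) (at s within {s..}) \<and> d \<le> 0 \<and>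
        \<psi> s = ?\<phi> s \<and> (\<forall>\<^sub>F r in at_right s. ?\<phi> r \<le> \<psi> r)"
      by (intro exI[of _ ?\<phi>] exI[of _ ?d]) auto
  qed
  then show ?thesis by (simp add: power2_norm_eq_inner S_0)
qed

lemma integral_dissipation_nonneg: "0 \<le> integral {0..t} (\<lambda>r. inner (Q (S r x)) (S r x))"
  by (intro integral_nonneg integrable_continuous_real continuous_on_subset[OF continuous_QS])
     (auto simp: Q_nonneg)

lemma contraction:
  assumes "t \<ge> 0"
  shows "norm (S t x) \<le> norm x"
proof -
  obtain v g where v: "\<And>n. (v n, g n) \<in> infinitesimal_generator S" "v \<longlonglongrightarrow> x"
    using generator_domain_dense[OF C0] by metis
  have "norm (S t (v n)) \<le> norm (v n)" for n
  proof -
    have "(norm (S t (v n)))\<^sup>2 \<le> (norm (v n))\<^sup>2"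
      using dissipation_generator[OF v(1)[of n] assms] integral_dissipation_nonneg[of t "v n"]
      by linarith
    then show ?thesis by (rule power2_le_imp_le) simp
  qed
  moreover have "(\<lambda>n. norm (S t (v n))) \<longlonglongrightarrow> norm (S t x)"
    by (intro tendsto_norm bounded_linear.tendsto[OF linear_S] v assms)
  ultimately show ?thesis
    using tendsto_norm[OF v(2)] by (intro LIMSEQ_le) auto
qed

text \<open>
  By contractivity the orbits of approximating initial values are bounded uniformly in time, so
  dominated convergence applies to the dissipation integral.
\<close>

lemma dissipation:
  assumes "t \<ge> 0"
  shows "(norm (S t x))\<^sup>2 / 2 + integral {0..t} (\<lambda>r. inner (Q (S r x)) (S r x)) \<le> (norm x)\<^sup>2 / 2"
proof -
  obtain v g where v: "\<And>n. (v n, g n) \<in> infinitesimal_generator S" "v \<longlonglongrightarrow> x"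
    using generator_domain_dense[OF C0] by metis
  obtain B where B: "\<And>n. norm (v n) \<le> B"
    using convergent_imp_bounded[OF v(2)] by (auto simp: bounded_iff)
  obtain K where K: "K > 0" "\<And>x. norm (Q x) \<le> norm x * K"
    using bounded_linear.pos_bounded[OF Q] by blast
  have lim: "(\<lambda>n. S r (v n)) \<longlonglongrightarrow> S r x" if "r \<ge> 0" for r
    using that by (intro bounded_linear.tendsto[OF linear_S] v)
  have "(\<lambda>n. integral {0..t} (\<lambda>r. inner (Q (S r (v n))) (S r (v n))))
      \<longlonglongrightarrow> integral {0..t} (\<lambda>r. inner (Q (S r x)) (S r x))"
  proof (rule dominated_convergence(2))
    show "(\<lambda>r. inner (Q (S r (v n))) (S r (v n))) integrable_on {0..t}" for n
      by (intro integrable_continuous_real continuous_on_subset[OF continuous_QS]) auto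
    show "(\<lambda>r. (B * K) * B) integrable_on {0..t}" by (rule integrable_const_ivl)
    fix n r assume r: "r \<in> {0..t}"
    have le: "norm (S r (v n)) \<le> B"
      using contraction[of r "v n"] B[of n] r by simp
    have "norm (Q (S r (v n))) \<le> B * K"
      using K(1) by (intro order_trans[OF K(2) mult_right_mono[OF le]]) simp
    then have "norm (Q (S r (v n))) * norm (S r (v n)) \<le> (B * K) * B"
      using le by (intro mult_mono) (auto intro: order_trans[OF norm_ge_zero])
    then show "norm (inner (Q (S r (v n))) (S r (v n))) \<le> (B * K) * B"
      using Cauchy_Schwarz_ineq2[of "Q (S r (v n))" "S r (v n)"] by simp
  next
    fix r assume r: "r \<in> {0..t}"
    then show "(\<lambda>n. inner (Q (S r (v n))) (S r (v n))) \<longlonglongrightarrow> inner (Q (S r x)) (S r x)"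
      by (intro tendsto_inner bounded_linear.tendsto[OF Q] lim) auto
  qed
  then have "(\<lambda>n. (norm (S t (v n)))\<^sup>2 / 2 + integral {0..t} (\<lambda>r. inner (Q (S r (v n))) (S r (v n))))
      \<longlonglongrightarrow> (norm (S t x))\<^sup>2 / 2 + integral {0..t} (\<lambda>r. inner (Q (S r x)) (S r x))"
    by (intro tendsto_add tendsto_divide tendsto_power tendsto_norm tendsto_const lim assms) simp_all
  moreover have "(\<lambda>n. (norm (v n))\<^sup>2 / 2) \<longlonglongrightarrow> (norm x)\<^sup>2 / 2"
    by (intro tendsto_divide tendsto_power tendsto_norm tendsto_const v) simp_all
  ultimately show ?thesis
    by (rule LIMSEQ_le) (use dissipation_generator[OF v(1) assms] in auto)
qed

lemma continuous_convolution:
  assumes "continuous_on {a..b} f"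
  shows "continuous_on {a..b} (\<lambda>r. S (b - r) (f r))"
  unfolding continuous_on_def
proof
  fix s assume s: "s \<in> {a..b}"
  have "continuous_on {a..b} (\<lambda>r. S (b - r) (f s))"
    by (rule continuous_on_compose2[OF continuous_S]) (auto intro!: continuous_intros)
  then have "((\<lambda>r. S (b - r) (f s)) \<longlongrightarrow> S (b - s) (f s)) (at s within {a..b})"
    using s by (simp add: continuous_on_def)
  moreover have "((\<lambda>r. S (b - r) (f r) - S (b - r) (f s)) \<longlongrightarrow> 0) (at s within {a..b})"
  proof (rule Lim_null_comparison)
    have "(f \<longlongrightarrow> f s) (at s within {a..b})" using assms s by (simp add: continuous_on_def)
    then show "((\<lambda>r. norm (f r - f s)) \<longlongrightarrow> 0) (at s within {a..b})"
      by (simp add: LIM_zero_iff tendsto_norm_zero_iff)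
    have "norm (S (b - r) (f r) - S (b - r) (f s)) \<le> norm (f r - f s)" if "r \<in> {a..b}" for r
      using contraction[of "b - r" "f r - f s"] that
      by (simp add: linear_diff[OF bounded_linear.linear[OF linear_S]])
    then show "\<forall>\<^sub>F r in at s within {a..b}. norm (S (b - r) (f r) - S (b - r) (f s)) \<le> norm (f r - f s)"
      by (auto simp: eventually_at intro: exI[of _ 1])
  qed
  ultimately show "((\<lambda>r. S (b - r) (f r)) \<longlongrightarrow> S (b - s) (f s)) (at s within {a..b})"
    using tendsto_add by fastforce
qed

text \<open>
  The semigroup law pulls \<open>S(h)\<close> out of the integral over the past; what remains is the forcing
  after time \<open>t\<close>.
\<close>

lemma duhamel_restart:
  assumes f: "continuous_on {0..} f"
    and u: "\<And>t. t \<ge> 0 \<Longrightarrow> u t = S t x + integral {0..t} (\<lambda>s. S (t - s) (f s))"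
    and "t \<ge> 0" "h \<ge> 0"
  shows "u (t + h) = S h (u t) + integral {0..h} (\<lambda>r. S (h - r) (f (t + r)))"
proof -
  have cont: "continuous_on {a..b} (\<lambda>s. S (b - s) (f s))" if "a \<ge> 0" for a b
    using that by (intro continuous_convolution continuous_on_subset[OF f]) auto
  have "integral {0..t + h} (\<lambda>s. S (t + h - s) (f s))
      = integral {0..t} (\<lambda>s. S (t + h - s) (f s)) + integral {t..t + h} (\<lambda>s. S (t + h - s) (f s))"
    using \<open>t \<ge> 0\<close> \<open>h \<ge> 0\<close> cont[of 0 "t + h"]
    by (intro Henstock_Kurzweil_Integration.integral_combine[symmetric] integrable_continuous_real) auto
  moreover have "integral {0..t} (\<lambda>s. S (t + h - s) (f s)) = S h (integral {0..t} (\<lambda>s. S (t - s) (f s)))"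
  proof -
    have "integral {0..t} (\<lambda>s. S (t + h - s) (f s)) = integral {0..t} (\<lambda>s. S h (S (t - s) (f s)))"
      using \<open>h \<ge> 0\<close> by (intro integral_cong) (simp add: S_add[symmetric] algebra_simps)
    also have "\<dots> = S h (integral {0..t} (\<lambda>s. S (t - s) (f s)))"
      using integral_linear[OF integrable_continuous_real[OF cont[of 0 t]] linear_S[OF \<open>h \<ge> 0\<close>]]
      by (simp add: o_def)
    finally show ?thesis .
  qed
  moreover have "integral {t..t + h} (\<lambda>s. S (t + h - s) (f s)) = integral {0..h} (\<lambda>r. S (h - r) (f (t + r)))"
    using integral_shift_real_ivl[of t t "t + h" "\<lambda>s. S (t + h - s) (f s)"]
    by (simp add: algebra_simps)
  ultimately show ?thesis
    using \<open>t \<ge> 0\<close> \<open>h \<ge> 0\<close> u[of t] u[of "t + h"]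
    by (simp add: linear_add[OF bounded_linear.linear[OF linear_S]] S_add[symmetric] add.commute)
qed

lemma duhamel_average_tendsto:
  assumes f: "continuous_on {0..} f"
  shows "((\<lambda>h. integral {0..h} (\<lambda>r. S (h - r) (f r)) /\<^sub>R h) \<longlongrightarrow> f 0) (at_right 0)"
proof (rule tendstoI)
  fix e :: real assume "e > 0"
  have "((\<lambda>r. f r) \<longlongrightarrow> f 0) (at_right 0)" "((\<lambda>r. S r (f 0)) \<longlongrightarrow> S 0 (f 0)) (at_right 0)"
    using f continuous_S[of "f 0"] unfolding continuous_on_def
    by (metis at_within_Ici_at_right atLeast_iff order_refl)+
  then have "\<forall>\<^sub>F r in at_right 0. dist (f r) (f 0) < e / 3 \<and> dist (S r (f 0)) (f 0) < e / 3"
    using \<open>e > 0\<close> by (auto simp: S_0 intro!: eventually_conj dest!: tendstoD[of _ _ _ "e / 3"])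
  then obtain d where d: "d > 0"
      "\<And>r. r > 0 \<Longrightarrow> r < d \<Longrightarrow> dist (f r) (f 0) < e / 3 \<and> dist (S r (f 0)) (f 0) < e / 3"
    unfolding eventually_at_right_field by blast
  have d': "norm (f r - f 0) \<le> e / 3" "norm (S r (f 0) - f 0) \<le> e / 3" if "r \<ge> 0" "r < d" for r
    using d(2)[of r] that \<open>e > 0\<close> by (cases "r = 0"; force simp: dist_norm S_0)+
  have "dist (integral {0..h} (\<lambda>r. S (h - r) (f r)) /\<^sub>R h) (f 0) < e" if h: "h > 0" "h < d" for h
  proof -
    have cont: "continuous_on {0..h} (\<lambda>r. S (h - r) (f r))"
      by (intro continuous_convolution continuous_on_subset[OF f]) auto
    have bd: "norm (S (h - r) (f r) - f 0) \<le> 2 * e / 3" if r: "r \<in> {0..h}" for r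
    proof -
      have "S (h - r) (f r) - f 0 = S (h - r) (f r - f 0) + (S (h - r) (f 0) - f 0)"
        using r by (simp add: linear_diff[OF bounded_linear.linear[OF linear_S]])
      then have "norm (S (h - r) (f r) - f 0) \<le> norm (S (h - r) (f r - f 0)) + norm (S (h - r) (f 0) - f 0)"
        by (metis norm_triangle_ineq)
      also have "\<dots> \<le> e / 3 + e / 3"
        using r h d'[of r] d'[of "h - r"] contraction[of "h - r" "f r - f 0"]
        by (intro add_mono) auto
      finally show ?thesis by simp
    qed
    have "integral {0..h} (\<lambda>r. S (h - r) (f r)) - h *\<^sub>R f 0 = integral {0..h} (\<lambda>r. S (h - r) (f r) - f 0)"
      using h integrable_continuous_real[OF cont]
      by (subst Henstock_Kurzweil_Integration.integral_diff) auto
    moreover have "norm (integral {0..h} (\<lambda>r. S (h - r) (f r) - f 0)) \<le> 2 * e / 3 * (h - 0)"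
      using h bd by (intro integral_bound continuous_intros cont) auto
    ultimately have "norm (integral {0..h} (\<lambda>r. S (h - r) (f r)) - h *\<^sub>R f 0) \<le> 2 * e / 3 * h"
      by simp
    moreover have "integral {0..h} (\<lambda>r. S (h - r) (f r)) /\<^sub>R h - f 0
        = (integral {0..h} (\<lambda>r. S (h - r) (f r)) - h *\<^sub>R f 0) /\<^sub>R h"
      using h by (simp add: scaleR_diff_right)
    ultimately have "norm (integral {0..h} (\<lambda>r. S (h - r) (f r)) /\<^sub>R h - f 0) \<le> inverse h * (2 * e / 3 * h)"
      using h by (simp only: norm_scaleR) (simp add: mult_left_mono)
    then have "norm (integral {0..h} (\<lambda>r. S (h - r) (f r)) /\<^sub>R h - f 0) \<le> 2 * e / 3"
      using h by (simp only: field_simps) simp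
    then show ?thesis using \<open>e > 0\<close> by (simp add: dist_norm)
  qed
  then show "\<forall>\<^sub>F h in at_right 0. dist (integral {0..h} (\<lambda>r. S (h - r) (f r)) /\<^sub>R h) (f 0) < e"
    unfolding eventually_at_right_field using d(1) by blast
qed

text \<open>
  With \<open>F(h)\<close> the forcing accumulated since time \<open>t\<close>, expand
  \<open>\<parallel>S(h) u(t) + F(h)\<parallel>\<^sup>2\<close> and estimate \<open>\<parallel>S(h) u(t)\<parallel>\<^sup>2\<close> by \<open>dissipation\<close>. Since
  \<open>F(h) = h f(t) + o(h)\<close>, the resulting bound is right differentiable at \<open>h = 0\<close>, even where
  \<open>u\<close> is not.
\<close>

lemma mild_norm_majorant:
  assumes f: "continuous_on {0..} f"
    and u: "\<And>t. t \<ge> 0 \<Longrightarrow> u t = S t x + integral {0..t} (\<lambda>s. S (t - s) (f s))"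
    and t: "t \<ge> 0"
  obtains \<psi> where
    "(\<psi> has_real_derivative inner (f t) (u t) - inner (Q (u t)) (u t)) (at t within {t..})"
    "\<psi> t = (norm (u t))\<^sup>2 / 2" "\<And>s. s \<ge> t \<Longrightarrow> (norm (u s))\<^sup>2 / 2 \<le> \<psi> s"
proof -
  define F where "F h = integral {0..h} (\<lambda>r. S (h - r) (f (t + r)))" for h
  define \<Psi> where "\<Psi> h = (norm (u t))\<^sup>2 / 2 - integral {0..h} (\<lambda>r. inner (Q (S r (u t))) (S r (u t)))
      + inner (S h (u t)) (F h) + (norm (F h))\<^sup>2 / 2" for h
  let ?\<psi> = "\<lambda>s. \<Psi> (s - t)"
  have F0: "F 0 = 0" by (simp add: F_def)
  then have \<Psi>0: "\<Psi> 0 = (norm (u t))\<^sup>2 / 2" by (simp add: \<Psi>_def)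
  then have 2: "?\<psi> t = (norm (u t))\<^sup>2 / 2" by simp
  have 3: "(norm (u s))\<^sup>2 / 2 \<le> ?\<psi> s" if "s \<ge> t" for s
  proof -
    define h where "h = s - t"
    have h: "h \<ge> 0" "s = t + h" using that by (simp_all add: h_def)
    have "u s = S h (u t) + F h"
      unfolding h(2) F_def using duhamel_restart[OF f u t h(1)] by simp
    then have "(norm (u s))\<^sup>2 / 2 = (norm (S h (u t)))\<^sup>2 / 2 + inner (S h (u t)) (F h) + (norm (F h))\<^sup>2 / 2"
      by (simp add: power2_norm_eq_inner inner_add_left inner_add_right inner_commute)
    then show ?thesis
      using dissipation[OF h(1), of "u t"] unfolding \<Psi>_def h_def by simp
  qed
  have "continuous_on {0..} (\<lambda>r. f (t + r))"
    by (rule continuous_on_compose2[OF f]) (use t in \<open>auto intro!: continuous_intros\<close>)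
  from duhamel_average_tendsto[OF this]
  have F: "((\<lambda>h. F h /\<^sub>R h) \<longlongrightarrow> f t) (at_right 0)" by (simp add: F_def)
  then have "((\<lambda>h. h *\<^sub>R (F h /\<^sub>R h)) \<longlongrightarrow> 0 *\<^sub>R f t) (at_right 0)"
    by (intro tendsto_scaleR tendsto_ident_at)
  moreover have "\<forall>\<^sub>F h in at_right 0. h *\<^sub>R (F h /\<^sub>R h) = F h"
    by (simp add: eventually_at_filter)
  ultimately have F_0: "(F \<longlongrightarrow> 0) (at_right 0)" by (simp add: filterlim_cong)
  have S_u: "((\<lambda>h. S h (u t)) \<longlongrightarrow> u t) (at_right 0)"
    using C0 by (simp add: C0_semigroup_def)
  have q: "((\<lambda>h. integral {0..0+h} (\<lambda>r. inner (Q (S r (u t))) (S r (u t))) /\<^sub>R h)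
      \<longlongrightarrow> inner (Q (S 0 (u t))) (S 0 (u t))) (at_right 0)"
    by (intro integral_average_tendsto continuous_QS)
  have "((\<lambda>h. - (integral {0..0+h} (\<lambda>r. inner (Q (S r (u t))) (S r (u t))) /\<^sub>R h)
        + inner (S h (u t)) (F h /\<^sub>R h) + inner (F h) (F h /\<^sub>R h) / 2)
      \<longlongrightarrow> - inner (Q (S 0 (u t))) (S 0 (u t)) + inner (u t) (f t) + inner 0 (f t) / 2) (at_right 0)"
    by (intro tendsto_intros q F F_0 S_u) simp
  moreover have "\<forall>\<^sub>F h in at_right 0.
      - (integral {0..0+h} (\<lambda>r. inner (Q (S r (u t))) (S r (u t))) /\<^sub>R h)
        + inner (S h (u t)) (F h /\<^sub>R h) + inner (F h) (F h /\<^sub>R h) / 2 = (\<Psi> h - \<Psi> 0) /\<^sub>R h"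
    unfolding \<Psi>0 by (auto simp: eventually_at_filter \<Psi>_def power2_norm_eq_inner field_simps)
  ultimately have "((\<lambda>h. (?\<psi> (t + h) - ?\<psi> t) /\<^sub>R h) \<longlongrightarrow> inner (f t) (u t) - inner (Q (u t)) (u t)) (at_right 0)"
    by (simp add: filterlim_cong S_0 inner_commute)
  then have 1: "(?\<psi> has_real_derivative inner (f t) (u t) - inner (Q (u t)) (u t)) (at t within {t..})"
    unfolding has_real_derivative_iff_has_vector_derivative has_vector_derivative_right_iff by simp
  show thesis using 1 2 3 by (rule that)
qed

end

section \<open>Mollifiers\<close>

text \<open>
  Recursion on the derivative makes closure under products an easy induction, which would be
  awkward for the iterates \<open>(deriv ^^ n) f\<close> in the definition of test functions.
\<close>

primrec differentiable_times :: "nat \<Rightarrow> (real \<Rightarrow> real) \<Rightarrow> bool" where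
  "differentiable_times 0 f \<longleftrightarrow> True"
| "differentiable_times (Suc n) f \<longleftrightarrow> (\<forall>x. f field_differentiable at x) \<and> differentiable_times n (deriv f)"

lemma differentiable_times_SucI:
  assumes "\<And>x. (f has_real_derivative f' x) (at x)" "differentiable_times n f'"
  shows "differentiable_times (Suc n) f"
proof -
  have "deriv f = f'" using assms(1) by (intro ext DERIV_imp_deriv)
  then show ?thesis using assms by (auto simp: field_differentiable_def)
qed

lemma differentiable_times_SucE:
  assumes "differentiable_times (Suc n) f"
  shows "(f has_real_derivative deriv f x) (at x)" "differentiable_times n (deriv f)"
  using assms by (auto simp: field_differentiable_derivI)

lemma differentiable_times_lower: "differentiable_times (Suc n) f \<Longrightarrow> differentiable_times n f"
  by (induction n arbitrary: f) auto

lemma differentiable_times_const: "differentiable_times n (\<lambda>x. c)"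
proof (induction n arbitrary: c)
  case (Suc n)
  show ?case by (rule differentiable_times_SucI[OF DERIV_const Suc])
qed simp

lemma differentiable_times_add:
  "differentiable_times n f \<Longrightarrow> differentiable_times n g \<Longrightarrow> differentiable_times n (\<lambda>x. f x + g x)"
proof (induction n arbitrary: f g)
  case (Suc n)
  show ?case
    by (rule differentiable_times_SucI[OF DERIV_add])
       (use Suc differentiable_times_SucE in blast)+
qed simp

lemma differentiable_times_mult:
  "differentiable_times n f \<Longrightarrow> differentiable_times n g \<Longrightarrow> differentiable_times n (\<lambda>x. f x * g x)"
proof (induction n arbitrary: f g)
  case (Suc n)
  show ?case
  proof (rule differentiable_times_SucI[OF DERIV_mult])
    show "(f has_real_derivative deriv f x) (at x)" "(g has_real_derivative deriv g x) (at x)" for x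
      using Suc.prems differentiable_times_SucE by blast+
    show "differentiable_times n (\<lambda>x. deriv f x * g x + deriv g x * f x)"
      using Suc.prems[THEN differentiable_times_SucE(2)] Suc.prems[THEN differentiable_times_lower]
      by (intro differentiable_times_add Suc.IH)
  qed
qed simp

lemma differentiable_times_affine:
  "differentiable_times n f \<Longrightarrow> differentiable_times n (\<lambda>x. f (a * x + b))"
proof (induction n arbitrary: f)
  case (Suc n)
  show ?case
  proof (rule differentiable_times_SucI)
    show "((\<lambda>x. f (a * x + b)) has_real_derivative a * deriv f (a * x + b)) (at x)" for x
      by (rule DERIV_cong[OF DERIV_chain2[OF differentiable_times_SucE(1)[OF Suc.prems]]])
         (auto intro!: derivative_eq_intros)
    show "differentiable_times n (\<lambda>x. a * deriv f (a * x + b))"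
      using Suc.prems by (intro differentiable_times_mult differentiable_times_const Suc.IH) simp
  qed
qed simp

lemma test_functionI:
  assumes "\<And>n. differentiable_times n f" and supp: "\<And>x. f x \<noteq> 0 \<Longrightarrow> x \<in> {a..b}"
  shows "test_function f"
  unfolding test_function_def
proof (intro conjI allI)
  have "differentiable_times (Suc n) f \<Longrightarrow> (deriv ^^ n) f field_differentiable at x" for n x f
  proof (induction n arbitrary: f)
    case (Suc n)
    then have "(deriv ^^ n) (deriv f) field_differentiable at x" by simp
    then show ?case by (simp only: funpow_Suc_right o_def)
  qed simp
  then show "(deriv ^^ n) f field_differentiable at x" for n x using assms(1) by blast
  have "closure {x. f x \<noteq> 0} \<subseteq> {a..b}" using supp by (intro closure_minimal) auto
  then have "bounded (closure {x. f x \<noteq> 0})" by (rule bounded_subset[OF bounded_closed_interval])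
  then show "compact (closure {x. f x \<noteq> 0})" by (simp add: compact_eq_bounded_closed)
qed

text \<open>
  The functions \<open>x^(-k) e^(-1/x)\<close> on the half line \<open>x > 0\<close>, extended by zero: their span
  is closed under differentiation, which yields smoothness of \<open>e^(-1/x)\<close> at the origin.
\<close>

definition flat_exp :: "nat \<Rightarrow> real \<Rightarrow> real" where
  "flat_exp k x = (if x > 0 then inverse x ^ k * exp (- inverse x) else 0)"

lemma flat_exp_tendsto_0: "(flat_exp k \<longlongrightarrow> 0) (at 0)"
proof -
  have "((\<lambda>x::real. inverse x ^ k / exp (inverse x)) \<longlongrightarrow> 0) (at_right 0)"
    by (rule filterlim_compose[OF tendsto_power_div_exp_0 filterlim_inverse_at_top_right])
  moreover have "\<forall>\<^sub>F x in at_right 0. inverse x ^ k / exp (inverse x) = flat_exp k x"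
    by (simp add: eventually_at_filter flat_exp_def exp_minus divide_inverse)
  ultimately have "(flat_exp k \<longlongrightarrow> 0) (at_right 0)" by (simp add: filterlim_cong)
  moreover have "(flat_exp k \<longlongrightarrow> 0) (at_left 0)"
    by (rule tendsto_eventually) (simp add: eventually_at_filter flat_exp_def)
  ultimately show ?thesis by (simp add: filterlim_split_at)
qed

lemma flat_exp_has_derivative:
  "(flat_exp k has_real_derivative flat_exp (k + 2) x - real k * flat_exp (k + 1) x) (at x)"
proof (cases x "0::real" rule: linorder_cases)
  case less
  have "((\<lambda>x. 0) has_real_derivative 0) (at x)" by simp
  then have "(flat_exp k has_real_derivative 0) (at x)"
    by (rule has_field_derivative_transform_within_open[of _ _ _ "{..<0}"])
       (use less in \<open>auto simp: flat_exp_def\<close>)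
  then show ?thesis using less by (simp add: flat_exp_def)
next
  case equal
  have "\<forall>\<^sub>F h in at 0. flat_exp (Suc k) h = (flat_exp k (0 + h) - flat_exp k 0) / h"
    by (auto simp: eventually_at_filter flat_exp_def field_simps)
  then have "((\<lambda>h. (flat_exp k (0 + h) - flat_exp k 0) / h) \<longlongrightarrow> 0) (at 0)"
    using flat_exp_tendsto_0[of "Suc k"] by (simp add: filterlim_cong)
  then show ?thesis using equal by (simp add: DERIV_def flat_exp_def)
next
  case greater
  have "((\<lambda>x. inverse x ^ k * exp (- inverse x)) has_real_derivative
      flat_exp (k + 2) x - real k * flat_exp (k + 1) x) (at x)"
  proof -
    have "((\<lambda>x. inverse x ^ k) has_real_derivative
        real k * inverse x ^ (k - Suc 0) * - (inverse x * inverse x)) (at x)"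
      using greater by (auto intro!: derivative_eq_intros)
    also have "real k * inverse x ^ (k - Suc 0) * - (inverse x * inverse x) = - real k * inverse x ^ (k + 1)"
      by (cases k) (simp_all add: algebra_simps)
    finally have "((\<lambda>x. inverse x ^ k) has_real_derivative - real k * inverse x ^ (k + 1)) (at x)" .
    moreover have "((\<lambda>x. exp (- inverse x)) has_real_derivative exp (- inverse x) * inverse x ^ 2) (at x)"
      using greater by (auto intro!: derivative_eq_intros simp: power2_eq_square)
    ultimately show ?thesis
      by (rule DERIV_cong[OF DERIV_mult])
         (use greater in \<open>simp add: flat_exp_def power2_eq_square algebra_simps\<close>)
  qed
  then show ?thesis
    by (rule has_field_derivative_transform_within_open[of _ _ _ "{0<..}"])
       (use greater in \<open>auto simp: flat_exp_def\<close>)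
qed

lemma flat_exp_smooth: "differentiable_times n (flat_exp k)"
proof (induction n arbitrary: k)
  case (Suc n)
  have "differentiable_times n (\<lambda>x. flat_exp (k + 2) x + - real k * flat_exp (k + 1) x)"
    by (intro differentiable_times_add differentiable_times_mult differentiable_times_const Suc)
  then show ?case
    using flat_exp_has_derivative by (intro differentiable_times_SucI) auto
qed simp

lemma integrable_if_continuous_compact_support:
  fixes g :: "real \<Rightarrow> real"
  assumes cont: "continuous_on UNIV g" and supp: "\<And>x. x \<notin> {a..b} \<Longrightarrow> g x = 0"
  shows "integrable lborel g" "integrable lebesgue g" "g \<in> borel_measurable lebesgue"
proof -
  have m: "g \<in> borel_measurable borel" by (rule borel_measurable_continuous_onI[OF cont])
  have "integrable lborel (\<lambda>x. indicator {a..b} x *\<^sub>R g x)"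
    using borel_integrable_atLeastAtMost'[OF continuous_on_subset[OF cont subset_UNIV], of a b]
    by (simp add: set_integrable_def)
  moreover have "(\<lambda>x. indicator {a..b} x *\<^sub>R g x) = g"
    using supp by (force simp: indicator_def)
  ultimately show "integrable lborel g" by simp
  then show "integrable lebesgue g" using m by (simp add: integrable_completion)
  show "g \<in> borel_measurable lebesgue" using m by (simp add: measurable_completion)
qed

lemma square_integrable_if_continuous_compact_support:
  assumes cont: "continuous_on UNIV g" and supp: "\<And>x. x \<notin> {a..b} \<Longrightarrow> g x = 0"
  shows "square_integrable g"
  unfolding square_integrable_def
  using integrable_if_continuous_compact_support(3)[OF assms]
    integrable_if_continuous_compact_support(2)[of "\<lambda>x. (g x)\<^sup>2" a b] assms
  by (auto intro!: continuous_intros)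

lemma bounded_if_continuous_compact_support:
  fixes g :: "real \<Rightarrow> real"
  assumes cont: "continuous_on UNIV g" and supp: "\<And>x. \<bar>x\<bar> > R \<Longrightarrow> g x = 0"
  obtains B where "B > 0" "\<And>x. \<bar>g x\<bar> \<le> B"
proof -
  have "compact (g ` {-R..R})"
    by (intro compact_continuous_image continuous_on_subset[OF cont]) auto
  then obtain B where "\<forall>y\<in>g ` {-R..R}. norm y \<le> B"
    using compact_imp_bounded bounded_iff by metis
  then have B: "\<bar>g x\<bar> \<le> B" if "x \<in> {-R..R}" for x
    using that by auto
  have "\<bar>g x\<bar> \<le> max B 1" for x
  proof (cases "\<bar>x\<bar> > R")
    case False
    then have "x \<in> {-R..R}" by auto
    then show ?thesis using B[of x] by (simp add: le_max_iff_disj)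
  qed (simp add: supp)
  then show thesis using that[of "max B 1"] by auto
qed

lemma deriv_eq_0_outside:
  assumes "\<And>x. \<bar>x\<bar> > R \<Longrightarrow> f x = (0::real)" and "\<bar>x\<bar> > R"
  shows "deriv f x = 0"
proof -
  have "((\<lambda>x. 0) has_real_derivative 0) (at x)" by simp
  then have "(f has_real_derivative 0) (at x)"
  proof (rule has_field_derivative_transform_within_open)
    show "open {x. \<bar>x\<bar> > R}" by (intro open_Collect_less continuous_intros)
  qed (use assms in auto)
  then show ?thesis by (rule DERIV_imp_deriv)
qed

lemma continuous_if_differentiable_times: "differentiable_times (Suc n) f \<Longrightarrow> continuous_on A f"
  by (meson DERIV_continuous_on DERIV_subset differentiable_times_SucE(1) subset_UNIV)

locale mollifier =
  fixes \<rho> :: "real \<Rightarrow> real" and \<epsilon> :: real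
  assumes smooth: "\<And>n. differentiable_times n \<rho>"
    and nonneg: "\<And>x. 0 \<le> \<rho> x"
    and support: "\<And>x. \<epsilon> < \<bar>x\<bar> \<Longrightarrow> \<rho> x = 0"
    and total: "(LINT x|lborel. \<rho> x) = 1"

text \<open>
  The product \<open>e^(-1/(1+x/\<epsilon>)) e^(-1/(1-x/\<epsilon>))\<close>, continued by zero, is smooth and
  supported in \<open>[-\<epsilon>, \<epsilon>]\<close>.
\<close>

lemma mollifier_exists:
  assumes "\<epsilon> > 0"
  obtains \<rho> where "mollifier \<rho> \<epsilon>"
proof -
  define b where "b x = flat_exp 0 (1 / \<epsilon> * x + 1) * flat_exp 0 (- 1 / \<epsilon> * x + 1)" for x
  have b_smooth: "differentiable_times n b" for n
    unfolding b_def by (intro differentiable_times_mult differentiable_times_affine flat_exp_smooth)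
  have b_cont: "continuous_on A b" for A
    using b_smooth by (rule continuous_if_differentiable_times)
  have b_nonneg: "b x \<ge> 0" for x by (simp add: b_def flat_exp_def)
  have b_supp: "b x = 0" if "\<epsilon> < \<bar>x\<bar>" for x
    using that \<open>\<epsilon> > 0\<close> by (auto simp: b_def flat_exp_def field_simps abs_if split: if_splits)
  have b_supp': "b x = 0" if "x \<notin> {-\<epsilon>..\<epsilon>}" for x
    using that b_supp[of x] by auto
  have b0: "b 0 > 0" by (simp add: b_def flat_exp_def)
  note b_int = integrable_if_continuous_compact_support(1)[OF b_cont b_supp']
  define c where "c = (LINT x|lborel. b x)"
  have "c \<ge> 0" unfolding c_def by (intro integral_nonneg_AE) (simp add: b_nonneg)
  moreover have "c \<noteq> 0"
  proof
    assume "c = 0"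
    have "set_integrable lborel {-\<epsilon>..\<epsilon>} b"
      by (rule borel_integrable_atLeastAtMost'[OF b_cont])
    from set_borel_integral_eq_integral(2)[OF this]
    have "integral {-\<epsilon>..\<epsilon>} b = (LINT x|lborel. indicator {-\<epsilon>..\<epsilon>} x *\<^sub>R b x)"
      by (simp add: set_lebesgue_integral_def)
    also have "(\<lambda>x. indicator {-\<epsilon>..\<epsilon>} x *\<^sub>R b x) = b"
      using b_supp' by (force simp: indicator_def)
    finally have "integral {-\<epsilon>..\<epsilon>} b = 0" using \<open>c = 0\<close> by (simp add: c_def)
    then have "(b has_integral 0) (cbox (-\<epsilon>) \<epsilon>)"
      using integrable_continuous_real[OF b_cont, of "-\<epsilon>" \<epsilon>] by (auto simp: has_integral_integral)
    from has_integral_0_cbox_imp_0[OF b_cont _ this, of 0] show False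
      using \<open>\<epsilon> > 0\<close> b0 b_nonneg by auto
  qed
  ultimately have "c > 0" by simp
  have "mollifier (\<lambda>x. inverse c * b x) \<epsilon>"
  proof
    show "differentiable_times n (\<lambda>x. inverse c * b x)" for n
      by (intro differentiable_times_mult differentiable_times_const b_smooth)
    show "(LINT x|lborel. inverse c * b x) = 1"
      using \<open>c > 0\<close> by (simp add: c_def[symmetric])
  qed (use \<open>c > 0\<close> b_nonneg b_supp in auto)
  then show thesis by (rule that)
qed

context mollifier
begin

lemma continuous_\<rho>: "continuous_on A \<rho>"
  using smooth by (rule continuous_if_differentiable_times)

lemma kernel_outside: "y \<notin> {x - \<epsilon>..x + \<epsilon>} \<Longrightarrow> \<rho> (x - y) = 0"
  by (rule support) auto

lemma continuous_kernel: "continuous_on A (\<lambda>y. \<rho> (x - y))"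
  by (rule continuous_on_compose2[OF continuous_\<rho>[of UNIV]]) (auto intro!: continuous_intros)

lemma integrable_kernel: "integrable lebesgue (\<lambda>y. \<rho> (x - y))"
  by (rule integrable_if_continuous_compact_support(2)[OF continuous_kernel kernel_outside])

lemma square_integrable_kernel: "square_integrable (\<lambda>y. \<rho> (x - y))"
  by (rule square_integrable_if_continuous_compact_support[OF continuous_kernel kernel_outside])

lemma integral_kernel: "(LINT y|lebesgue. \<rho> (x - y)) = 1"
proof -
  have "(LINT y|lebesgue. \<rho> (x - y)) = (LINT y|lborel. \<rho> (x + (-1) * y))"
    by (subst integral_completion) (auto intro!: borel_measurable_continuous_onI continuous_kernel)
  also have "\<dots> = 1"
    using lborel_integral_real_affine[of "-1" \<rho> x] total by simp
  finally show ?thesis .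
qed

definition conv :: "(real \<Rightarrow> real) \<Rightarrow> real \<Rightarrow> real" where
  "conv f x = (LINT y|lebesgue. f y * \<rho> (x - y))"

lemma test_function_kernel: "test_function (\<lambda>y. \<rho> (x - y))"
proof (rule test_functionI)
  show "differentiable_times n (\<lambda>y. \<rho> (x - y))" for n
    using differentiable_times_affine[OF smooth, of n "-1" x] by simp
qed (use kernel_outside in blast)

lemma deriv_kernel: "deriv (\<lambda>y. \<rho> (x - y)) = (\<lambda>y. - deriv \<rho> (x - y))"
proof (intro ext DERIV_imp_deriv)
  fix y
  have "(\<rho> has_real_derivative deriv \<rho> (x - y)) (at (x - y))"
    using smooth by (rule differentiable_times_SucE(1))
  moreover have "((\<lambda>y. x - y) has_real_derivative -1) (at y)"
    by (auto intro!: derivative_eq_intros)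
  ultimately show "((\<lambda>y. \<rho> (x - y)) has_real_derivative - deriv \<rho> (x - y)) (at y)"
    using DERIV_chain2[of \<rho> "deriv \<rho> (x - y)" "\<lambda>y. x - y" y "-1" UNIV] by simp
qed

text \<open>
  The indicator keeps the Taylor estimate usable under an integral against a function that is only
  square integrable; the interval is widened by one to accommodate all shifts \<open>|h| \<le> 1\<close>.
\<close>

lemma remainder_bound:
  obtains K where "K > 0"
    "\<And>a h. \<bar>h\<bar> \<le> 1 \<Longrightarrow> \<bar>\<rho> (a + h) - \<rho> a - h * deriv \<rho> a\<bar> \<le> K * h\<^sup>2 * indicator {-\<epsilon>-1..\<epsilon>+1} a"
proof -
  have D: "(\<rho> has_real_derivative deriv \<rho> x) (at x)" for x
    using smooth by (rule differentiable_times_SucE(1))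
  have "differentiable_times (Suc (Suc 0)) (deriv \<rho>)"
    using smooth[of "Suc (Suc (Suc 0))"] differentiable_times_SucE(2) by blast
  then have DD: "(deriv \<rho> has_real_derivative deriv (deriv \<rho>) x) (at x)"
    and cont: "continuous_on UNIV (deriv (deriv \<rho>))" for x
    using continuous_if_differentiable_times differentiable_times_SucE by blast+
  have supp1: "deriv \<rho> x = 0" if "\<bar>x\<bar> > \<epsilon>" for x
    using support that by (rule deriv_eq_0_outside)
  have supp2: "deriv (deriv \<rho>) x = 0" if "\<bar>x\<bar> > \<epsilon>" for x
    using supp1 that by (rule deriv_eq_0_outside)
  obtain K where K: "K > 0" "\<And>x. \<bar>deriv (deriv \<rho>) x\<bar> \<le> K"
    using bounded_if_continuous_compact_support[OF cont supp2] by metis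
  have lip: "\<bar>deriv \<rho> x - deriv \<rho> y\<bar> \<le> K * \<bar>x - y\<bar>" for x y
    using field_differentiable_bound[of UNIV "deriv \<rho>" "deriv (deriv \<rho>)" K x y] DD K(2) by auto
  have bd: "\<bar>\<rho> (a + h) - \<rho> a - h * deriv \<rho> a\<bar> \<le> K * h\<^sup>2" for a h
  proof -
    let ?g = "\<lambda>t. \<rho> t - t * deriv \<rho> a"
    have "norm (?g (a + h) - ?g a) \<le> (K * \<bar>h\<bar>) * norm (a + h - a)"
    proof (rule field_differentiable_bound)
      show "convex (cball a \<bar>h\<bar>)" by simp
      show "(?g has_real_derivative deriv \<rho> z - deriv \<rho> a) (at z within cball a \<bar>h\<bar>)" for z
        using DERIV_subset[OF D[of z] subset_UNIV]
        by (auto intro!: derivative_eq_intros)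
      show "norm (deriv \<rho> z - deriv \<rho> a) \<le> K * \<bar>h\<bar>" if "z \<in> cball a \<bar>h\<bar>" for z
        using lip[of z a] that K(1)
        by (auto simp: dist_real_def abs_minus_commute intro: order_trans mult_left_mono)
    qed (auto simp: dist_real_def)
    then show ?thesis by (simp add: algebra_simps power2_eq_square abs_mult_self_eq)
  qed
  show thesis
  proof (rule that[OF K(1)])
    fix a h :: real assume h: "\<bar>h\<bar> \<le> 1"
    show "\<bar>\<rho> (a + h) - \<rho> a - h * deriv \<rho> a\<bar> \<le> K * h\<^sup>2 * indicator {-\<epsilon>-1..\<epsilon>+1} a"
    proof (cases "a \<in> {-\<epsilon>-1..\<epsilon>+1}")
      case False
      then have "\<bar>a\<bar> > \<epsilon>" "\<bar>a + h\<bar> > \<epsilon>" using h by auto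
      then show ?thesis using False support supp1 by simp
    qed (use bd in simp)
  qed
qed

lemma conv_has_derivative:
  assumes f: "square_integrable f"
  shows "(conv f has_real_derivative (LINT y|lebesgue. f y * deriv \<rho> (x - y))) (at x)"
proof -
  obtain K where K: "K > 0"
    "\<And>a h. \<bar>h\<bar> \<le> 1 \<Longrightarrow> \<bar>\<rho> (a + h) - \<rho> a - h * deriv \<rho> a\<bar> \<le> K * h\<^sup>2 * indicator {-\<epsilon>-1..\<epsilon>+1} a"
    using remainder_bound by metis
  define D where "D = (LINT y|lebesgue. f y * deriv \<rho> (x - y))"
  define L where "L = (LINT y|lebesgue. \<bar>f y\<bar> * indicator {x-\<epsilon>-1..x+\<epsilon>+1} y)"
  have int1: "integrable lebesgue (\<lambda>y. f y * \<rho> (z - y))" for z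
    by (rule square_integrable_mult[OF f square_integrable_kernel])
  have int2: "integrable lebesgue (\<lambda>y. f y * deriv \<rho> (x - y))"
  proof (rule square_integrable_mult[OF f square_integrable_if_continuous_compact_support])
    have "continuous_on UNIV (deriv \<rho>)"
      using differentiable_times_SucE(2)[OF smooth[of "Suc (Suc 0)"]]
      by (rule continuous_if_differentiable_times)
    then show "continuous_on UNIV (\<lambda>y. deriv \<rho> (x - y))"
      by (rule continuous_on_compose2) (auto intro!: continuous_intros)
    show "deriv \<rho> (x - y) = 0" if "y \<notin> {x - \<epsilon>..x + \<epsilon>}" for y
      using that by (intro deriv_eq_0_outside[OF support]) auto
  qed
  have ind: "square_integrable (indicator {x-\<epsilon>-1..x+\<epsilon>+1})"
  proof -
    have "(\<lambda>y. (indicator {x-\<epsilon>-1..x+\<epsilon>+1} y :: real)\<^sup>2) = indicator {x-\<epsilon>-1..x+\<epsilon>+1}"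
      by (auto simp: indicator_def)
    then show ?thesis
      by (auto simp: square_integrable_def emeasure_lborel_Icc_eq intro!: integrable_real_indicator
          borel_measurable_indicator)
  qed
  have int3: "integrable lebesgue (\<lambda>y. \<bar>f y\<bar> * indicator {x-\<epsilon>-1..x+\<epsilon>+1} y)"
    using integrable_abs[OF square_integrable_mult[OF f ind]] by (simp add: abs_mult)
  have bd: "\<bar>(conv f (x + h) - conv f x) / h - D\<bar> \<le> K * L * \<bar>h\<bar>" if h: "\<bar>h\<bar> \<le> 1" "h \<noteq> 0" for h
  proof -
    have eq: "conv f (x + h) - conv f x - h * D
        = (LINT y|lebesgue. f y * \<rho> (x + h - y) - f y * \<rho> (x - y) - h * (f y * deriv \<rho> (x - y)))"
      unfolding conv_def D_def using int1 int2
      by (simp add: Bochner_Integration.integral_diff)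
    have "norm (conv f (x + h) - conv f x - h * D) \<le> (LINT y|lebesgue. K * h\<^sup>2 * (\<bar>f y\<bar> * indicator {x-\<epsilon>-1..x+\<epsilon>+1} y))"
      unfolding eq
    proof (rule Bochner_Integration.integral_norm_bound_integral)
      fix y
      have eq: "f y * \<rho> (x + h - y) - f y * \<rho> (x - y) - h * (f y * deriv \<rho> (x - y))
          = f y * (\<rho> ((x - y) + h) - \<rho> (x - y) - h * deriv \<rho> (x - y))"
        by (simp add: algebra_simps)
      have "\<bar>f y\<bar> * \<bar>\<rho> ((x - y) + h) - \<rho> (x - y) - h * deriv \<rho> (x - y)\<bar>
          \<le> \<bar>f y\<bar> * (K * h\<^sup>2 * indicator {-\<epsilon>-1..\<epsilon>+1} (x - y))"
        by (rule mult_left_mono[OF K(2)[OF h(1)]]) simp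
      moreover have "indicator {-\<epsilon>-1..\<epsilon>+1} (x - y) = (indicator {x-\<epsilon>-1..x+\<epsilon>+1} y :: real)"
        by (auto simp: indicator_def)
      ultimately show "norm (f y * \<rho> (x + h - y) - f y * \<rho> (x - y) - h * (f y * deriv \<rho> (x - y)))
          \<le> K * h\<^sup>2 * (\<bar>f y\<bar> * indicator {x-\<epsilon>-1..x+\<epsilon>+1} y)"
        unfolding eq by (simp add: mult_ac abs_mult)
    qed (use int1 int2 int3 in auto)
    also have "\<dots> = K * L * \<bar>h\<bar> * \<bar>h\<bar>"
      by (simp add: L_def power2_eq_square mult_ac abs_mult_self_eq)
    finally have "\<bar>conv f (x + h) - conv f x - h * D\<bar> / \<bar>h\<bar> \<le> K * L * \<bar>h\<bar>"
      using h by (simp add: pos_divide_le_eq)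
    moreover have "(conv f (x + h) - conv f x) / h - D = (conv f (x + h) - conv f x - h * D) / h"
      using h by (simp add: field_simps)
    ultimately show ?thesis by (simp only: abs_divide)
  qed
  have "((\<lambda>h. (conv f (x + h) - conv f x) / h - D) \<longlongrightarrow> 0) (at 0)"
  proof (rule Lim_null_comparison)
    show "\<forall>\<^sub>F h in at 0. norm ((conv f (x + h) - conv f x) / h - D) \<le> K * L * \<bar>h\<bar>"
      unfolding eventually_at by (rule exI[of _ 1]) (use bd in auto)
    show "((\<lambda>h. K * L * \<bar>h\<bar>) \<longlongrightarrow> 0) (at 0)" by (auto intro!: tendsto_eq_intros)
  qed
  then show ?thesis by (simp add: DERIV_def D_def LIM_zero_iff)
qed

text \<open>
  The kernel \<open>\<lambda>y. \<rho> (x - y)\<close> is a test function, so the derivative can be moved from it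
  to the function by the definition of weak derivatives.
\<close>

lemma conv_has_weak_derivative:
  assumes "has_weak_deriv 1 v v1"
  shows "(conv (rep_L2 v) has_real_derivative conv (rep_L2 v1) x) (at x)"
proof -
  have "(LINT y|lebesgue. rep_L2 v y * deriv (\<lambda>y. \<rho> (x - y)) y) = - (LINT y|lebesgue. rep_L2 v1 y * \<rho> (x - y))"
    using assms test_function_kernel[of x] by (auto simp: has_weak_deriv_def)
  then have "(LINT y|lebesgue. rep_L2 v y * deriv \<rho> (x - y)) = conv (rep_L2 v1) x"
    by (simp add: deriv_kernel conv_def)
  then show ?thesis using conv_has_derivative[OF square_integrable_rep_L2, of v x] by simp
qed

lemma continuous_conv: "square_integrable f \<Longrightarrow> continuous_on A (conv f)"
  by (meson DERIV_continuous_on DERIV_subset conv_has_derivative subset_UNIV)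

lemma conv_diff:
  assumes "square_integrable f" "square_integrable g"
  shows "conv (\<lambda>y. f y - g y) x = conv f x - conv g x"
  unfolding conv_def
  using assms[THEN square_integrable_mult, OF square_integrable_kernel]
  by (simp add: left_diff_distrib)

text \<open>
  Jensen's inequality for the probability density \<open>\<lambda>y. \<rho> (x - y)\<close>: the variance is nonnegative.
\<close>

lemma conv_square_le:
  assumes f: "square_integrable f"
  shows "integrable lebesgue (\<lambda>y. (f y)\<^sup>2 * \<rho> (x - y))"
    and "(conv f x)\<^sup>2 \<le> (LINT y|lebesgue. (f y)\<^sup>2 * \<rho> (x - y))"
proof -
  obtain B where B: "\<And>x. \<bar>\<rho> x\<bar> \<le> B"
    using bounded_if_continuous_compact_support[OF continuous_\<rho> support] by metis
  have f2: "integrable lebesgue (\<lambda>y. (f y)\<^sup>2)" and [measurable]: "f \<in> borel_measurable lebesgue"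
    using f by (auto simp: square_integrable_def)
  have [measurable]: "(\<lambda>y. \<rho> (x - y)) \<in> borel_measurable lebesgue"
    using square_integrable_kernel by (simp add: square_integrable_def)
  show int: "integrable lebesgue (\<lambda>y. (f y)\<^sup>2 * \<rho> (x - y))"
  proof (rule Bochner_Integration.integrable_bound)
    show "integrable lebesgue (\<lambda>y. B * (f y)\<^sup>2)" using f2 by simp
    show "AE y in lebesgue. norm ((f y)\<^sup>2 * \<rho> (x - y)) \<le> norm (B * (f y)\<^sup>2)"
    proof (rule AE_I2)
      fix y
      have "\<bar>\<rho> (x - y)\<bar> \<le> \<bar>B\<bar>" using B[of "x - y"] by linarith
      then have "\<bar>\<rho> (x - y)\<bar> * (f y)\<^sup>2 \<le> \<bar>B\<bar> * (f y)\<^sup>2" by (rule mult_right_mono) simp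
      then show "norm ((f y)\<^sup>2 * \<rho> (x - y)) \<le> norm (B * (f y)\<^sup>2)"
        by (simp add: abs_mult mult.commute)
    qed
  qed measurable
  have int1: "integrable lebesgue (\<lambda>y. f y * \<rho> (x - y))"
    by (rule square_integrable_mult[OF f square_integrable_kernel])
  \<comment> \<open>The mean of \<open>f\<close> with respect to the density; its variance is expanded below.\<close>
  define m where "m = conv f x"
  have "0 \<le> (LINT y|lebesgue. (f y - m)\<^sup>2 * \<rho> (x - y))"
    by (intro integral_nonneg_AE) (simp add: nonneg)
  also have "\<dots> = (LINT y|lebesgue. (f y)\<^sup>2 * \<rho> (x - y) - 2 * m * (f y * \<rho> (x - y)) + m\<^sup>2 * \<rho> (x - y))"
    by (intro Bochner_Integration.integral_cong) (auto simp: power2_eq_square algebra_simps)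
  also have "\<dots> = (LINT y|lebesgue. (f y)\<^sup>2 * \<rho> (x - y)) - 2 * m * m + m\<^sup>2 * 1"
  proof -
    have "(LINT y|lebesgue. f y * \<rho> (x - y)) = m" by (simp add: m_def conv_def)
    then show ?thesis
      using int int1 integrable_kernel[of x] integral_kernel[of x]
      by simp
  qed
  finally show "(conv f x)\<^sup>2 \<le> (LINT y|lebesgue. (f y)\<^sup>2 * \<rho> (x - y))"
    by (simp add: m_def power2_eq_square)
qed

text \<open>
  Integrate \<open>conv_square_le\<close> over \<open>x\<close> and exchange the integrals. A Borel representative is
  needed for measurability on the product.
\<close>

lemma conv_L2_contraction:
  assumes f: "square_integrable f"
  shows "square_integrable (conv f)" "norm (abs_L2 (conv f)) \<le> norm (abs_L2 f)"
proof -
  have fm: "f \<in> borel_measurable lebesgue" using f by (simp add: square_integrable_def)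
  obtain g where g [measurable]: "g \<in> borel_measurable lborel" and fg: "AE x in lborel. f x = g x"
    using completion_ex_borel_measurable_real[OF fm] by blast
  have fg': "AE x in lebesgue. f x = g x" using fg by (rule AE_completion)
  have [measurable]: "\<rho> \<in> borel_measurable borel"
    by (rule borel_measurable_continuous_onI[OF continuous_\<rho>])
  have total': "(\<integral>\<^sup>+x. ennreal (\<rho> (x - y)) \<partial>lborel) = 1" for y
  proof -
    have "(\<integral>\<^sup>+x. ennreal (\<rho> x) \<partial>lborel) = ennreal (LINT x|lborel. \<rho> x)"
      using support by (intro nn_integral_eq_integral integrable_if_continuous_compact_support(1)
          [OF continuous_\<rho>, of "-\<epsilon>" \<epsilon>]) (auto simp: nonneg)
    then have "(\<integral>\<^sup>+x. ennreal (\<rho> x) \<partial>lborel) = 1" using total by simp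
    then show ?thesis
      using nn_integral_real_affine[of "\<lambda>x. ennreal (\<rho> x)" 1 "-y"] by simp
  qed
  have pt: "ennreal ((conv f x)\<^sup>2) \<le> (\<integral>\<^sup>+y. ennreal ((g y)\<^sup>2) * ennreal (\<rho> (x - y)) \<partial>lborel)" for x
  proof -
    have "ennreal ((conv f x)\<^sup>2) \<le> ennreal (LINT y|lebesgue. (f y)\<^sup>2 * \<rho> (x - y))"
      by (rule ennreal_leI[OF conv_square_le(2)[OF f]])
    also have "\<dots> = (\<integral>\<^sup>+y. ennreal ((f y)\<^sup>2 * \<rho> (x - y)) \<partial>lebesgue)"
      by (rule nn_integral_eq_integral[symmetric, OF conv_square_le(1)[OF f]]) (simp add: nonneg)
    also have "\<dots> = (\<integral>\<^sup>+y. ennreal ((g y)\<^sup>2) * ennreal (\<rho> (x - y)) \<partial>lebesgue)"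
      using fg' by (intro nn_integral_cong_AE) (auto simp: ennreal_mult nonneg elim: eventually_mono)
    finally show ?thesis by (simp add: nn_integral_completion)
  qed
  have "(\<integral>\<^sup>+x. ennreal ((conv f x)\<^sup>2) \<partial>lborel)
      \<le> (\<integral>\<^sup>+x. \<integral>\<^sup>+y. ennreal ((g y)\<^sup>2) * ennreal (\<rho> (x - y)) \<partial>lborel \<partial>lborel)"
    by (intro nn_integral_mono pt)
  also have "\<dots> = (\<integral>\<^sup>+y. \<integral>\<^sup>+x. ennreal ((g y)\<^sup>2) * ennreal (\<rho> (x - y)) \<partial>lborel \<partial>lborel)"
    by (rule lborel_pair.Fubini') measurable
  also have "\<dots> = (\<integral>\<^sup>+y. ennreal ((g y)\<^sup>2) \<partial>lborel)"
    by (simp add: nn_integral_cmult total')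
  also have "\<dots> = (\<integral>\<^sup>+y. ennreal ((f y)\<^sup>2) \<partial>lebesgue)"
    unfolding nn_integral_completion[symmetric, where M = lborel]
    using fg' by (intro nn_integral_cong_AE) (auto elim: eventually_mono)
  also have "\<dots> = ennreal ((norm (abs_L2 f))\<^sup>2)"
    using f by (subst nn_integral_eq_integral) (auto simp: square_integrable_def norm_abs_L2[OF f])
  finally have le: "(\<integral>\<^sup>+x. ennreal ((conv f x)\<^sup>2) \<partial>lebesgue) \<le> ennreal ((norm (abs_L2 f))\<^sup>2)"
    by (simp add: nn_integral_completion)
  have m: "conv f \<in> borel_measurable lebesgue"
    by (intro measurable_completion) (simp add: borel_measurable_continuous_onI continuous_conv[OF f])
  show sq: "square_integrable (conv f)"
    unfolding square_integrable_def using m le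
    by (auto intro!: integrableI_nonneg simp: le_less_trans)
  have "ennreal ((norm (abs_L2 (conv f)))\<^sup>2) \<le> ennreal ((norm (abs_L2 f))\<^sup>2)"
    using le sq unfolding norm_abs_L2[OF sq]
    by (subst (asm) nn_integral_eq_integral) (auto simp: square_integrable_def)
  then have "(norm (abs_L2 (conv f)))\<^sup>2 \<le> (norm (abs_L2 f))\<^sup>2"
    by (subst (asm) ennreal_le_iff) auto
  then show "norm (abs_L2 (conv f)) \<le> norm (abs_L2 f)" by (rule power2_le_imp_le) simp
qed

end

section \<open>Mollification converges in the mean\<close>

lemma inner_abs_L2:
  assumes "square_integrable f" "square_integrable g"
  shows "inner (abs_L2 f) (abs_L2 g) = (LINT x|lebesgue. f x * g x)"
  using assms by (simp add: inner_L2.abs_eq L2_eq_def)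

lemma square_integrable_abs: "square_integrable f \<Longrightarrow> square_integrable (\<lambda>x. \<bar>f x\<bar>)"
  by (auto simp: square_integrable_def)

lemma integral_mult_le_norms:
  assumes "square_integrable f" "square_integrable g"
  shows "(LINT x|lebesgue. \<bar>f x * g x\<bar>) \<le> norm (abs_L2 f) * norm (abs_L2 g)"
proof -
  note sq = assms[THEN square_integrable_abs]
  have norm_abs: "norm (abs_L2 (\<lambda>x. \<bar>h x\<bar>)) = norm (abs_L2 h)" if "square_integrable h" for h
  proof (rule power2_eq_imp_eq)
    show "(norm (abs_L2 (\<lambda>x. \<bar>h x\<bar>)))\<^sup>2 = (norm (abs_L2 h))\<^sup>2"
      unfolding norm_abs_L2[OF that] norm_abs_L2[OF square_integrable_abs[OF that]] by simp
  qed simp_all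
  have "(LINT x|lebesgue. \<bar>f x * g x\<bar>) = inner (abs_L2 (\<lambda>x. \<bar>f x\<bar>)) (abs_L2 (\<lambda>x. \<bar>g x\<bar>))"
    by (simp add: inner_abs_L2 sq abs_mult)
  also have "\<dots> \<le> norm (abs_L2 (\<lambda>x. \<bar>f x\<bar>)) * norm (abs_L2 (\<lambda>x. \<bar>g x\<bar>))"
    by (rule norm_cauchy_schwarz)
  finally show ?thesis using assms by (simp add: norm_abs)
qed

lemma L2_dominated_tendsto:
  assumes s: "\<And>n. square_integrable (s n)" and f: "square_integrable f"
    and lim: "AE x in lebesgue. (\<lambda>n. s n x) \<longlonglongrightarrow> f x"
    and w: "integrable lebesgue w"
    and le: "\<And>n. AE x in lebesgue. (s n x - f x)\<^sup>2 \<le> w x"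
  shows "(\<lambda>n. abs_L2 (s n)) \<longlonglongrightarrow> abs_L2 f"
proof -
  have d: "square_integrable (\<lambda>x. s n x - f x)" for n
    by (rule square_integrable_diff[OF s f])
  have "(\<lambda>n. LINT x|lebesgue. (s n x - f x)\<^sup>2) \<longlonglongrightarrow> (LINT x|(lebesgue :: real measure). 0)"
  proof (rule Bochner_Integration.integral_dominated_convergence[where w = w])
    show "AE x in lebesgue. (\<lambda>n. (s n x - f x)\<^sup>2) \<longlonglongrightarrow> 0"
      using lim
    proof eventually_elim
      case (elim x)
      then have "(\<lambda>n. (s n x - f x)\<^sup>2) \<longlonglongrightarrow> (f x - f x)\<^sup>2" by (intro tendsto_intros)
      then show ?case by simp
    qed
  qed (use le d w in \<open>auto simp: square_integrable_def\<close>)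
  then have "(\<lambda>n. (norm (abs_L2 (s n) - abs_L2 f))\<^sup>2) \<longlonglongrightarrow> 0"
    by (simp add: diff_abs_L2[OF s f] norm_abs_L2[OF d])
  then have "(\<lambda>n. sqrt ((norm (abs_L2 (s n) - abs_L2 f))\<^sup>2)) \<longlonglongrightarrow> sqrt 0"
    by (rule tendsto_real_sqrt)
  then show ?thesis by (simp add: tendsto_norm_zero_iff LIM_zero_iff)
qed

definition tent :: "real \<Rightarrow> real \<Rightarrow> real" where
  "tent k x = max 0 (min 1 (k + 1 - \<bar>x\<bar>))"

definition clamp_to :: "real \<Rightarrow> real \<Rightarrow> real" where
  "clamp_to k y = max (- k) (min k y)"

lemma continuous_on_tent [continuous_intros]: "continuous_on A (tent k)"
  unfolding tent_def by (intro continuous_intros)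

lemma tent_outside: "x \<notin> {-(k + 1)..k + 1} \<Longrightarrow> tent k x = 0"
  by (auto simp: tent_def)

lemma tent_bounds: "0 \<le> tent k x" "tent k x \<le> 1"
  by (auto simp: tent_def)

lemma square_integrable_tent: "square_integrable (tent k)"
  by (rule square_integrable_if_continuous_compact_support[OF continuous_on_tent tent_outside])

lemma tent_clamp_abs_le: "k \<ge> 0 \<Longrightarrow> \<bar>tent k x * clamp_to k y\<bar> \<le> \<bar>y\<bar>"
proof -
  assume "k \<ge> 0"
  then have "\<bar>clamp_to k y\<bar> \<le> \<bar>y\<bar>" by (auto simp: clamp_to_def)
  then have "\<bar>tent k x\<bar> * \<bar>clamp_to k y\<bar> \<le> 1 * \<bar>y\<bar>"
    using tent_bounds[of k x] by (intro mult_mono) auto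
  then show ?thesis by (simp add: abs_mult)
qed

lemma square_integrable_bounded:
  assumes "f \<in> borel_measurable lebesgue" "square_integrable g" "\<And>x. \<bar>f x\<bar> \<le> \<bar>g x\<bar>"
  shows "square_integrable f"
  unfolding square_integrable_def
proof
  show "integrable lebesgue (\<lambda>x. (f x)\<^sup>2)"
  proof (rule Bochner_Integration.integrable_bound)
    show "integrable lebesgue (\<lambda>x. (g x)\<^sup>2)" using assms by (simp add: square_integrable_def)
  qed (use assms in \<open>auto simp: abs_le_square_iff\<close>)
qed fact

text \<open>
  A Lebesgue measurable function is the pointwise limit almost everywhere of continuous functions.
  To make this limit dominated, values are first clamped to \<open>[-k, k]\<close> and the support is cut off
  by a tent function; both operations preserve continuity.
\<close>

lemma continuous_compact_support_dense_L2:
  assumes "e > 0"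
  obtains g R where "continuous_on UNIV g" "\<And>x. \<bar>x\<bar> > R \<Longrightarrow> g x = 0" "norm (abs_L2 g - v) < e"
proof -
  define f where "f = rep_L2 v"
  have f: "square_integrable f" and v: "abs_L2 f = v"
    by (simp_all add: f_def square_integrable_rep_L2 abs_rep_L2)
  then have fm [measurable]: "f \<in> borel_measurable lebesgue" by (simp add: square_integrable_def)
  define F where "F k x = tent (real k) x * clamp_to (real k) (f x)" for k x
  have tm [measurable]: "tent k \<in> borel_measurable lebesgue" for k
    using square_integrable_tent by (simp add: square_integrable_def)
  have [measurable]: "F k \<in> borel_measurable lebesgue" for k
    unfolding F_def clamp_to_def by measurable
  have F: "square_integrable (F k)" for k
    by (rule square_integrable_bounded[OF _ f]) (auto simp: F_def tent_clamp_abs_le)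
  have "(\<lambda>k. abs_L2 (F k)) \<longlonglongrightarrow> abs_L2 f"
  proof (rule L2_dominated_tendsto[OF F f])
    show "integrable lebesgue (\<lambda>x. 4 * (f x)\<^sup>2)" using f by (simp add: square_integrable_def)
    show "AE x in lebesgue. (\<lambda>k. F k x) \<longlonglongrightarrow> f x"
    proof (rule AE_I2, rule tendsto_eventually)
      fix x
      obtain N where N: "\<bar>x\<bar> + \<bar>f x\<bar> \<le> real N" using real_arch_simple by blast
      have "F k x = f x" if "k \<ge> N" for k
      proof -
        have "\<bar>x\<bar> + \<bar>f x\<bar> \<le> real k" using N that by linarith
        then have "tent (real k) x = 1" "clamp_to (real k) (f x) = f x"
          by (auto simp: tent_def clamp_to_def)
        then show ?thesis by (simp add: F_def)
      qed
      then show "\<forall>\<^sub>F k in sequentially. F k x = f x" by (auto simp: eventually_sequentially)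
    qed
    show "AE x in lebesgue. (F k x - f x)\<^sup>2 \<le> 4 * (f x)\<^sup>2" for k
    proof (rule AE_I2)
      fix x
      have "\<bar>F k x - f x\<bar> \<le> \<bar>2 * f x\<bar>"
        using tent_clamp_abs_le[of "real k" x "f x"] unfolding F_def[symmetric] by simp
      then show "(F k x - f x)\<^sup>2 \<le> 4 * (f x)\<^sup>2"
        using abs_le_square_iff[of "F k x - f x" "2 * f x"] by (simp add: power_mult_distrib)
    qed
  qed
  from tendstoD[OF this, of "e / 2"]
  have "\<forall>\<^sub>F k in sequentially. norm (abs_L2 (F k) - v) < e / 2"
    using \<open>e > 0\<close> v by (simp add: dist_norm)
  then obtain k where k: "norm (abs_L2 (F k) - v) < e / 2"
    by (auto simp: eventually_sequentially)
  have "f measurable_on UNIV"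
    using fm by (intro lebesgue_measurable_imp_measurable_on_real) auto
  then obtain N g where N: "negligible N" and g: "\<And>n. continuous_on UNIV (g n)"
    and lim: "\<And>x. x \<notin> N \<Longrightarrow> (\<lambda>n. g n x) \<longlonglongrightarrow> f x"
    by (auto simp: measurable_on_def)
  define G where "G n x = tent (real k) x * clamp_to (real k) (g n x)" for n x
  have G_cont: "continuous_on UNIV (G n)" for n
    unfolding G_def clamp_to_def by (intro continuous_intros g)
  have G_supp: "G n x = 0" if "x \<notin> {-(real k + 1)..real k + 1}" for n x
    using tent_outside[OF that] by (simp add: G_def)
  have G: "square_integrable (G n)" for n
    by (rule square_integrable_if_continuous_compact_support[OF G_cont G_supp])
  have "(\<lambda>n. abs_L2 (G n)) \<longlonglongrightarrow> abs_L2 (F k)"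
  proof (rule L2_dominated_tendsto[OF G F])
    show "integrable lebesgue (\<lambda>x. (2 * real k * tent (real k) x)\<^sup>2)"
      using square_integrable_scale[OF square_integrable_tent, of "2 * real k" "real k"]
      by (simp add: square_integrable_def)
    have "AE x in lebesgue. x \<notin> N"
      using N by (intro AE_not_in) (simp add: negligible_iff_null_sets)
    then show "AE x in lebesgue. (\<lambda>n. G n x) \<longlonglongrightarrow> F k x"
    proof eventually_elim
      case (elim x)
      then show ?case unfolding G_def F_def clamp_to_def
        by (intro tendsto_mult tendsto_const tendsto_max tendsto_min lim)
    qed
    show "AE x in lebesgue. (G n x - F k x)\<^sup>2 \<le> (2 * real k * tent (real k) x)\<^sup>2" for n
    proof (rule AE_I2)
      fix x
      have "\<bar>clamp_to (real k) (g n x) - clamp_to (real k) (f x)\<bar> \<le> 2 * real k"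
        by (auto simp: clamp_to_def)
      then have "\<bar>tent (real k) x\<bar> * \<bar>clamp_to (real k) (g n x) - clamp_to (real k) (f x)\<bar>
          \<le> \<bar>tent (real k) x\<bar> * (2 * real k)"
        by (rule mult_left_mono) simp
      then have "\<bar>G n x - F k x\<bar> \<le> \<bar>2 * real k * tent (real k) x\<bar>"
        by (simp add: G_def F_def abs_mult[symmetric] right_diff_distrib mult_ac)
      then show "(G n x - F k x)\<^sup>2 \<le> (2 * real k * tent (real k) x)\<^sup>2"
        by (simp only: abs_le_square_iff)
    qed
  qed
  from tendstoD[OF this, of "e / 2"]
  have "\<forall>\<^sub>F n in sequentially. norm (abs_L2 (G n) - abs_L2 (F k)) < e / 2"
    using \<open>e > 0\<close> by (simp add: dist_norm)
  then obtain n where n: "norm (abs_L2 (G n) - abs_L2 (F k)) < e / 2"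
    by (auto simp: eventually_sequentially)
  have "norm (abs_L2 (G n) - v) < e"
    using norm_triangle_ineq[of "abs_L2 (G n) - abs_L2 (F k)" "abs_L2 (F k) - v"] n k by simp
  then show thesis
    using that[of "G n" "real k + 1"] G_cont[of n] G_supp[of _ n] by force
qed

text \<open>
  Uniform continuity gives \<open>|\<rho> * g - g| \<le> \<eta>\<close>, and both functions vanish off a fixed
  interval of length \<open>2 r + 2\<close>.
\<close>

lemma mollification_tendsto_continuous:
  assumes g: "continuous_on UNIV g" and supp: "\<And>x. \<bar>x\<bar> > R \<Longrightarrow> g x = 0" and "e > 0"
  obtains \<delta> where "\<delta> > 0"
    "\<And>\<rho> \<epsilon>. mollifier \<rho> \<epsilon> \<Longrightarrow> \<epsilon> \<le> \<delta> \<Longrightarrow> norm (abs_L2 (mollifier.conv \<rho> g) - abs_L2 g) < e"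
proof -
  define r where "r = max R 0"
  have r: "r \<ge> 0" and supp: "g x = 0" if "\<bar>x\<bar> > r" for x
    using supp that by (auto simp: r_def)
  have r: "r \<ge> 0" by (simp add: r_def)
  \<comment> \<open>Chosen so that \<open>\<eta>\<^sup>2 (2 r + 2) < e\<^sup>2\<close>.\<close>
  define \<eta> where "\<eta> = e / (2 * r + 3)"
  have \<eta>: "\<eta> > 0" using \<open>e > 0\<close> r by (simp add: \<eta>_def)
  have "uniformly_continuous_on {-(r + 2)..r + 2} g"
    by (intro compact_uniformly_continuous continuous_on_subset[OF g]) auto
  then obtain d where d: "d > 0"
    "\<And>x y. x \<in> {-(r+2)..r+2} \<Longrightarrow> y \<in> {-(r+2)..r+2} \<Longrightarrow> dist y x < d \<Longrightarrow> dist (g y) (g x) < \<eta>"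
    unfolding uniformly_continuous_on_def using \<eta> by metis
  have gsq: "square_integrable g"
    by (rule square_integrable_if_continuous_compact_support[OF g, of "-r" r]) (use supp in auto)
  define \<delta> where "\<delta> = min 1 (d / 2)"
  have "norm (abs_L2 (mollifier.conv \<rho> g) - abs_L2 g) < e" if m: "mollifier \<rho> \<epsilon>" and "\<epsilon> \<le> \<delta>" for \<rho> \<epsilon>
  proof -
    interpret mollifier \<rho> \<epsilon> by fact
    have osc: "\<bar>g y - g x\<bar> * \<rho> (x - y) \<le> \<eta> * indicator {-(r+1)..r+1} x * \<rho> (x - y)" for x y
    proof (cases "\<rho> (x - y) = 0")
      case False
      then have xy: "\<bar>x - y\<bar> \<le> \<delta>" using support[of "x - y"] \<open>\<epsilon> \<le> \<delta>\<close> by force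
      have "\<bar>g y - g x\<bar> \<le> \<eta> * indicator {-(r+1)..r+1} x"
      proof (cases "x \<in> {-(r+1)..r+1}")
        case True
        then have "x \<in> {-(r+2)..r+2}" "y \<in> {-(r+2)..r+2}" "dist y x < d"
          using xy d(1) by (auto simp: \<delta>_def dist_real_def abs_minus_commute[of y x])
        then have "\<bar>g y - g x\<bar> < \<eta>" using d(2) by (simp add: dist_real_def)
        then show ?thesis using True by simp
      next
        case out: False
        then have "\<bar>x\<bar> > r" "\<bar>y\<bar> > r" using xy by (auto simp: \<delta>_def)
        then show ?thesis using out supp by simp
      qed
      then show ?thesis using nonneg by (rule mult_right_mono)
    qed simp
    have bd: "\<bar>conv g x - g x\<bar> \<le> \<eta> * indicator {-(r+1)..r+1} x" for x
    proof -
      have int: "integrable lebesgue (\<lambda>y. g y * \<rho> (x - y))"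
        by (rule square_integrable_mult[OF gsq square_integrable_kernel])
      have "conv g x - g x = (LINT y|lebesgue. g y * \<rho> (x - y)) - (LINT y|lebesgue. g x * \<rho> (x - y))"
        using integral_kernel by (simp add: conv_def)
      also have "\<dots> = (LINT y|lebesgue. (g y - g x) * \<rho> (x - y))"
        using int integrable_kernel[of x] by (simp add: left_diff_distrib)
      finally have eq: "conv g x - g x = (LINT y|lebesgue. (g y - g x) * \<rho> (x - y))" .
      have "norm (conv g x - g x) \<le> (LINT y|lebesgue. \<eta> * indicator {-(r+1)..r+1} x * \<rho> (x - y))"
        unfolding eq
      proof (rule Bochner_Integration.integral_norm_bound_integral)
        show "integrable lebesgue (\<lambda>y. (g y - g x) * \<rho> (x - y))"
          using int integrable_kernel[of x] by (simp add: left_diff_distrib)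
        show "integrable lebesgue (\<lambda>y. \<eta> * indicator {-(r+1)..r+1} x * \<rho> (x - y))"
          using integrable_kernel[of x] by simp
        show "norm ((g y - g x) * \<rho> (x - y)) \<le> \<eta> * indicator {-(r+1)..r+1} x * \<rho> (x - y)" for y
          using osc[of y x] nonneg[of "x - y"] by (simp add: abs_mult)
      qed
      then show ?thesis using integral_kernel[of x] by simp
    qed
    note csq = conv_L2_contraction(1)[OF gsq]
    have dsq: "square_integrable (\<lambda>x. conv g x - g x)"
      by (rule square_integrable_diff[OF csq gsq])
    have "(norm (abs_L2 (conv g) - abs_L2 g))\<^sup>2 = (LINT x|lebesgue. (conv g x - g x)\<^sup>2)"
      by (simp add: diff_abs_L2[OF csq gsq] norm_abs_L2[OF dsq])
    also have "\<dots> \<le> (LINT x|lebesgue. \<eta>\<^sup>2 * indicator {-(r+1)..r+1} x)"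
    proof (rule integral_mono)
      show "integrable lebesgue (\<lambda>x. (conv g x - g x)\<^sup>2)" using dsq by (simp add: square_integrable_def)
      show "integrable lebesgue (\<lambda>x. \<eta>\<^sup>2 * indicator {-(r+1)..r+1} x)"
        by (intro integrable_mult_right integrable_real_indicator) (auto simp: emeasure_lborel_Icc_eq)
      show "(conv g x - g x)\<^sup>2 \<le> \<eta>\<^sup>2 * indicator {-(r+1)..r+1} x" for x
        using power_mono[OF bd[of x], of 2] by (auto simp: indicator_def split: if_splits)
    qed
    also have "\<dots> = \<eta>\<^sup>2 * (2 * r + 2)"
      using r by (simp add: measure_def emeasure_lborel_Icc_eq)
    also have "\<dots> < e\<^sup>2"
    proof -
      have "\<eta>\<^sup>2 * (2 * r + 2) < \<eta>\<^sup>2 * (2 * r + 3)\<^sup>2"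
        using r \<eta> by (intro mult_strict_left_mono) (auto simp: power2_eq_square algebra_simps intro!: add_pos_nonneg)
      also have "\<dots> = e\<^sup>2" using r by (simp add: \<eta>_def power_divide)
      finally show ?thesis .
    qed
    finally show ?thesis using \<open>e > 0\<close> by (simp add: power_less_imp_less_base)
  qed
  moreover have "\<delta> > 0" using d(1) by (simp add: \<delta>_def)
  ultimately show thesis by (intro that)
qed

text \<open>
  One \<open>\<delta>\<close> works for all mollifiers of support in \<open>[-\<delta>, \<delta>]\<close>, so that a single mollifier can serve a function and its weak derivative at the same time.
\<close>

lemma mollification_tendsto:
  assumes "e > 0"
  obtains \<delta> where "\<delta> > 0"
    "\<And>\<rho> \<epsilon>. mollifier \<rho> \<epsilon> \<Longrightarrow> \<epsilon> \<le> \<delta> \<Longrightarrow> norm (abs_L2 (mollifier.conv \<rho> (rep_L2 v)) - v) < e"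
proof -
  have e3: "e / 3 > 0" using assms by simp
  obtain g R where g: "continuous_on UNIV g" "\<And>x. \<bar>x\<bar> > R \<Longrightarrow> g x = 0" "norm (abs_L2 g - v) < e / 3"
    using continuous_compact_support_dense_L2[OF e3, of v] by metis
  obtain \<delta> where \<delta>: "\<delta> > 0"
    "\<And>\<rho> \<epsilon>. mollifier \<rho> \<epsilon> \<Longrightarrow> \<epsilon> \<le> \<delta> \<Longrightarrow> norm (abs_L2 (mollifier.conv \<rho> g) - abs_L2 g) < e / 3"
    using mollification_tendsto_continuous[OF g(1,2) e3] by metis
  have gsq: "square_integrable g"
    by (rule square_integrable_if_continuous_compact_support[OF g(1), of "-R" R]) (use g(2) in auto)
  have "norm (abs_L2 (mollifier.conv \<rho> (rep_L2 v)) - v) < e" if m: "mollifier \<rho> \<epsilon>" and "\<epsilon> \<le> \<delta>" for \<rho> \<epsilon>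
  proof -
    interpret mollifier \<rho> \<epsilon> by fact
    let ?v = "rep_L2 v"
    note vsq = square_integrable_rep_L2[of v]
    have "abs_L2 (conv ?v) - abs_L2 (conv g) = abs_L2 (conv (\<lambda>x. ?v x - g x))"
    proof -
      have "conv (\<lambda>x. ?v x - g x) = (\<lambda>x. conv ?v x - conv g x)"
        by (rule ext) (rule conv_diff[OF vsq gsq])
      then show ?thesis using vsq gsq by (simp add: diff_abs_L2 conv_L2_contraction(1))
    qed
    then have "norm (abs_L2 (conv ?v) - abs_L2 (conv g)) \<le> norm (abs_L2 (\<lambda>x. ?v x - g x))"
      using conv_L2_contraction(2)[OF square_integrable_diff[OF vsq gsq]] by simp
    also have "abs_L2 (\<lambda>x. ?v x - g x) = v - abs_L2 g"
      using diff_abs_L2[OF vsq gsq] by (simp add: abs_rep_L2)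
    finally have "norm (abs_L2 (conv ?v) - abs_L2 (conv g)) < e / 3"
      using g(3) by (simp add: norm_minus_commute)
    moreover have "norm (abs_L2 (conv g) - abs_L2 g) < e / 3" using \<delta>(2) that by blast
    ultimately show ?thesis
      using g(3) norm_triangle_ineq[of "abs_L2 (conv ?v) - abs_L2 (conv g)" "abs_L2 (conv g) - abs_L2 g"]
        norm_triangle_ineq[of "abs_L2 (conv ?v) - abs_L2 g" "abs_L2 g - v"]
      by simp
  qed
  then show thesis using that[OF \<delta>(1)] by blast
qed

section \<open>Weak derivatives\<close>

text \<open>
  Classical stand-ins for elements of \<open>H\<^sup>1\<close>: differentiable at every point, which is what the
  fundamental theorem of calculus for the gauge integral asks for.
\<close>

definition H1_pair :: "(real \<Rightarrow> real) \<Rightarrow> (real \<Rightarrow> real) \<Rightarrow> bool" where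
  "H1_pair w w' \<longleftrightarrow> (\<forall>x. (w has_real_derivative w' x) (at x)) \<and> square_integrable w \<and> square_integrable w'"

text \<open>
  Mollification commutes with weak differentiation, and it converges for both functions.
\<close>

lemma H1_dense:
  assumes "has_weak_deriv 1 v v1"
  obtains w w' where "\<And>n. H1_pair (w n) (w' n)"
    "(\<lambda>n. abs_L2 (w n)) \<longlonglongrightarrow> v" "(\<lambda>n. abs_L2 (w' n)) \<longlonglongrightarrow> v1"
proof -
  have "\<exists>w w'. H1_pair w w' \<and> norm (abs_L2 w - v) < e \<and> norm (abs_L2 w' - v1) < e" if e: "e > 0" for e
  proof -
    obtain \<delta>1 where \<delta>1: "\<delta>1 > 0"
      "\<And>\<rho> \<epsilon>. mollifier \<rho> \<epsilon> \<Longrightarrow> \<epsilon> \<le> \<delta>1 \<Longrightarrow> norm (abs_L2 (mollifier.conv \<rho> (rep_L2 v)) - v) < e"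
      using mollification_tendsto[OF e, of v] by metis
    obtain \<delta>2 where \<delta>2: "\<delta>2 > 0"
      "\<And>\<rho> \<epsilon>. mollifier \<rho> \<epsilon> \<Longrightarrow> \<epsilon> \<le> \<delta>2 \<Longrightarrow> norm (abs_L2 (mollifier.conv \<rho> (rep_L2 v1)) - v1) < e"
      using mollification_tendsto[OF e, of v1] by metis
    note \<delta> = \<delta>1 \<delta>2
    obtain \<rho> where m: "mollifier \<rho> (min \<delta>1 \<delta>2)"
      using mollifier_exists[of "min \<delta>1 \<delta>2"] \<delta> by (metis min_less_iff_conj)
    interpret mollifier \<rho> "min \<delta>1 \<delta>2" by fact
    have "H1_pair (conv (rep_L2 v)) (conv (rep_L2 v1))"
      using conv_has_weak_derivative[OF assms]
      by (simp add: H1_pair_def conv_L2_contraction(1) square_integrable_rep_L2)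
    then show ?thesis using \<delta> m by (metis min.cobounded1 min.cobounded2)
  qed
  then have "\<forall>n. \<exists>w w'. H1_pair w w' \<and> norm (abs_L2 w - v) < inverse (real (Suc n))
      \<and> norm (abs_L2 w' - v1) < inverse (real (Suc n))" by simp
  then obtain w w' where w: "\<And>n. H1_pair (w n) (w' n)"
    "\<And>n. norm (abs_L2 (w n) - v) < inverse (real (Suc n))"
    "\<And>n. norm (abs_L2 (w' n) - v1) < inverse (real (Suc n))"
    by metis
  show thesis
  proof (rule that[OF w(1)])
    have "(\<lambda>n. abs_L2 (w n) - v) \<longlonglongrightarrow> 0"
      by (rule Lim_null_comparison[OF _ LIMSEQ_inverse_real_of_nat]) (use w(2) in \<open>auto intro!: always_eventually less_imp_le\<close>)
    then show "(\<lambda>n. abs_L2 (w n)) \<longlonglongrightarrow> v" by (simp add: LIM_zero_iff)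
    have "(\<lambda>n. abs_L2 (w' n) - v1) \<longlonglongrightarrow> 0"
      by (rule Lim_null_comparison[OF _ LIMSEQ_inverse_real_of_nat]) (use w(3) in \<open>auto intro!: always_eventually less_imp_le\<close>)
    then show "(\<lambda>n. abs_L2 (w' n)) \<longlonglongrightarrow> v1" by (simp add: LIM_zero_iff)
  qed
qed

text \<open>
  An integrable function need not tend to zero at infinity, but it cannot stay above a positive
  constant on a half line.
\<close>

lemma integrable_vanishing_sequence:
  fixes F :: "real \<Rightarrow> real"
  assumes F: "integrable lebesgue F" and nonneg: "\<And>x. F x \<ge> 0"
  obtains R :: "nat \<Rightarrow> real" where "\<And>n. R n \<ge> real n" "(\<lambda>n. F (R n)) \<longlonglongrightarrow> 0"
proof -
  have "\<exists>r\<ge>real n. F r < inverse (real (Suc n))" for n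
  proof (rule ccontr)
    assume neg: "\<not> ?thesis"
    define c where "c = inverse (real (Suc n))"
    have ge: "F x \<ge> c" if "x \<ge> real n" for x using neg that by (force simp: c_def)
    have le: "c * k \<le> (LINT x|lebesgue. F x)" if "k \<ge> 0" for k
    proof -
      have "c * k = (LINT x|lebesgue. c * indicator {real n..real n + k} x)"
        using that by (simp add: measure_def emeasure_lborel_Icc_eq)
      also have "\<dots> \<le> (LINT x|lebesgue. F x)"
      proof (rule integral_mono[OF _ F])
        show "integrable lebesgue (\<lambda>x. c * indicator {real n..real n + k} x)"
          by (intro integrable_mult_right integrable_real_indicator) (auto simp: emeasure_lborel_Icc_eq)
        show "c * indicator {real n..real n + k} x \<le> F x" for x
          using ge[of x] nonneg[of x] by (auto simp: indicator_def)
      qed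
      finally show ?thesis .
    qed
    have I: "(LINT x|lebesgue. F x) \<ge> 0" by (intro integral_nonneg_AE) (simp add: nonneg)
    have c: "c > 0" by (simp add: c_def)
    have "c * (((LINT x|lebesgue. F x) + 1) / c) \<le> (LINT x|lebesgue. F x)"
      using I c by (intro le) auto
    then show False using c by simp
  qed
  then obtain R where R: "\<And>n. R n \<ge> real n" "\<And>n. F (R n) < inverse (real (Suc n))" by metis
  have "(\<lambda>n. F (R n)) \<longlonglongrightarrow> 0"
    by (rule Lim_null_comparison[OF _ LIMSEQ_inverse_real_of_nat])
       (use R(2) nonneg in \<open>auto intro!: always_eventually less_imp_le\<close>)
  then show thesis using that R(1) by blast
qed

lemma integral_deriv_interval:
  fixes P P' :: "real \<Rightarrow> real"
  assumes D: "\<And>x. (P has_real_derivative P' x) (at x)" and P': "integrable lebesgue P'" and "a \<le> b"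
  shows "(LINT x|lebesgue. indicator {a..b} x * P' x) = P b - P a"
proof -
  have "set_integrable lebesgue {a..b} P'"
    using integrable_mult_indicator[OF _ P', of "{a..b}"] by (simp add: set_integrable_def)
  from set_lebesgue_integral_eq_integral(2)[OF this]
  have "(LINT x|lebesgue. indicator {a..b} x * P' x) = integral {a..b} P'"
    by (simp add: set_lebesgue_integral_def)
  also have "(P' has_integral P b - P a) {a..b}"
    using D \<open>a \<le> b\<close> by (intro fundamental_theorem_of_calculus)
       (auto simp: has_real_derivative_iff_has_vector_derivative intro: has_vector_derivative_at_within)
  then have "integral {a..b} P' = P b - P a" by (rule integral_unique)
  finally show ?thesis .
qed

text \<open>
  The boundary terms in the fundamental theorem of calculus vanish along a sequence of intervals
  \<open>[-R n, R n]\<close>; it has to be the same sequence at both ends, whence the sum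
  \<open>|P x| + |P (-x)|\<close>.
\<close>

lemma
  fixes P P' :: "real \<Rightarrow> real"
  assumes D: "\<And>x. (P has_real_derivative P' x) (at x)"
    and P: "integrable lebesgue P" and P': "integrable lebesgue P'"
  shows integral_deriv_eq_0: "(LINT x|lebesgue. P' x) = 0"
    and abs_le_integral_deriv: "\<bar>P x\<bar> \<le> (LINT x|lebesgue. \<bar>P' x\<bar>)"
proof -
  have "integrable lebesgue (\<lambda>x. P (- x))"
  proof -
    have [measurable]: "P \<in> borel_measurable borel"
      by (intro borel_measurable_continuous_onI DERIV_continuous_on) (use D in blast)
    have "integrable lborel P" using P by (simp add: integrable_completion)
    from lborel_integrable_real_affine[OF this, of "-1" 0]
    show ?thesis by (simp add: integrable_completion)
  qed
  then obtain R where R: "\<And>n. R n \<ge> real n" "(\<lambda>n. \<bar>P (R n)\<bar> + \<bar>P (- R n)\<bar>) \<longlonglongrightarrow> 0"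
    using integrable_vanishing_sequence[of "\<lambda>x. \<bar>P x\<bar> + \<bar>P (- x)\<bar>"] P by auto
  have R1: "(\<lambda>n. P (R n)) \<longlonglongrightarrow> 0" and R2: "(\<lambda>n. P (- R n)) \<longlonglongrightarrow> 0"
    by (rule Lim_null_comparison[OF _ R(2)]; simp)+
  have "(\<lambda>n. LINT x|lebesgue. indicator {- R n..R n} x * P' x) \<longlonglongrightarrow> (LINT x|lebesgue. P' x)"
  proof (rule Bochner_Integration.integral_dominated_convergence)
    show "integrable lebesgue (\<lambda>x. \<bar>P' x\<bar>)" using P' by simp
    show "AE x in lebesgue. (\<lambda>n. indicator {- R n..R n} x * P' x) \<longlonglongrightarrow> P' x"
    proof (rule AE_I2, rule tendsto_eventually)
      fix x :: real
      obtain N where N: "\<bar>x\<bar> \<le> real N" using real_arch_simple by blast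
      have "indicator {- R n..R n} x * P' x = P' x" if "n \<ge> N" for n
        using R(1)[of n] N that by (auto simp: indicator_def)
      then show "\<forall>\<^sub>F n in sequentially. indicator {- R n..R n} x * P' x = P' x"
        by (auto simp: eventually_sequentially)
    qed
    show "(\<lambda>x. indicator {- R n..R n} x * P' x) \<in> borel_measurable lebesgue" for n
      using P' by (intro borel_measurable_times borel_measurable_indicator) auto
  qed (use P' in \<open>auto simp: indicator_def\<close>)
  moreover have "(LINT x|lebesgue. indicator {- R n..R n} x * P' x) = P (R n) - P (- R n)" for n
    using R(1)[of n] by (intro integral_deriv_interval D P') simp
  ultimately have "(\<lambda>n. P (R n) - P (- R n)) \<longlonglongrightarrow> (LINT x|lebesgue. P' x)" by simp
  moreover have "(\<lambda>n. P (R n) - P (- R n)) \<longlonglongrightarrow> 0 - 0" by (intro tendsto_diff R1 R2)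
  ultimately show "(LINT x|lebesgue. P' x) = 0" using LIMSEQ_unique by fastforce
  show "\<bar>P x\<bar> \<le> (LINT x|lebesgue. \<bar>P' x\<bar>)"
  proof (rule LIMSEQ_le)
    show "(\<lambda>n. \<bar>P (R n) - P x\<bar>) \<longlonglongrightarrow> \<bar>P x\<bar>"
      using tendsto_rabs[OF tendsto_diff[OF R1 tendsto_const[of "P x"]]] by simp
    have "\<bar>P (R n) - P x\<bar> \<le> (LINT x|lebesgue. \<bar>P' x\<bar>)" if "n \<ge> nat \<lceil>x\<rceil>" for n
    proof -
      have "x \<le> R n" using R(1)[of n] that by linarith
      then have "P (R n) - P x = (LINT y|lebesgue. indicator {x..R n} y * P' y)"
        by (intro integral_deriv_interval[symmetric] D P')
      moreover have "norm (LINT y|lebesgue. indicator {x..R n} y * P' y) \<le> (LINT x|lebesgue. \<bar>P' x\<bar>)"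
        using integrable_mult_indicator[OF _ P', of "{x..R n}"] P'
        by (intro Bochner_Integration.integral_norm_bound_integral) (auto simp: indicator_def)
      ultimately show ?thesis by simp
    qed
    then show "\<exists>N. \<forall>n\<ge>N. \<bar>P (R n) - P x\<bar> \<le> (LINT x|lebesgue. \<bar>P' x\<bar>)" by blast
  qed (rule tendsto_const)
qed

text \<open>
  The one-dimensional Agmon inequality, from \<open>(w\<^sup>2)' = 2 w w'\<close>. The constant 2 could be
  lowered to 1 by integrating from both ends, but 2 is the one that produces the factor
  \<open>(2/p)^(1/(2p-1))\<close> in the decay rate.
\<close>

lemma H1_pair_square_le:
  assumes "H1_pair w w'"
  shows "(w x)\<^sup>2 \<le> 2 * (norm (abs_L2 w) * norm (abs_L2 w'))"
proof -
  have w: "square_integrable w" "square_integrable w'" and D: "\<And>x. (w has_real_derivative w' x) (at x)"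
    using assms by (auto simp: H1_pair_def)
  have "\<bar>(w x)\<^sup>2\<bar> \<le> (LINT x|lebesgue. \<bar>2 * (w x * w' x)\<bar>)"
  proof (rule abs_le_integral_deriv[where P = "\<lambda>x. (w x)\<^sup>2"])
    show "((\<lambda>x. (w x)\<^sup>2) has_real_derivative 2 * (w x * w' x)) (at x)" for x
      by (auto intro!: derivative_eq_intros D)
    show "integrable lebesgue (\<lambda>x. 2 * (w x * w' x))" using square_integrable_mult[OF w] by simp
  qed (use w in \<open>simp add: square_integrable_def\<close>)
  also have "\<dots> = 2 * (LINT x|lebesgue. \<bar>w x * w' x\<bar>)" by (simp add: abs_mult)
  also have "\<dots> \<le> 2 * (norm (abs_L2 w) * norm (abs_L2 w'))"
    using integral_mult_le_norms[OF w] by simp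
  finally show ?thesis by simp
qed

lemma H1_pair_integration_by_parts:
  assumes "H1_pair w w'" "H1_pair z z'"
  shows "inner (abs_L2 w') (abs_L2 z) = - inner (abs_L2 w) (abs_L2 z')"
proof -
  have sq: "square_integrable w" "square_integrable w'" "square_integrable z" "square_integrable z'"
    and D: "(w has_real_derivative w' x) (at x)" "(z has_real_derivative z' x) (at x)" for x
    using assms by (auto simp: H1_pair_def)
  have "(LINT x|lebesgue. w' x * z x + w x * z' x) = 0"
  proof (rule integral_deriv_eq_0[where P = "\<lambda>x. w x * z x"])
    show "((\<lambda>x. w x * z x) has_real_derivative w' x * z x + w x * z' x) (at x)" for x
      by (rule DERIV_cong[OF DERIV_mult[OF D]]) simp
  qed (use sq square_integrable_mult in simp_all)
  then show ?thesis
    using sq by (simp add: inner_abs_L2 square_integrable_mult)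
qed

text \<open>
  Integration by parts holds for the approximating pairs and is continuous in the graph norm.
\<close>

lemma weak_deriv_skew:
  assumes v: "has_weak_deriv 1 v v1" and z: "has_weak_deriv 1 z z1"
  shows "inner v1 z = - inner v z1"
proof -
  obtain w w' where w: "\<And>n. H1_pair (w n) (w' n)"
    "(\<lambda>n. abs_L2 (w n)) \<longlonglongrightarrow> v" "(\<lambda>n. abs_L2 (w' n)) \<longlonglongrightarrow> v1"
    using H1_dense[OF v] by metis
  obtain y y' where y: "\<And>n. H1_pair (y n) (y' n)"
    "(\<lambda>n. abs_L2 (y n)) \<longlonglongrightarrow> z" "(\<lambda>n. abs_L2 (y' n)) \<longlonglongrightarrow> z1"
    using H1_dense[OF z] by metis
  have "(\<lambda>n. inner (abs_L2 (w' n)) (abs_L2 (y n))) \<longlonglongrightarrow> inner v1 z"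
    by (intro tendsto_inner w y)
  moreover have "(\<lambda>n. - inner (abs_L2 (w n)) (abs_L2 (y' n))) \<longlonglongrightarrow> - inner v z1"
    by (intro tendsto_minus tendsto_inner w y)
  ultimately show ?thesis
    using LIMSEQ_unique by (simp add: H1_pair_integration_by_parts[OF w(1) y(1)])
qed

lemma test_function_deriv:
  assumes "test_function \<phi>"
  shows "test_function (deriv \<phi>)"
  unfolding test_function_def
proof (intro conjI allI)
  have "(deriv ^^ Suc n) \<phi> field_differentiable at x" for n x
    using assms unfolding test_function_def by blast
  then show "(deriv ^^ n) (deriv \<phi>) field_differentiable at x" for n x
    by (simp only: funpow_Suc_right o_def)
  have "{x. deriv \<phi> x \<noteq> 0} \<subseteq> closure {x. \<phi> x \<noteq> 0}"
  proof (rule ccontr)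
    assume "\<not> ?thesis"
    then obtain x where x: "deriv \<phi> x \<noteq> 0" "x \<notin> closure {x. \<phi> x \<noteq> 0}" by blast
    have "((\<lambda>x. 0) has_real_derivative 0) (at x)" by simp
    then have "(\<phi> has_real_derivative 0) (at x)"
    proof (rule has_field_derivative_transform_within_open)
      show "open (- closure {x. \<phi> x \<noteq> 0})" by (intro open_Compl closed_closure)
      show "0 = \<phi> y" if "y \<in> - closure {x. \<phi> x \<noteq> 0}" for y
        using that closure_subset[of "{x. \<phi> x \<noteq> 0}"] by auto
    qed (use x in simp)
    then show False using x(1) DERIV_imp_deriv by blast
  qed
  then have "closure {x. deriv \<phi> x \<noteq> 0} \<subseteq> closure {x. \<phi> x \<noteq> 0}"
    by (rule closure_minimal) simp
  then show "compact (closure {x. deriv \<phi> x \<noteq> 0})"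
    using assms by (metis closed_closure compact_Int_closed inf.absorb2 test_function_def)
qed

text \<open>
  Weak derivatives of higher order are defined directly, without reference to those of lower order;
  this links them, by testing with \<open>deriv \<phi>\<close>.
\<close>

lemma weak_deriv_Suc:
  assumes "has_weak_deriv k v w" "has_weak_deriv (Suc k) v w'"
  shows "has_weak_deriv 1 w w'"
  unfolding has_weak_deriv_def
proof (intro allI impI)
  fix \<phi> assume \<phi>: "test_function \<phi>"
  have "(-1) ^ k * (LINT x|lebesgue. rep_L2 w x * deriv \<phi> x)
      = (LINT x|lebesgue. rep_L2 v x * (deriv ^^ k) (deriv \<phi>) x)"
    using assms(1) test_function_deriv[OF \<phi>] by (simp add: has_weak_deriv_def)
  also have "\<dots> = (LINT x|lebesgue. rep_L2 v x * (deriv ^^ Suc k) \<phi> x)"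
    by (simp only: funpow_Suc_right o_def)
  also have "\<dots> = (-1) ^ Suc k * (LINT x|lebesgue. rep_L2 w' x * \<phi> x)"
    using assms(2) \<phi> unfolding has_weak_deriv_def by blast
  finally show "(LINT x|lebesgue. rep_L2 w x * (deriv ^^ 1) \<phi> x)
      = (-1) ^ 1 * (LINT x|lebesgue. rep_L2 w' x * \<phi> x)"
    by (cases "even k") auto
qed

section \<open>Multiplication operators\<close>

lemma in_Linf_const_mult: "in_Linf m \<Longrightarrow> in_Linf (\<lambda>x. c * m x)"
proof -
  assume "in_Linf m"
  then obtain C where C: "AE x in lebesgue. \<bar>m x\<bar> \<le> C" and [measurable]: "m \<in> borel_measurable lebesgue"
    by (auto simp: in_Linf_def)
  have "AE x in lebesgue. \<bar>c * m x\<bar> \<le> \<bar>c\<bar> * C"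
    using C by eventually_elim (simp add: abs_mult mult_left_mono)
  then show ?thesis by (auto simp: in_Linf_def)
qed

lemma in_Linf_abs: "in_Linf m \<Longrightarrow> in_Linf (\<lambda>x. \<bar>m x\<bar>)"
  by (auto simp: in_Linf_def)

lemma Linf_mult_bounded:
  assumes "in_Linf m"
  obtains C where "C \<ge> 0"
    "\<And>f. square_integrable f \<Longrightarrow> square_integrable (\<lambda>x. m x * f x)"
    "\<And>f. square_integrable f \<Longrightarrow> norm (abs_L2 (\<lambda>x. m x * f x)) \<le> C * norm (abs_L2 f)"
proof -
  obtain C where C: "AE x in lebesgue. \<bar>m x\<bar> \<le> C" and m [measurable]: "m \<in> borel_measurable lebesgue"
    using assms by (auto simp: in_Linf_def)
  have le: "AE x in lebesgue. (m x * f x)\<^sup>2 \<le> \<bar>C\<bar>\<^sup>2 * (f x)\<^sup>2" for f :: "real \<Rightarrow> real"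
    using C
  proof eventually_elim
    case (elim x)
    then have "\<bar>m x\<bar>\<^sup>2 \<le> \<bar>C\<bar>\<^sup>2" by (intro power_mono) auto
    then show ?case by (simp add: power_mult_distrib mult_right_mono)
  qed
  have sq: "square_integrable (\<lambda>x. m x * f x)" if f: "square_integrable f" for f
    unfolding square_integrable_def
  proof
    have [measurable]: "f \<in> borel_measurable lebesgue" using f by (simp add: square_integrable_def)
    show "(\<lambda>x. m x * f x) \<in> borel_measurable lebesgue" by measurable
    show "integrable lebesgue (\<lambda>x. (m x * f x)\<^sup>2)"
    proof (rule Bochner_Integration.integrable_bound)
      show "integrable lebesgue (\<lambda>x. \<bar>C\<bar>\<^sup>2 * (f x)\<^sup>2)" using f by (simp add: square_integrable_def)
    qed (use le[of f] in auto)
  qed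
  have "norm (abs_L2 (\<lambda>x. m x * f x)) \<le> \<bar>C\<bar> * norm (abs_L2 f)" if f: "square_integrable f" for f
  proof (rule power2_le_imp_le)
    have "(norm (abs_L2 (\<lambda>x. m x * f x)))\<^sup>2 \<le> (LINT x|lebesgue. \<bar>C\<bar>\<^sup>2 * (f x)\<^sup>2)"
      unfolding norm_abs_L2[OF sq[OF f]]
      using f sq[OF f] le[of f] by (intro integral_mono_AE) (auto simp: square_integrable_def)
    also have "\<dots> = (\<bar>C\<bar> * norm (abs_L2 f))\<^sup>2"
      by (simp add: norm_abs_L2[OF f] power_mult_distrib)
    finally show "(norm (abs_L2 (\<lambda>x. m x * f x)))\<^sup>2 \<le> (\<bar>C\<bar> * norm (abs_L2 f))\<^sup>2" .
  qed simp
  with sq show thesis by (intro that[of "\<bar>C\<bar>"]) auto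
qed

lemma L2_mult_abs_L2:
  assumes "in_Linf m" and f: "square_integrable f"
  shows "L2_mult m (abs_L2 f) = abs_L2 (\<lambda>x. m x * f x)"
proof -
  have sq: "square_integrable (\<lambda>x. m x * g x)" if "square_integrable g" for g
    using Linf_mult_bounded[OF assms(1)] that by metis
  have "AE x in lebesgue. m x * rep_L2 (abs_L2 f) x = m x * f x"
    using rep_abs_L2[OF f] by (rule eventually_mono) simp
  then have "L2_eq (\<lambda>x. m x * rep_L2 (abs_L2 f) x) (\<lambda>x. m x * f x)"
    by (simp add: L2_eq_def sq f square_integrable_rep_L2)
  then show ?thesis
    unfolding L2_mult_def using Quotient3_rel_abs[OF Quotient3_L2] by blast
qed

lemma inner_L2_mult:
  assumes "in_Linf m"
  shows "inner (L2_mult m f) g = (LINT x|lebesgue. m x * rep_L2 f x * rep_L2 g x)"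
proof -
  have "square_integrable (\<lambda>x. m x * rep_L2 f x)"
    using Linf_mult_bounded[OF assms] square_integrable_rep_L2 by metis
  from inner_abs_L2[OF this square_integrable_rep_L2[of g]]
  show ?thesis by (simp add: L2_mult_def abs_rep_L2)
qed

lemma bounded_linear_L2_mult:
  assumes "in_Linf m"
  shows "bounded_linear (L2_mult m)"
proof -
  obtain C where C: "\<And>f. square_integrable f \<Longrightarrow> square_integrable (\<lambda>x. m x * f x)"
    "\<And>f. square_integrable f \<Longrightarrow> norm (abs_L2 (\<lambda>x. m x * f x)) \<le> C * norm (abs_L2 f)"
    using Linf_mult_bounded[OF assms] by metis
  note sq = square_integrable_rep_L2
  show ?thesis
  proof (rule bounded_linear_intro)
    fix f g :: L2 and r :: real
    have "f + g = abs_L2 (\<lambda>x. rep_L2 f x + rep_L2 g x)"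
      using sq[of f] sq[of g] plus_L2.abs_eq[of "rep_L2 f" "rep_L2 g"]
      by (simp add: L2_eq_def abs_rep_L2)
    then have "L2_mult m (f + g) = abs_L2 (\<lambda>x. m x * rep_L2 f x + m x * rep_L2 g x)"
      using sq by (simp add: L2_mult_abs_L2[OF assms] square_integrable_add distrib_left)
    also have "\<dots> = L2_mult m f + L2_mult m g"
      using C(1)[OF sq] by (simp add: L2_mult_def plus_L2.abs_eq L2_eq_def)
    finally show "L2_mult m (f + g) = L2_mult m f + L2_mult m g" .
    have "r *\<^sub>R f = abs_L2 (\<lambda>x. r * rep_L2 f x)"
      using sq[of f] scaleR_L2.abs_eq[of "rep_L2 f" r] by (simp add: L2_eq_def abs_rep_L2)
    then have "L2_mult m (r *\<^sub>R f) = abs_L2 (\<lambda>x. r * (m x * rep_L2 f x))"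
      using sq by (simp add: L2_mult_abs_L2[OF assms] square_integrable_scale mult.left_commute)
    also have "\<dots> = r *\<^sub>R L2_mult m f"
      using C(1)[OF sq] by (simp add: L2_mult_def scaleR_L2.abs_eq L2_eq_def)
    finally show "L2_mult m (r *\<^sub>R f) = r *\<^sub>R L2_mult m f" .
    show "norm (L2_mult m f) \<le> norm f * C"
      using C(2)[OF sq, of f] by (simp add: L2_mult_def abs_rep_L2 mult.commute)
  qed
qed

section \<open>Dissipativity of the third-order operator\<close>

text \<open>
  Young's inequality against the constant 1. In the case \<open>p = 1\<close> the conjugate exponent is
  infinite, but the inequality is an equality.
\<close>

lemma linear_le_powr:
  fixes s p :: real
  assumes "1 \<le> p" "0 \<le> s"
  shows "s \<le> s powr p / p + (p - 1) / p"
proof (cases "p = 1")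
  case True
  then show ?thesis using assms by simp
next
  case False
  then have "p > 1" using assms by simp
  then have "s * 1 \<le> s powr p / p + 1 powr (p / (p - 1)) / (p / (p - 1))"
    using assms by (intro Youngs_inequality) (auto simp: field_simps)
  then show ?thesis by simp
qed

text \<open>
  Instead of Hoelder's inequality, split \<open>\<beta>\<close> pointwise: for every \<open>\<theta> > 0\<close>,

    \<open>|\<beta>| \<le> \<mu> |\<beta>|^p + \<nu>\<close>  with  \<open>\<mu> = \<theta>^(1-p)/p\<close>  and  \<open>\<nu> = \<theta> (p-1)/p\<close>.

  With \<open>I = \<integral> |\<beta>|^p\<close> the first part costs
  \<open>2 \<mu> I \<parallel>w\<parallel> \<parallel>w'\<parallel> \<le> \<parallel>w'\<parallel>\<^sup>2 + (\<mu> I)\<^sup>2 \<parallel>w\<parallel>\<^sup>2\<close> by \<open>H1_pair_square_le\<close>, so the total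
  price is \<open>(\<mu> I)\<^sup>2 + \<nu>\<close>. The \<open>\<theta>\<close> of the statement minimises it: it is the solution of
  \<open>\<theta>^(2p-1) = (2/p) I\<^sup>2\<close>, for which \<open>(\<mu> I)\<^sup>2 = \<theta>/(2p)\<close>.
\<close>

lemma potential_bound_H1_pair:
  fixes p \<alpha> :: real
  assumes w: "H1_pair w w'" and p: "1 \<le> p" and \<beta>: "in_Lp p \<beta>" and m: "in_Linf m"
    and le: "AE x in lebesgue. m x \<le> \<alpha> + \<beta> x"
  defines "\<theta> \<equiv> (2 / p) powr (1 / (2 * p - 1)) * Lp_norm p \<beta> powr (2 * p / (2 * p - 1))"
  shows "(LINT x|lebesgue. m x * (w x)\<^sup>2)
    \<le> (norm (abs_L2 w'))\<^sup>2 + (\<alpha> + (2 * p - 1) / (2 * p) * \<theta>) * (norm (abs_L2 w))\<^sup>2"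
proof -
  have sq: "square_integrable w" "square_integrable w'" using w by (auto simp: H1_pair_def)
  have int_w: "integrable lebesgue (\<lambda>x. (w x)\<^sup>2)" using sq by (simp add: square_integrable_def)
  have norm_w: "(LINT x|lebesgue. (w x)\<^sup>2) = (norm (abs_L2 w))\<^sup>2" by (simp add: norm_abs_L2 sq)
  define I where "I = (LINT x|lebesgue. \<bar>\<beta> x\<bar> powr p)"
  have int_I: "integrable lebesgue (\<lambda>x. \<bar>\<beta> x\<bar> powr p)" and [measurable]: "\<beta> \<in> borel_measurable lebesgue"
    using \<beta> by (auto simp: in_Lp_def)
  have "I \<ge> 0" unfolding I_def by (intro integral_nonneg_AE) simp
  have B: "Lp_norm p \<beta> = I powr (1 / p)" by (simp add: Lp_norm_def I_def)
  have "square_integrable (\<lambda>x. m x * w x)" using Linf_mult_bounded[OF m] sq by metis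
  from square_integrable_mult[OF this sq(1)]
  have int_mw: "integrable lebesgue (\<lambda>x. m x * (w x)\<^sup>2)" by (simp add: power2_eq_square mult.assoc)
  show ?thesis
  proof (cases "I = 0")
    case True
    then have "AE x in lebesgue. \<bar>\<beta> x\<bar> powr p = 0"
      using integral_nonneg_eq_0_iff_AE[OF int_I] by (simp add: I_def)
    then have "AE x in lebesgue. m x * (w x)\<^sup>2 \<le> \<alpha> * (w x)\<^sup>2"
      using le by eventually_elim (auto intro: mult_right_mono)
    then have "(LINT x|lebesgue. m x * (w x)\<^sup>2) \<le> (LINT x|lebesgue. \<alpha> * (w x)\<^sup>2)"
      using int_mw int_w by (intro integral_mono_AE) auto
    also have "\<dots> = \<alpha> * (norm (abs_L2 w))\<^sup>2" by (simp add: norm_w)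
    also have "\<theta> = 0" using True p by (simp add: \<theta>_def B)
    then have "\<alpha> * (norm (abs_L2 w))\<^sup>2
        \<le> (norm (abs_L2 w'))\<^sup>2 + (\<alpha> + (2 * p - 1) / (2 * p) * \<theta>) * (norm (abs_L2 w))\<^sup>2" by simp
    finally show ?thesis .
  next
    case False
    then have "I > 0" using \<open>I \<ge> 0\<close> by simp
    then have \<theta>: "\<theta> > 0" using p by (simp add: \<theta>_def B)
    \<comment> \<open>The optimal slope and intercept of the pointwise bound for the chosen \<open>\<theta>\<close>.\<close>
    define \<mu> where "\<mu> = \<theta> powr (1 - p) / p"
    define \<nu> where "\<nu> = \<theta> * (p - 1) / p"
    have \<mu>: "\<mu> > 0" using \<theta> p by (simp add: \<mu>_def)
    have young: "b \<le> \<mu> * b powr p + \<nu>" if "b \<ge> 0" for b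
    proof -
      have "b / \<theta> \<le> (b / \<theta>) powr p / p + (p - 1) / p"
        using that \<theta> p by (intro linear_le_powr) auto
      then have "\<theta> * (b / \<theta>) \<le> \<theta> * ((b / \<theta>) powr p / p + (p - 1) / p)"
        using \<theta> by (intro mult_left_mono) auto
      also have "\<dots> = (\<theta> * (b / \<theta>) powr p) / p + \<nu>" by (simp add: \<nu>_def field_simps)
      also have "\<theta> * (b / \<theta>) powr p = \<theta> powr (1 - p) * b powr p"
        using that \<theta> by (simp add: powr_divide powr_diff)
      finally show ?thesis using \<theta> by (simp add: \<mu>_def)
    qed
    define n n' where "n = norm (abs_L2 w)" and "n' = norm (abs_L2 w')"
    have "AE x in lebesgue. m x * (w x)\<^sup>2 \<le> (\<alpha> + \<nu>) * (w x)\<^sup>2 + \<mu> * (2 * (n * n')) * \<bar>\<beta> x\<bar> powr p"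
      using le
    proof eventually_elim
      case (elim x)
      have "m x \<le> \<alpha> + \<nu> + \<mu> * \<bar>\<beta> x\<bar> powr p" using elim young[of "\<bar>\<beta> x\<bar>"] by simp
      then have "m x * (w x)\<^sup>2 \<le> (\<alpha> + \<nu> + \<mu> * \<bar>\<beta> x\<bar> powr p) * (w x)\<^sup>2" by (rule mult_right_mono) simp
      moreover have "\<mu> * \<bar>\<beta> x\<bar> powr p * (w x)\<^sup>2 \<le> \<mu> * \<bar>\<beta> x\<bar> powr p * (2 * (n * n'))"
        using H1_pair_square_le[OF w, of x] \<mu> by (intro mult_left_mono) (auto simp: n_def n'_def)
      ultimately show ?case by (simp add: algebra_simps)
    qed
    then have "(LINT x|lebesgue. m x * (w x)\<^sup>2)
        \<le> (LINT x|lebesgue. (\<alpha> + \<nu>) * (w x)\<^sup>2 + \<mu> * (2 * (n * n')) * \<bar>\<beta> x\<bar> powr p)"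
      using int_mw int_w int_I by (intro integral_mono_AE) auto
    also have "\<dots> = (\<alpha> + \<nu>) * n\<^sup>2 + 2 * n' * (\<mu> * I * n)"
      using int_w int_I by (simp add: norm_w n_def I_def)
    also have "2 * n' * (\<mu> * I * n) \<le> n'\<^sup>2 + (\<mu> * I * n)\<^sup>2"
      by (rule sum_squares_bound)
    finally have "(LINT x|lebesgue. m x * (w x)\<^sup>2) \<le> n'\<^sup>2 + (\<alpha> + (\<nu> + (\<mu> * I)\<^sup>2)) * n\<^sup>2"
      by (simp add: algebra_simps)
    moreover have "\<nu> + (\<mu> * I)\<^sup>2 = (2 * p - 1) / (2 * p) * \<theta>"
    proof -
      have "\<theta> powr (2 * p - 1) = (2 / p) * I\<^sup>2"
      proof -
        have e1: "1 / (2 * p - 1) * (2 * p - 1) = 1" and e2: "1 / p * (2 * p / (2 * p - 1)) * (2 * p - 1) = 2"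
          using p by (auto simp: field_simps)
        have "\<theta> powr (2 * p - 1) = (2 / p) powr (1 / (2 * p - 1) * (2 * p - 1))
            * I powr (1 / p * (2 * p / (2 * p - 1)) * (2 * p - 1))"
          using p \<open>I > 0\<close> unfolding \<theta>_def B by (simp only: powr_mult powr_powr)
        also have "\<dots> = (2 / p) * I\<^sup>2"
          unfolding e1 e2 using p \<open>I > 0\<close> by simp
        finally show ?thesis .
      qed
      moreover have "(\<theta> powr (1 - p))\<^sup>2 * \<theta> powr (2 * p - 1) = \<theta>"
      proof -
        have "(\<theta> powr (1 - p))\<^sup>2 * \<theta> powr (2 * p - 1) = \<theta> powr ((1 - p) + (1 - p) + (2 * p - 1))"
          unfolding power2_eq_square powr_add by simp
        also have "(1 - p) + (1 - p) + (2 * p - 1) = 1" by simp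
        finally show ?thesis using \<theta> by simp
      qed
      ultimately have "(\<theta> powr (1 - p))\<^sup>2 * ((2 / p) * I\<^sup>2) = \<theta>" by simp
      then have "(\<theta> powr (1 - p))\<^sup>2 * I\<^sup>2 = \<theta> * p / 2"
        using p by (simp add: field_simps)
      then have "(\<mu> * I)\<^sup>2 = \<theta> / (2 * p)"
        using p by (simp add: \<mu>_def power_mult_distrib power_divide power2_eq_square field_simps)
      then show ?thesis using p by (simp add: \<nu>_def field_simps)
    qed
    ultimately show ?thesis by (simp add: n_def n'_def)
  qed
qed

text \<open>
  Both sides are continuous in \<open>v\<close> and \<open>v1\<close> with respect to the \<open>L\<^sup>2\<close> norm since \<open>m\<close> is
  bounded; this is why the estimate is stated with \<open>m\<close> and not with \<open>\<beta>\<close> on the left.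
\<close>

lemma potential_bound:
  fixes p \<alpha> :: real
  assumes v: "has_weak_deriv 1 v v1" and p: "1 \<le> p" and \<beta>: "in_Lp p \<beta>" and m: "in_Linf m"
    and le: "AE x in lebesgue. m x \<le> \<alpha> + \<beta> x"
  shows "inner (L2_mult m v) v \<le> (norm v1)\<^sup>2 + (\<alpha> + (2 * p - 1) / (2 * p)
    * ((2 / p) powr (1 / (2 * p - 1)) * Lp_norm p \<beta> powr (2 * p / (2 * p - 1)))) * (norm v)\<^sup>2"
    (is "_ \<le> _ + ?c * _")
proof -
  obtain w w' where w: "\<And>n. H1_pair (w n) (w' n)"
    "(\<lambda>n. abs_L2 (w n)) \<longlonglongrightarrow> v" "(\<lambda>n. abs_L2 (w' n)) \<longlonglongrightarrow> v1"
    using H1_dense[OF v] by metis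
  show ?thesis
  proof (rule LIMSEQ_le)
    show "(\<lambda>n. inner (L2_mult m (abs_L2 (w n))) (abs_L2 (w n))) \<longlonglongrightarrow> inner (L2_mult m v) v"
      by (intro tendsto_inner bounded_linear.tendsto[OF bounded_linear_L2_mult[OF m]] w)
    show "(\<lambda>n. (norm (abs_L2 (w' n)))\<^sup>2 + ?c * (norm (abs_L2 (w n)))\<^sup>2) \<longlonglongrightarrow> (norm v1)\<^sup>2 + ?c * (norm v)\<^sup>2"
      by (intro tendsto_intros w)
    have "inner (L2_mult m (abs_L2 (w n))) (abs_L2 (w n)) = (LINT x|lebesgue. m x * (w n x)\<^sup>2)" for n
    proof -
      have sq: "square_integrable (w n)" using w(1) by (simp add: H1_pair_def)
      then have "square_integrable (\<lambda>x. m x * w n x)" using Linf_mult_bounded[OF m] by metis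
      then show ?thesis
        using sq by (simp add: L2_mult_abs_L2[OF m] inner_abs_L2 power2_eq_square mult.assoc)
    qed
    then show "\<exists>N. \<forall>n\<ge>N. inner (L2_mult m (abs_L2 (w n))) (abs_L2 (w n))
        \<le> (norm (abs_L2 (w' n)))\<^sup>2 + ?c * (norm (abs_L2 (w n)))\<^sup>2"
      using potential_bound_H1_pair[OF w(1) p \<beta> m le] by simp
  qed
qed

text \<open>
  Skewness gives \<open>\<langle>v3, v\<rangle> = - \<langle>v2, v1\<rangle> = 0\<close> and
  \<open>\<langle>v2, v\<rangle> = - \<parallel>v1\<parallel>\<^sup>2\<close>.
\<close>

lemma A_op_dissipative:
  assumes vg: "(v, g) \<in> A_op lam0" and "in_Linf lam0" and lam0: "AE x in lebesgue. lam0 x \<ge> \<alpha>0"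
  obtains v1 where "has_weak_deriv 1 v v1" "inner g v \<le> - (norm v1)\<^sup>2 - \<alpha>0 * (norm v)\<^sup>2"
proof -
  obtain v2 v3 where H: "v \<in> sobolev_H 3" and v2: "has_weak_deriv 2 v v2" and v3: "has_weak_deriv 3 v v3"
    and g: "g = - v3 + v2 - L2_mult lam0 v"
    using vg by (auto simp: A_op_def)
  obtain v1 where v1: "has_weak_deriv 1 v v1" using H by (force simp: sobolev_H_def)
  have v12: "has_weak_deriv 1 v1 v2" and v23: "has_weak_deriv 1 v2 v3"
    using weak_deriv_Suc[OF v1, of v2] weak_deriv_Suc[OF v2, of v3] v2 v3
    by (simp_all add: numeral_eq_Suc)
  have "inner v2 v1 = 0" using weak_deriv_skew[OF v12 v12] by (simp add: inner_commute)
  then have i3: "inner v3 v = 0" using weak_deriv_skew[OF v23 v1] by simp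
  have i2: "inner v2 v = - (norm v1)\<^sup>2"
    using weak_deriv_skew[OF v12 v1] by (simp add: power2_norm_eq_inner)
  have "\<alpha>0 * (norm v)\<^sup>2 \<le> inner (L2_mult lam0 v) v"
  proof -
    have sq: "square_integrable (rep_L2 v)" by (rule square_integrable_rep_L2)
    then have "square_integrable (\<lambda>x. lam0 x * rep_L2 v x)"
      using Linf_mult_bounded[OF \<open>in_Linf lam0\<close>] by metis
    from square_integrable_mult[OF this sq]
    have "(LINT x|lebesgue. \<alpha>0 * (rep_L2 v x)\<^sup>2) \<le> (LINT x|lebesgue. lam0 x * rep_L2 v x * rep_L2 v x)"
      using sq lam0 unfolding square_integrable_def
      by (intro integral_mono_AE)
         (auto simp: power2_eq_square mult.assoc intro!: mult_right_mono elim!: eventually_mono)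
    then show ?thesis by (simp add: inner_L2_mult[OF \<open>in_Linf lam0\<close>] norm_L2_eq)
  qed
  then have "inner g v \<le> - (norm v1)\<^sup>2 - \<alpha>0 * (norm v)\<^sup>2"
    using i2 i3 by (simp add: g inner_diff_left inner_add_left)
  then show thesis using v1 by (intro that)
qed

section \<open>Decay of the energy\<close>

text \<open>
  Young's inequality with weight \<open>c\<close>; below, \<open>c = e^\<tau>\<close> matches the factor \<open>e^(-\<tau>)\<close> with
  which the memory term loses its oldest contribution.
\<close>

lemma delayed_term_le:
  assumes lam: "in_Linf lam" and "c > 0"
  shows "- inner (L2_mult lam w) v
    \<le> c / 2 * inner (L2_mult (\<lambda>x. \<bar>lam x\<bar>) v) v + inverse c / 2 * inner (L2_mult (\<lambda>x. \<bar>lam x\<bar>) w) w"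
proof -
  note sq = square_integrable_rep_L2
  have sql: "square_integrable (\<lambda>x. lam x * rep_L2 f x)"
    "square_integrable (\<lambda>x. \<bar>lam x\<bar> * rep_L2 f x)" for f
    using Linf_mult_bounded[OF lam] Linf_mult_bounded[OF in_Linf_abs[OF lam]] sq by metis+
  have int: "integrable lebesgue (\<lambda>x. lam x * rep_L2 f x * rep_L2 g x)"
    "integrable lebesgue (\<lambda>x. \<bar>lam x\<bar> * rep_L2 f x * rep_L2 g x)" for f g
    by (rule square_integrable_mult[OF sql(1) sq], rule square_integrable_mult[OF sql(2) sq])
  have "(LINT x|lebesgue. - (lam x * rep_L2 w x * rep_L2 v x))
      \<le> (LINT x|lebesgue. c / 2 * (\<bar>lam x\<bar> * rep_L2 v x * rep_L2 v x)
          + inverse c / 2 * (\<bar>lam x\<bar> * rep_L2 w x * rep_L2 w x))"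
  proof (rule integral_mono)
    fix x
    let ?v = "rep_L2 v x" and ?w = "rep_L2 w x"
    have "- (lam x * ?w * ?v) \<le> \<bar>lam x\<bar> * (\<bar>?w\<bar> * \<bar>?v\<bar>)"
      by (metis abs_ge_minus_self abs_mult mult.assoc)
    moreover have "\<bar>?w\<bar> * \<bar>?v\<bar> \<le> c / 2 * ?v\<^sup>2 + inverse c / 2 * ?w\<^sup>2"
    proof -
      have "0 \<le> (c * \<bar>?v\<bar> - \<bar>?w\<bar>)\<^sup>2" by simp
      then have "2 * c * (\<bar>?w\<bar> * \<bar>?v\<bar>) \<le> c\<^sup>2 * ?v\<^sup>2 + ?w\<^sup>2"
        by (simp add: power2_diff power_mult_distrib algebra_simps)
      then show ?thesis using \<open>c > 0\<close> by (simp add: field_simps power2_eq_square)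
    qed
    then have "\<bar>lam x\<bar> * (\<bar>?w\<bar> * \<bar>?v\<bar>) \<le> \<bar>lam x\<bar> * (c / 2 * ?v\<^sup>2 + inverse c / 2 * ?w\<^sup>2)"
      by (rule mult_left_mono) simp
    ultimately show "- (lam x * ?w * ?v)
        \<le> c / 2 * (\<bar>lam x\<bar> * ?v * ?v) + inverse c / 2 * (\<bar>lam x\<bar> * ?w * ?w)"
      by (simp add: power2_eq_square algebra_simps)
  qed (use int in auto)
  then show ?thesis
    using int by (simp add: inner_L2_mult lam in_Linf_abs)
qed

lemma energy_eq:
  assumes lam: "in_Linf lam"
  shows "energy lam \<tau> u t = (norm (u t))\<^sup>2 / 2
    + 1/2 * integral {t - \<tau>..t} (\<lambda>s. exp (- (t - s)) * inner (L2_mult (\<lambda>x. \<bar>lam x\<bar>) (u s)) (u s))"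
  unfolding energy_def inner_L2_mult[OF in_Linf_abs[OF lam]] norm_L2_eq
  by (simp add: power2_eq_square mult.assoc)

text \<open>
  The form of \<open>Q\<close> contains the weight \<open>(e^\<tau> + 1)/2 |\<lambda>|\<close> because the energy balance
  spends \<open>e^\<tau>/2 \<integral> |\<lambda>| u\<^sup>2\<close> on the delayed term and \<open>1/2 \<integral> |\<lambda>| u\<^sup>2\<close> on the growth
  of the memory term; the surplus \<open>\<delta>\<close> is what drives the decay.
\<close>

locale damped_delay_problem = dissipative_semigroup S Q
  for S :: "real \<Rightarrow> L2 \<Rightarrow> L2" and Q :: "L2 \<Rightarrow> L2" +
  fixes lam :: "real \<Rightarrow> real" and \<tau> \<delta> \<gamma> :: real
  assumes lam: "in_Linf lam" and \<tau>: "\<tau> > 0"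
    and Q_eq: "\<And>v. inner (Q v) v = (exp \<tau> + 1) / 2 * inner (L2_mult (\<lambda>x. \<bar>lam x\<bar>) v) v + \<delta> * (norm v)\<^sup>2"
    and \<gamma>: "\<gamma> \<le> 2 * \<delta>" "\<gamma> \<le> 1"
begin

definition weighted :: "L2 \<Rightarrow> real" where
  "weighted v = inner (L2_mult (\<lambda>x. \<bar>lam x\<bar>) v) v"

lemma weighted_nonneg: "0 \<le> weighted v"
  unfolding weighted_def inner_L2_mult[OF in_Linf_abs[OF lam]]
  by (intro integral_nonneg_AE) (simp add: mult.assoc)

lemma continuous_weighted: "continuous_on A u \<Longrightarrow> continuous_on A (\<lambda>t. weighted (u t))"
  unfolding weighted_def
  by (intro continuous_intros bounded_linear.continuous_on[OF bounded_linear_L2_mult[OF in_Linf_abs[OF lam]]])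

text \<open>
  Writing the memory term as \<open>e^(-t) (\<Phi> t - \<Phi> (t - \<tau>))\<close> with a primitive \<open>\<Phi>\<close> of
  \<open>e^t \<integral> |\<lambda>| u(t)\<^sup>2\<close> makes it right differentiable. Together with \<open>mild_norm_majorant\<close> it yields a majorant of
  \<open>e^(\<gamma> t) E(t)\<close> with nonpositive slope at every time.
\<close>

theorem energy_decay:
  assumes mild: "mild_solution S lam \<tau> u0 u" and "T \<ge> 0"
  shows "energy lam \<tau> u T \<le> energy lam \<tau> u 0 * exp (- \<gamma> * T)"
proof -
  have u_cont: "continuous_on {-\<tau>..} u" using mild by (simp add: mild_solution_def)
  define f where "f s = - L2_mult lam (u (s - \<tau>))" for s
  have f_cont: "continuous_on {0..} f"
  proof -
    have "continuous_on {0..} (\<lambda>s. u (s - \<tau>))"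
      by (rule continuous_on_compose2[OF u_cont]) (auto intro!: continuous_intros)
    then show ?thesis unfolding f_def
      by (intro continuous_intros bounded_linear.continuous_on[OF bounded_linear_L2_mult[OF lam]])
  qed
  have duhamel: "u t = S t (u0 0) + integral {0..t} (\<lambda>s. S (t - s) (f s))" if "t \<ge> 0" for t
  proof -
    have "integral {0..t} (\<lambda>s. S (t - s) (f s))
        = integral {0..t} (\<lambda>s. - S (t - s) (L2_mult lam (u (s - \<tau>))))"
      by (intro integral_cong) (simp add: f_def linear_neg[OF bounded_linear.linear[OF linear_S]])
    then show ?thesis using mild that by (simp add: mild_solution_def)
  qed
  define g where "g s = weighted (u s)" for s
  have g_cont: "continuous_on {-\<tau>..} (\<lambda>s. exp s * g s)"
    unfolding g_def by (intro continuous_intros continuous_weighted u_cont)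
  define \<Phi> where "\<Phi> t = integral {-\<tau>..t} (\<lambda>s. exp s * g s)" for t
  define mem where "mem t = exp (- t) * (\<Phi> t - \<Phi> (t - \<tau>))" for t
  have \<Phi>_diff: "\<Phi> t - \<Phi> (t - \<tau>) = integral {t - \<tau>..t} (\<lambda>s. exp s * g s)" if "t \<ge> 0" for t
  proof -
    have "(\<lambda>s. exp s * g s) integrable_on {-\<tau>..t}"
      by (intro integrable_continuous_real continuous_on_subset[OF g_cont]) auto
    from Henstock_Kurzweil_Integration.integral_combine[OF _ _ this, of "t - \<tau>"] that \<tau>
    show ?thesis by (simp add: \<Phi>_def)
  qed
  have energy: "energy lam \<tau> u t = (norm (u t))\<^sup>2 / 2 + mem t / 2" if "t \<ge> 0" for t
  proof -
    have "exp (- t) * integral {t - \<tau>..t} (\<lambda>s. exp s * g s)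
        = integral {t - \<tau>..t} (\<lambda>s. exp (- (t - s)) * g s)"
      by (simp only: integral_mult_right[symmetric]) (simp add: exp_diff exp_minus field_simps)
    then show ?thesis
      using \<Phi>_diff[OF that] by (simp add: energy_eq[OF lam] mem_def g_def weighted_def)
  qed
  have mem_nonneg: "mem t \<ge> 0" if "t \<ge> 0" for t
  proof -
    have "integral {t - \<tau>..t} (\<lambda>s. exp s * g s) \<ge> 0"
      using that
      by (intro Henstock_Kurzweil_Integration.integral_nonneg integrable_continuous_real
            continuous_on_subset[OF g_cont]) (auto simp: g_def weighted_nonneg)
    then show ?thesis using \<Phi>_diff[OF that] by (simp add: mem_def)
  qed
  have \<Phi>_cont: "continuous_on {-\<tau>..T} \<Phi>"
    unfolding \<Phi>_def
    by (intro indefinite_integral_continuous_1 integrable_continuous_real continuous_on_subset[OF g_cont]) auto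
  have \<Phi>_deriv: "(\<Phi> has_real_derivative exp t * g t) (at t within {t..})" if "t \<ge> -\<tau>" for t
    unfolding \<Phi>_def has_real_derivative_iff_has_vector_derivative
    by (rule integral_has_right_derivative[OF g_cont that])
  have \<Phi>_shift_deriv: "((\<lambda>s. \<Phi> (s - \<tau>)) has_real_derivative exp (t - \<tau>) * g (t - \<tau>)) (at t within {t..})"
    if "t \<ge> 0" for t
    using \<Phi>_deriv[of "t - \<tau>"] that
    unfolding has_real_derivative_iff_has_vector_derivative has_vector_derivative_right_iff
    by (simp add: algebra_simps)
  let ?\<phi> = "\<lambda>t. exp (\<gamma> * t) * ((norm (u t))\<^sup>2 / 2 + mem t / 2)"
  have "?\<phi> T \<le> ?\<phi> 0"
  proof (rule decreasing_if_right_majorant[OF \<open>T \<ge> 0\<close>])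
    have "continuous_on {0..T} (\<lambda>t. \<Phi> (t - \<tau>))" "continuous_on {0..T} \<Phi>" "continuous_on {0..T} u"
      using \<tau> by (auto intro!: continuous_intros continuous_on_compose2[OF \<Phi>_cont]
          continuous_on_subset[OF \<Phi>_cont] continuous_on_subset[OF u_cont])
    then show "continuous_on {0..T} ?\<phi>"
      unfolding mem_def by (intro continuous_intros) auto
    fix t assume t: "0 \<le> t" "t < T"
    obtain \<psi> where \<psi>:
      "(\<psi> has_real_derivative inner (f t) (u t) - inner (Q (u t)) (u t)) (at t within {t..})"
      "\<psi> t = (norm (u t))\<^sup>2 / 2" "\<And>s. s \<ge> t \<Longrightarrow> (norm (u s))\<^sup>2 / 2 \<le> \<psi> s"
      using mild_norm_majorant[OF f_cont duhamel t(1)] by metis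
    define D where "D = inner (f t) (u t) - inner (Q (u t)) (u t)
        + (- mem t + g t - exp (- \<tau>) * g (t - \<tau>)) / 2"
    define E where "E = (norm (u t))\<^sup>2 / 2 + mem t / 2"
    have mem_deriv: "(mem has_real_derivative - mem t + g t - exp (- \<tau>) * g (t - \<tau>)) (at t within {t..})"
    proof -
      have "((\<lambda>s. exp (- s)) has_real_derivative - exp (- t)) (at t within {t..})"
        by (auto intro!: derivative_eq_intros)
      moreover have "((\<lambda>s. \<Phi> s - \<Phi> (s - \<tau>)) has_real_derivative exp t * g t - exp (t - \<tau>) * g (t - \<tau>)) (at t within {t..})"
        using t(1) \<tau> by (intro DERIV_diff \<Phi>_deriv \<Phi>_shift_deriv) auto
      ultimately have "(mem has_real_derivative - exp (- t) * (\<Phi> t - \<Phi> (t - \<tau>))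
          + (exp t * g t - exp (t - \<tau>) * g (t - \<tau>)) * exp (- t)) (at t within {t..})"
        unfolding mem_def[abs_def] by (rule DERIV_mult)
      moreover have "- exp (- t) * (\<Phi> t - \<Phi> (t - \<tau>))
            + (exp t * g t - exp (t - \<tau>) * g (t - \<tau>)) * exp (- t)
          = - mem t + (exp t * exp (- t)) * g t - (exp (t - \<tau>) * exp (- t)) * g (t - \<tau>)"
        by (simp add: mem_def algebra_simps)
      moreover have "exp t * exp (- t) = 1" "exp (t - \<tau>) * exp (- t) = exp (- \<tau>)"
        by (simp_all add: mult_exp_exp)
      ultimately show ?thesis by simp
    qed
    have deriv: "((\<lambda>s. exp (\<gamma> * s) * (\<psi> s + mem s / 2)) has_real_derivative exp (\<gamma> * t) * (\<gamma> * E + D)) (at t within {t..})"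
    proof -
      have "((\<lambda>s. exp (\<gamma> * s)) has_real_derivative exp (\<gamma> * t) * \<gamma>) (at t within {t..})"
        by (auto intro!: derivative_eq_intros)
      moreover have "((\<lambda>s. \<psi> s + mem s / 2) has_real_derivative D) (at t within {t..})"
        unfolding D_def by (intro DERIV_add \<psi>(1) DERIV_cdivide mem_deriv)
      ultimately show ?thesis
        by (rule DERIV_cong[OF DERIV_mult]) (simp add: E_def \<psi>(2) algebra_simps)
    qed
    have "inner (f t) (u t) \<le> exp \<tau> / 2 * g t + exp (- \<tau>) / 2 * g (t - \<tau>)"
      using delayed_term_le[OF lam, of "exp \<tau>" "u (t - \<tau>)" "u t"]
      by (simp add: f_def g_def weighted_def exp_minus)
    moreover have "inner (Q (u t)) (u t) = (exp \<tau> + 1) / 2 * g t + \<delta> * (norm (u t))\<^sup>2"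
      by (simp add: Q_eq g_def weighted_def)
    ultimately have "D \<le> - (\<delta> * (norm (u t))\<^sup>2) - mem t / 2"
      by (simp add: D_def field_simps)
    moreover have "\<gamma> * (norm (u t))\<^sup>2 \<le> 2 * \<delta> * (norm (u t))\<^sup>2" "\<gamma> * mem t \<le> 1 * mem t"
      using \<gamma> mem_nonneg[OF t(1)] by (intro mult_right_mono; simp)+
    ultimately have "\<gamma> * E + D \<le> 0" by (simp add: E_def algebra_simps)
    then have "exp (\<gamma> * t) * (\<gamma> * E + D) \<le> 0" by (simp add: mult_nonneg_nonpos)
    moreover have "\<forall>\<^sub>F s in at_right t. ?\<phi> s \<le> exp (\<gamma> * s) * (\<psi> s + mem s / 2)"
      using \<psi>(3) by (auto simp: eventually_at_filter intro!: always_eventually)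
    ultimately show "\<exists>\<psi> d. (\<psi> has_real_derivative d) (at t within {t..}) \<and> d \<le> 0 \<and>
        \<psi> t = ?\<phi> t \<and> (\<forall>\<^sub>F s in at_right t. ?\<phi> s \<le> \<psi> s)"
      using deriv \<psi>(2)
      by (intro exI[of _ "\<lambda>s. exp (\<gamma> * s) * (\<psi> s + mem s / 2)"] exI[of _ "exp (\<gamma> * t) * (\<gamma> * E + D)"]) simp
  qed
  then have "exp (\<gamma> * T) * energy lam \<tau> u T \<le> energy lam \<tau> u 0"
    using energy[of T] energy[of 0] \<open>T \<ge> 0\<close> by simp
  then have "exp (- \<gamma> * T) * (exp (\<gamma> * T) * energy lam \<tau> u T) \<le> exp (- \<gamma> * T) * energy lam \<tau> u 0"
    by (intro mult_left_mono) auto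
  then show ?thesis by (simp add: mult.assoc[symmetric] mult_exp_exp mult.commute)
qed

end

lemma energy_initial:
  assumes "in_Linf lam" "\<tau> > 0" and u: "\<And>t. t \<in> {-\<tau>..0} \<Longrightarrow> u t = u0 t"
  shows "energy lam \<tau> u 0 = 1/2 * (norm (u0 0))\<^sup>2
    + 1/2 * integral {-\<tau>..0} (\<lambda>s. exp s * (LINT x|lebesgue. \<bar>lam x\<bar> * (rep_L2 (u0 s) x)\<^sup>2))"
proof -
  have "integral {-\<tau>..0} (\<lambda>s. exp (- (0 - s)) * inner (L2_mult (\<lambda>x. \<bar>lam x\<bar>) (u s)) (u s))
      = integral {-\<tau>..0} (\<lambda>s. exp s * (LINT x|lebesgue. \<bar>lam x\<bar> * (rep_L2 (u0 s) x)\<^sup>2))"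
    using u by (intro integral_cong)
      (simp add: inner_L2_mult[OF in_Linf_abs[OF assms(1)]] power2_eq_square mult.assoc)
  then show ?thesis using u[of 0] \<open>\<tau> > 0\<close> by (simp add: energy_eq[OF assms(1)])
qed

lemma decay_rate_positive:
  fixes p \<alpha> \<alpha>0 B :: real
  assumes "1 \<le> p" "\<alpha> < \<alpha>0" "B \<ge> 0"
    and B: "B < ((\<alpha>0 - \<alpha>) / ((1 - 1 / (2 * p)) * (2 / p) powr (1 / (2 * p - 1)))) powr (1 - 1 / (2 * p))"
  shows "(2 * p - 1) / (2 * p) * (2 / p) powr (1 / (2 * p - 1)) * B powr (2 * p / (2 * p - 1)) < \<alpha>0 - \<alpha>"
proof -
  define c where "c = (1 - 1 / (2 * p)) * (2 / p) powr (1 / (2 * p - 1))"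
  have c: "c > 0" and c': "c = (2 * p - 1) / (2 * p) * (2 / p) powr (1 / (2 * p - 1))"
    using \<open>1 \<le> p\<close> by (auto simp: c_def field_simps)
  have "B powr (2 * p / (2 * p - 1)) < (((\<alpha>0 - \<alpha>) / c) powr (1 - 1 / (2 * p))) powr (2 * p / (2 * p - 1))"
    using B \<open>B \<ge> 0\<close> \<open>1 \<le> p\<close> by (intro powr_less_mono2) (auto simp: c_def)
  also have "\<dots> = ((\<alpha>0 - \<alpha>) / c) powr ((1 - 1 / (2 * p)) * (2 * p / (2 * p - 1)))"
    by (simp add: powr_powr)
  also have "(1 - 1 / (2 * p)) * (2 * p / (2 * p - 1)) = 1"
    using \<open>1 \<le> p\<close> by (simp add: field_simps)
  finally have "B powr (2 * p / (2 * p - 1)) < (\<alpha>0 - \<alpha>) / c"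
    using c \<open>\<alpha> < \<alpha>0\<close> by simp
  then have "c * B powr (2 * p / (2 * p - 1)) < \<alpha>0 - \<alpha>" using c by (simp add: field_simps)
  then show ?thesis unfolding c' .
qed

theorem theorem2p3:
  fixes \<tau> \<alpha>0 \<alpha> p c \<gamma> :: real
    and lam lam0 \<beta> :: "real \<Rightarrow> real"
    and S :: "real \<Rightarrow> L2 \<Rightarrow> L2"
    and C :: "(real \<Rightarrow> L2) \<Rightarrow> real"
  assumes "\<tau> > 0"
    and "in_Linf lam" and "in_Linf lam0"
    and "\<alpha>0 > 0" and "AE x in lebesgue. lam0 x \<ge> \<alpha>0"
    and "generates_C0_semigroup (A_op lam0) S"
    and "1 \<le> p" and "in_Lp p \<beta>"
    and "AE x in lebesgue. (exp \<tau> + 1) / 2 * \<bar>lam x\<bar> \<le> \<alpha> + \<beta> x"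
    and "0 \<le> \<alpha>" and "\<alpha> < \<alpha>0"
    and c_def: "c = (1 - 1 / (2 * p)) * (2 / p) powr (1 / (2 * p - 1))"
    and "Lp_norm p \<beta> < ((\<alpha>0 - \<alpha>) / c) powr (1 - 1 / (2 * p))"
    and \<gamma>_def: "\<gamma> = min (2 * (\<alpha>0 - \<alpha> - (2 * p - 1) / (2 * p) * (2 / p) powr (1 / (2 * p - 1))
                     * Lp_norm p \<beta> powr (2 * p / (2 * p - 1)))) 1"
    and C_def: "\<And>u0. C u0 = 1/2 * (norm (u0 0))\<^sup>2 +
                  1/2 * integral {-\<tau>..0}
                    (\<lambda>s. exp s * (LINT x|lebesgue. \<bar>lam x\<bar> * (rep_L2 (u0 s) x)\<^sup>2))"
  shows "exponentially_stable S lam \<tau> \<and>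
         \<gamma> > 0 \<and>
         (\<forall>u0 u. continuous_on {-\<tau>..0} u0 \<longrightarrow> mild_solution S lam \<tau> u0 u \<longrightarrow>
           C u0 = energy lam \<tau> u 0 \<and>
           (\<forall>t\<ge>0. energy lam \<tau> u t \<le> C u0 * exp (- \<gamma> * t)))"
proof -
  define \<kappa> where "\<kappa> = (2 * p - 1) / (2 * p) * (2 / p) powr (1 / (2 * p - 1)) * Lp_norm p \<beta> powr (2 * p / (2 * p - 1))"
  define \<delta> where "\<delta> = \<alpha>0 - \<alpha> - \<kappa>"
  have "\<kappa> < \<alpha>0 - \<alpha>"
    unfolding \<kappa>_def using assms(7,11,13) unfolding c_def
    by (intro decay_rate_positive) (auto simp: Lp_norm_def)
  then have \<delta>: "\<delta> > 0" by (simp add: \<delta>_def)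
  have \<gamma>_eq: "\<gamma> = min (2 * \<delta>) 1" by (simp add: \<gamma>_def \<delta>_def \<kappa>_def)
  define m where "m x = (exp \<tau> + 1) / 2 * \<bar>lam x\<bar>" for x
  have m: "in_Linf m" unfolding m_def by (intro in_Linf_const_mult in_Linf_abs assms(2))
  define Q where "Q v = L2_mult m v + \<delta> *\<^sub>R v" for v
  have Q_eq: "inner (Q v) v = (exp \<tau> + 1) / 2 * inner (L2_mult (\<lambda>x. \<bar>lam x\<bar>) v) v + \<delta> * (norm v)\<^sup>2" for v
  proof -
    have "inner (L2_mult m v) v = (exp \<tau> + 1) / 2 * inner (L2_mult (\<lambda>x. \<bar>lam x\<bar>) v) v"
      unfolding inner_L2_mult[OF m] inner_L2_mult[OF in_Linf_abs[OF assms(2)]]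
      by (subst integral_mult_right_zero[symmetric]) (simp add: m_def mult.assoc)
    then show ?thesis by (simp add: Q_def inner_add_left power2_norm_eq_inner)
  qed
  have Q_lin: "bounded_linear Q"
    unfolding Q_def[abs_def]
    by (intro bounded_linear_add bounded_linear_L2_mult m bounded_linear_scaleR_right)
  have Q_nonneg: "0 \<le> inner (Q v) v" for v
  proof -
    have "0 \<le> inner (L2_mult (\<lambda>x. \<bar>lam x\<bar>) v) v"
      unfolding inner_L2_mult[OF in_Linf_abs[OF assms(2)]]
      by (intro integral_nonneg_AE) (simp add: mult.assoc)
    then show ?thesis using \<delta> by (simp add: Q_eq)
  qed
  have dissip: "inner g v + inner (Q v) v \<le> 0" if "(v, g) \<in> infinitesimal_generator S" for v g
  proof -
    have "(v, g) \<in> A_op lam0" using assms(6) that by (simp add: generates_C0_semigroup_def)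
    then obtain v1 where v1: "has_weak_deriv 1 v v1" "inner g v \<le> - (norm v1)\<^sup>2 - \<alpha>0 * (norm v)\<^sup>2"
      using A_op_dissipative assms(3,5) by metis
    have "inner (L2_mult m v) v \<le> (norm v1)\<^sup>2 + (\<alpha> + \<kappa>) * (norm v)\<^sup>2"
      using potential_bound[OF v1(1) assms(7,8) m, of \<alpha>] assms(9)
      by (simp add: m_def \<kappa>_def mult.assoc)
    then show ?thesis
      using v1(2) by (simp add: Q_def inner_add_left \<delta>_def power2_norm_eq_inner algebra_simps)
  qed
  have C0: "C0_semigroup S" using assms(6) by (simp add: generates_C0_semigroup_def)
  interpret damped_delay_problem S Q lam \<tau> \<delta> \<gamma>
    by (intro damped_delay_problem.intro dissipative_semigroup.intro damped_delay_problem_axioms.intro)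
       (use C0 Q_lin Q_nonneg dissip assms(1,2) Q_eq \<gamma>_eq in auto)
  have init: "C u0 = energy lam \<tau> u 0" if "mild_solution S lam \<tau> u0 u" for u0 u
    using that energy_initial[OF assms(2,1), of u u0] by (simp add: C_def mild_solution_def)
  have decay: "energy lam \<tau> u t \<le> C u0 * exp (- \<gamma> * t)" if "mild_solution S lam \<tau> u0 u" "t \<ge> 0" for u0 u t
    using energy_decay[OF that] init[OF that(1)] by simp
  have "\<gamma> > 0" using \<delta> by (simp add: \<gamma>_eq)
  moreover from this have "exponentially_stable S lam \<tau>"
    unfolding exponentially_stable_def using decay by blast
  ultimately show ?thesis using init decay by blast
qed

end
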